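(* Let $k$ be a positive integer. Suppose the real numbers $\sigma$ and $\delta$ are chosen according to one of the following alternatives: (1) $\sigma\geq \frac{\sqrt{2}+1}{\sqrt{3}}$ and $\delta=2+\sigma+\frac{1}{3\sigma}$; (2) $\sigma = \frac{1}{3}\sqrt{\frac{5}{2}}$ and $\delta = 2+\frac{11}{3}\sqrt{\frac{1}{10}}$; (3) $\sigma = 0.2$ and $\delta=3.109$. Then every finite graph $G$ with average degree $\frac{2|E(G)|}{|V(G)|}\geq \delta k-1$ has a $(k+1)$-connected subgraph on more than $(1+\sigma)k$ vertices.
   Context: Graphs are finite and simple. A graph is $(k+1)$-connected if it has more than $k+1$ vertices and remains connected after deleting any set of at most $k$ vertices. *)

theory Defs
  imports Complex_Main "Graph_Theory.Digraph_Component"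
begin

text \<open>
  A finite simple graph is a structure satisfying \<^locale>\<open>graph\<close>, that is, a finite symmetric
  digraph without loops and multiple arcs.  Every undirected edge is thus represented by two
  opposite arcs, so edges are counted via their sets of endpoints.
\<close>

definition edges :: "('a, 'b) pre_digraph \<Rightarrow> 'a set set" where
  "edges G = {{tail G e, head G e} | e. e \<in> arcs G}"

definition average_degree :: "('a, 'b) pre_digraph \<Rightarrow> real" where
  "average_degree G = 2 * real (card (edges G)) / real (card (verts G))"

text \<open>
  The qualified name below avoids a clash with the topological notion of connectedness.
\<close>

definition vertex_connected :: "nat \<Rightarrow> ('a, 'b) pre_digraph \<Rightarrow> bool" where
  "vertex_connected l G \<longleftrightarrow>
     l < card (verts G) \<and>
     (\<forall>S \<subseteq> verts G. card S < l \<longrightarrow> Digraph_Component.connected (G \<restriction> (verts G - S)))"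

end

theory Submission
  imports Defs
begin

text \<open>
  Suppose there is no such subgraph.  Then every vertex set \<open>U\<close> with more than \<open>(1 + \<sigma>) k\<close> elements
  is a union of two proper subsets \<open>A\<close>, \<open>B\<close> with \<open>k\<close> common vertices and no edge between
  \<open>A - B\<close> and \<open>B - A\<close>.  Put \<open>y = |U| / k - 1\<close> and \<open>W U = (2 e + |U|) / k\<^sup>2 - \<delta> y\<close>, where \<open>e\<close> counts
  the edges inside \<open>U\<close>.  The degree condition says \<open>W V \<ge> \<delta>\<close>, and it is contradicted by showing
  \<open>W U \<le> 1\<close> for all \<open>U\<close> that are not too small, by induction on \<open>|U|\<close>.  Since \<open>W U = W A + W B - 1\<close> plus
  the density of nonadjacent pairs (holes) in \<open>A \<inter> B\<close>, the induction has to keep track of where the holes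
  are.  It is therefore carried out for a stronger statement: for every nonnegative
  positive semidefinite weight \<open>K\<close> on pairs of vertices that is bounded and has small mass, \<open>W U\<close> plus the
  \<open>K\<close>-weight of the holes is at most an affine function of the mass of \<open>K\<close>.  New weights on \<open>A\<close>
  and \<open>B\<close> that put extra weight on \<open>A \<inter> B\<close> pay for the overlap, and semidefiniteness
  bounds the weight between \<open>A - B\<close> and \<open>B - A\<close>, which is lost, by the weight inside these sets.  When a side
  is too small for the induction hypothesis, it is peeled off, or one uses that the holes of small sets
  already have large weight outside any such \<open>K\<close>.
\<close>

section \<open>Kernels and separations\<close>

text \<open>A plain bound \<open>W \<le> w\<close> survives the recursion
  \<open>W A + W B - 1 + h\<close>, where the density \<open>h\<close> of holes in the overlap may
  be as large as 1, only if \<open>w \<le> 0\<close>, whereas the direct estimates at the bottom of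
  the induction are positive; the weights let the hypotheses on \<open>A\<close> and
  \<open>B\<close> absorb \<open>h\<close>. Semidefiniteness is used only through test functions
  that are constant on a few blocks, with coefficients that often make the form vanish in the worst
  configuration. In the first alternative \<sigma> and \<open>1 / (3 * \<sigma>)\<close> are the
  roots of \<open>1 - \<gamma> * y + y\<^sup>2 = 2 / 3\<close>, which starts the induction, and the
  condition on \<sigma> amounts to \<open>sqrt (2 / 3) \<le> \<sigma>\<close> and
  \<open>2 * sqrt (2 / 3) \<le> \<gamma>\<close>, which is what peeling requires. In the other two a
  direct estimate must cover a whole interval of sizes before separations take over. It rests on
  lower bounds for the holes that \<open>K\<close> does not pay for, and most decimal constants are
  roundings made for these estimates. If \<open>\<sigma> * k < 1\<close>, which forces
  \<open>k \<le> 4\<close>, a finite recursion replaces the weights.\<close>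

definition kernel :: "('a \<Rightarrow> 'a \<Rightarrow> real) \<Rightarrow> bool" where
  "kernel K \<longleftrightarrow> (\<forall>x y. K x y = K y x) \<and> (\<forall>x y. 0 \<le> K x y) \<and>
     (\<forall>F f. finite F \<longrightarrow> 0 \<le> (\<Sum>x\<in>F. \<Sum>y\<in>F. f x * f y * K x y))"

definition on_set :: "'a set \<Rightarrow> ('a \<Rightarrow> 'a \<Rightarrow> real) \<Rightarrow> 'a \<Rightarrow> 'a \<Rightarrow> real" where
  "on_set S K x y = (if x \<in> S \<and> y \<in> S then K x y else 0)"

lemma kernel_sym: "kernel K \<Longrightarrow> K x y = K y x"
  and kernel_nonneg: "kernel K \<Longrightarrow> 0 \<le> K x y"
  and kernel_psd: "kernel K \<Longrightarrow> finite F \<Longrightarrow> 0 \<le> (\<Sum>x\<in>F. \<Sum>y\<in>F. f x * f y * K x y)"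
  by (auto simp: kernel_def)

lemma kernel_const: "0 \<le> c \<Longrightarrow> kernel (\<lambda>_ _. c)"
proof -
  assume c: "0 \<le> c"
  have "(\<Sum>x\<in>F. \<Sum>y\<in>F. f x * f y * c) = (\<Sum>x\<in>F. f x)\<^sup>2 * c" for F :: "'a set" and f
  proof -
    have "(\<Sum>x\<in>F. f x)\<^sup>2 * c = (\<Sum>x\<in>F. \<Sum>y\<in>F. f x * f y) * c"
      by (simp only: power2_eq_square sum_product)
    then show ?thesis by (simp only: sum_distrib_right)
  qed
  with c show ?thesis by (simp add: kernel_def)
qed

lemma kernel_add: "kernel K \<Longrightarrow> kernel L \<Longrightarrow> kernel (\<lambda>x y. K x y + L x y)"
  by (auto simp: kernel_def distrib_left sum.distrib)

lemma kernel_scale: "0 \<le> c \<Longrightarrow> kernel K \<Longrightarrow> kernel (\<lambda>x y. c * K x y)"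
proof -
  assume c: "0 \<le> c" and K: "kernel K"
  have "(\<Sum>x\<in>F. \<Sum>y\<in>F. f x * f y * (c * K x y)) = c * (\<Sum>x\<in>F. \<Sum>y\<in>F. f x * f y * K x y)"
    for F :: "'a set" and f
    by (simp add: sum_distrib_left mult.left_commute)
  with c K show ?thesis by (auto simp: kernel_def)
qed

lemma kernel_on_set: "kernel K \<Longrightarrow> kernel (on_set S K)"
proof -
  assume K: "kernel K"
  have "(\<Sum>x\<in>F. \<Sum>y\<in>F. f x * f y * on_set S K x y)
      = (\<Sum>x\<in>F. \<Sum>y\<in>F. (if x \<in> S then f x else 0) * (if y \<in> S then f y else 0) * K x y)"
    for F :: "'a set" and f
    by (intro sum.cong) (auto simp: on_set_def)
  then show ?thesis
    using K by (auto simp: kernel_def on_set_def)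
qed

locale sep_graph =
  fixes V :: "'a set" and adj :: "'a \<Rightarrow> 'a \<Rightarrow> bool" and k :: nat and \<sigma> \<gamma> :: real
  assumes finV: "finite V"
    and k_pos: "0 < k"
    and sigma_pos: "0 < \<sigma>"
    and adj_refl: "adj u u"
    and adj_sym: "adj u v \<Longrightarrow> adj v u"
    and separable: "U \<subseteq> V \<Longrightarrow> (1 + \<sigma>) * real k < real (card U) \<Longrightarrow>
       \<exists>A B. A \<union> B = U \<and> card (A \<inter> B) = k \<and> A \<noteq> U \<and> B \<noteq> U \<and> (\<forall>x\<in>A - B. \<forall>y\<in>B - A. \<not> adj x y)"
begin

section \<open>Masses, holes and the functional \<open>W\<close>\<close>

definition mass :: "('a \<Rightarrow> 'a \<Rightarrow> real) \<Rightarrow> 'a set \<Rightarrow> 'a set \<Rightarrow> real" where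
  "mass K X Y = (\<Sum>x\<in>X. \<Sum>y\<in>Y. K x y) / (real k)\<^sup>2"

definition nadj :: "'a \<Rightarrow> 'a \<Rightarrow> real" where
  "nadj x y = (if adj x y then 0 else 1)"

definition holes :: "('a \<Rightarrow> 'a \<Rightarrow> real) \<Rightarrow> 'a set \<Rightarrow> 'a set \<Rightarrow> real" where
  "holes K X Y = mass (\<lambda>x y. K x y * nadj x y) X Y"

definition excess :: "'a set \<Rightarrow> real" where
  "excess U = real (card U) / real k - 1"

text \<open>
  Here \<open>\<gamma>\<close> stands for \<open>\<delta> - 2\<close>.  Every vertex counts as adjacent to itself, so that by lemma \<open>W_adj\<close> below
  \<open>W U = (2 e + |U|) / k\<^sup>2 - \<delta> excess U\<close>.
\<close>

definition W :: "'a set \<Rightarrow> real" where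
  "W U = 1 - \<gamma> * excess U + (excess U)\<^sup>2 - holes (\<lambda>_ _. 1) U U"

definition separation :: "'a set \<Rightarrow> 'a set \<Rightarrow> 'a set \<Rightarrow> bool" where
  "separation U A B \<longleftrightarrow> A \<union> B = U \<and> card (A \<inter> B) = k \<and> A \<noteq> U \<and> B \<noteq> U \<and>
     (\<forall>x\<in>A - B. \<forall>y\<in>B - A. \<not> adj x y)"

lemma k0: "0 < real k" using k_pos by simp

lemma finite_sub: "U \<subseteq> V \<Longrightarrow> finite U" using finV finite_subset by blast

lemma mass_union_left: "finite X \<Longrightarrow> finite X' \<Longrightarrow> X \<inter> X' = {} \<Longrightarrow> mass K (X \<union> X') Y = mass K X Y + mass K X' Y"
  by (simp add: mass_def sum.union_disjoint add_divide_distrib)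

lemma mass_union_right: "finite Y \<Longrightarrow> finite Y' \<Longrightarrow> Y \<inter> Y' = {} \<Longrightarrow> mass K X (Y \<union> Y') = mass K X Y + mass K X Y'"
  by (simp add: mass_def sum.union_disjoint add_divide_distrib sum.distrib)

lemma mass_commute: "(\<And>x y. K x y = K y x) \<Longrightarrow> mass K X Y = mass K Y X"
  unfolding mass_def by (subst sum.swap) simp

lemma mass_mono: "(\<And>x y. x \<in> X \<Longrightarrow> y \<in> Y \<Longrightarrow> K x y \<le> L x y) \<Longrightarrow> mass K X Y \<le> mass L X Y"
  unfolding mass_def by (intro divide_right_mono sum_mono) auto

lemma mass_nonneg: "(\<And>x y. x \<in> X \<Longrightarrow> y \<in> Y \<Longrightarrow> 0 \<le> K x y) \<Longrightarrow> 0 \<le> mass K X Y"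
  unfolding mass_def by (intro divide_nonneg_nonneg sum_nonneg) auto

lemma mass_add: "mass (\<lambda>x y. K x y + L x y) X Y = mass K X Y + mass L X Y"
  by (simp add: mass_def sum.distrib add_divide_distrib)

lemma mass_scale: "mass (\<lambda>x y. c * K x y) X Y = c * mass K X Y"
  by (simp add: mass_def sum_distrib_left[symmetric])

lemma mass_const: "mass (\<lambda>_ _. c) X Y = c * (real (card X) / real k) * (real (card Y) / real k)"
  by (simp add: mass_def power2_eq_square)

lemma mass_on_set: "finite X \<Longrightarrow> finite Y \<Longrightarrow> mass (on_set S K) X Y = mass K (X \<inter> S) (Y \<inter> S)"
proof -
  assume fin: "finite X" "finite Y"
  have "(\<Sum>y\<in>Y. on_set S K x y) = (if x \<in> S then (\<Sum>y\<in>Y \<inter> S. K x y) else 0)" for x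
    using fin by (auto simp: on_set_def sum.inter_restrict)
  then show ?thesis
    using sum.inter_restrict[OF fin(1), of "\<lambda>x. \<Sum>y\<in>Y \<inter> S. K x y" S] by (simp add: mass_def)
qed

text \<open>Semidefiniteness tested on \<open>s\<close> times the indicator of \<open>X\<close> plus
  \<open>t\<close> times that of \<open>Y\<close>. The sets may overlap, which is needed when a
  single vertex is tested against a set containing it.\<close>

lemma mass_quad:
  assumes K: "kernel K" and "finite X" "finite Y"
  shows "0 \<le> s\<^sup>2 * mass K X X + 2 * s * t * mass K X Y + t\<^sup>2 * mass K Y Y"
proof -
  define F where "F = X \<union> Y"
  define f where "f x = (if x \<in> X then s else 0) + (if x \<in> Y then t else 0)" for x
  have [simp]: "finite F" and XF: "F \<inter> X = X" "F \<inter> Y = Y" using assms by (auto simp: F_def)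
  have D: "mass (\<lambda>x y. (if x \<in> P then 1 else 0) * (if y \<in> Q then 1 else 0) * K x y) F F = mass K P Q"
    if "F \<inter> P = P" "F \<inter> Q = Q" for P Q
  proof -
    have "(\<Sum>y\<in>F. (if x \<in> P then 1 else 0) * (if y \<in> Q then 1 else 0) * K x y)
        = (if x \<in> P then (\<Sum>y\<in>Q. K x y) else 0)" for x
    proof -
      have "(\<Sum>y\<in>F. (if y \<in> Q then 1 else 0) * K x y) = (\<Sum>y\<in>F. if y \<in> Q then K x y else 0)"
        by (intro sum.cong) auto
      also have "\<dots> = (\<Sum>y\<in>Q. K x y)"
        using that(2) sum.inter_restrict[of F "\<lambda>y. K x y" Q] by simp
      finally show ?thesis by simp
    qed
    then show ?thesis using that(1) sum.inter_restrict[of F "\<lambda>x. (\<Sum>y\<in>Q. K x y)" P] by (simp add: mass_def)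
  qed
  have "0 \<le> (\<Sum>x\<in>F. \<Sum>y\<in>F. f x * f y * K x y) / (real k)\<^sup>2"
    using kernel_psd[OF K] by simp
  also have "\<dots> = mass (\<lambda>x y. f x * f y * K x y) F F" by (simp add: mass_def)
  also have "(\<lambda>x y. f x * f y * K x y) = (\<lambda>x y. 
       (s\<^sup>2 * ((if x \<in> X then 1 else 0) * (if y \<in> X then 1 else 0) * K x y)
      + s * t * ((if x \<in> X then 1 else 0) * (if y \<in> Y then 1 else 0) * K x y))
      + (s * t * ((if x \<in> Y then 1 else 0) * (if y \<in> X then 1 else 0) * K x y)
      + t\<^sup>2 * ((if x \<in> Y then 1 else 0) * (if y \<in> Y then 1 else 0) * K x y)))"
    by (intro ext) (auto simp: f_def power2_eq_square algebra_simps)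
  also have "mass \<dots> F F = s\<^sup>2 * mass K X X + s * t * mass K X Y + (s * t * mass K Y X + t\<^sup>2 * mass K Y Y)"
    unfolding mass_add mass_scale using XF by (simp only: D)
  finally show ?thesis
    using mass_commute[of K Y X] kernel_sym[OF K] by (simp add: algebra_simps)
qed


section \<open>Separations and their three blocks\<close>

lemma separation_exists:
  assumes "U \<subseteq> V" "\<sigma> < excess U"
  obtains A B where "separation U A B"
proof -
  have "(1 + \<sigma>) * real k < real (card U)"
    using assms(2) k0 by (simp add: excess_def field_simps)
  then show ?thesis using separable[OF assms(1)] that unfolding separation_def by blast
qed

lemma separation_swap: "separation U A B \<Longrightarrow> separation U B A"
  unfolding separation_def using adj_sym by (metis Int_commute Un_commute)

lemma separation_ordered:
  assumes "U \<subseteq> V" "\<sigma> < excess U"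
  obtains A B where "separation U A B" "excess B \<le> excess A"
  using separation_exists[OF assms] separation_swap by (metis linear)

lemma separation_parts:
  assumes S: "separation U A B" and U: "U \<subseteq> V"
  shows "A \<subseteq> U" "B \<subseteq> U" "A \<subseteq> V" "B \<subseteq> V" "finite A" "finite B" "finite U"
    and "A \<inter> B \<subseteq> V" "card A < card U" "card B < card U"
    and "real (card (B - A)) / real k = excess B" "real (card (A - B)) / real k = excess A"
    and "0 < excess A" "0 < excess B" "excess A + excess B = excess U"
proof -
  show sub: "A \<subseteq> U" "B \<subseteq> U" using S by (auto simp: separation_def)
  with U show "A \<subseteq> V" "B \<subseteq> V" "A \<inter> B \<subseteq> V" by auto
  then show fin: "finite A" "finite B" "finite U" using finite_sub U by auto
  have uni: "A \<union> B = U" and k: "card (A \<inter> B) = k" and ne: "A \<noteq> U" "B \<noteq> U"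
    using S by (auto simp: separation_def)
  show "card A < card U" "card B < card U" using sub ne fin psubset_card_mono by blast+
  have "card (B - A) = card B - card (A \<inter> B)" "card (A \<inter> B) \<le> card B"
    using card_Diff_subset_Int[of B A] fin by (auto simp: Int_commute card_mono)
  then have cB: "card B = card (B - A) + k" using k by simp
  have "card (A - B) = card A - card (A \<inter> B)" "card (A \<inter> B) \<le> card A"
    using card_Diff_subset_Int[of A B] fin by (auto simp: card_mono)
  then have cA: "card A = card (A - B) + k" using k by simp
  show "real (card (B - A)) / real k = excess B" "real (card (A - B)) / real k = excess A"
    using k0 by (simp_all add: excess_def cA cB field_simps)
  moreover have "B - A \<noteq> {}" "A - B \<noteq> {}" using uni ne by auto
  then have "0 < card (B - A)" "0 < card (A - B)" using fin by (auto simp: card_gt_0_iff)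
  ultimately show "0 < excess A" "0 < excess B"
    using k0 by (metis divide_pos_pos of_nat_0_less_iff)+
  have "card U + card (A \<inter> B) = card A + card B" using uni card_Un_Int[OF fin(1,2)] by simp
  then have "real (card U) + real k = real (card A) + real (card B)" using k by linarith
  then have "(real (card U) + real k) / real k = (real (card A) + real (card B)) / real k" by simp
  then show "excess A + excess B = excess U" using k0 by (simp add: excess_def add_divide_distrib)
qed

lemma nadj_sym: "nadj x y = nadj y x" using adj_sym by (auto simp: nadj_def)
lemma nadj_bounds: "0 \<le> nadj x y" "nadj x y \<le> 1" by (auto simp: nadj_def)

lemma block_sum:
  assumes S: "separation U A B" and U: "U \<subseteq> V" and sym: "\<And>x y. K x y = K y x"
  shows "mass K A A = mass K (A - B) (A - B) + mass K (A \<inter> B) (A \<inter> B) + 2 * mass K (A - B) (A \<inter> B)"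
    and "mass K B B = mass K (B - A) (B - A) + mass K (A \<inter> B) (A \<inter> B) + 2 * mass K (B - A) (A \<inter> B)"
    and "mass K U U = mass K (B - A) (B - A) + mass K (A - B) (A - B) + mass K (A \<inter> B) (A \<inter> B)
      + 2 * mass K (B - A) (A - B) + 2 * mass K (B - A) (A \<inter> B) + 2 * mass K (A - B) (A \<inter> B)"
    and "mass K (B - A) A = mass K (B - A) (A - B) + mass K (B - A) (A \<inter> B)"
    and "mass K (A - B) B = mass K (B - A) (A - B) + mass K (A - B) (A \<inter> B)"
proof -
  let ?X = "B - A" and ?Y = "A - B" and ?T = "A \<inter> B"
  have fin: "finite ?X" "finite ?Y" "finite ?T" using separation_parts[OF S U] by auto
  have A: "A = ?Y \<union> ?T" and B: "B = ?X \<union> ?T" and UU: "U = (?X \<union> ?Y) \<union> ?T"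
    using S by (auto simp: separation_def)
  have c: "mass K P Q = mass K Q P" for P Q using mass_commute[of K] sym by blast
  note l = mass_union_left mass_union_right
  have d: "?Y \<inter> ?T = {}" "?X \<inter> ?T = {}" "?X \<inter> ?Y = {}" "(?X \<union> ?Y) \<inter> ?T = {}" by auto
  have "mass K (?Y \<union> ?T) (?Y \<union> ?T) = mass K ?Y ?Y + mass K ?T ?T + 2 * mass K ?Y ?T"
    using fin d c[of ?T ?Y] by (simp add: l)
  then show "mass K A A = mass K ?Y ?Y + mass K ?T ?T + 2 * mass K ?Y ?T" using A by simp
  have "mass K (?X \<union> ?T) (?X \<union> ?T) = mass K ?X ?X + mass K ?T ?T + 2 * mass K ?X ?T"
    using fin d c[of ?T ?X] by (simp add: l)
  then show "mass K B B = mass K ?X ?X + mass K ?T ?T + 2 * mass K ?X ?T" using B by simp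
  have "mass K ((?X \<union> ?Y) \<union> ?T) ((?X \<union> ?Y) \<union> ?T) = mass K ?X ?X + mass K ?Y ?Y + mass K ?T ?T
      + 2 * mass K ?X ?Y + 2 * mass K ?X ?T + 2 * mass K ?Y ?T"
    using fin d c[of ?T ?X] c[of ?T ?Y] c[of ?Y ?X] by (simp add: l finite_Un)
  then show "mass K U U = mass K ?X ?X + mass K ?Y ?Y + mass K ?T ?T
      + 2 * mass K ?X ?Y + 2 * mass K ?X ?T + 2 * mass K ?Y ?T" using UU by simp
  have "mass K ?X (?Y \<union> ?T) = mass K ?X ?Y + mass K ?X ?T" using fin d by (simp add: l)
  then show "mass K ?X A = mass K ?X ?Y + mass K ?X ?T" using A by simp
  have "mass K ?Y (?X \<union> ?T) = mass K ?Y ?X + mass K ?Y ?T" using fin d by (simp add: l)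
  then show "mass K ?Y B = mass K ?X ?Y + mass K ?Y ?T" using B c[of ?Y ?X] by simp
qed

text \<open>All pairs between \<open>B - A\<close> and \<open>A - B\<close> are holes, so the cross
  term is the full mass of \<open>K\<close> there; this is the weight that neither side of the
  separation sees.\<close>

lemma holes_block:
  assumes S: "separation U A B" and U: "U \<subseteq> V" and sym: "\<And>x y. K x y = K y x"
  shows "holes K U U = holes K A A + holes K B B - holes K (A \<inter> B) (A \<inter> B) + 2 * mass K (B - A) (A - B)"
    and "holes K A A = holes K (A - B) (A - B) + holes K (A \<inter> B) (A \<inter> B) + 2 * holes K (A - B) (A \<inter> B)"
    and "holes K B B = holes K (B - A) (B - A) + holes K (A \<inter> B) (A \<inter> B) + 2 * holes K (B - A) (A \<inter> B)"
proof -
  let ?H = "\<lambda>x y. K x y * nadj x y"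
  have s: "?H x y = ?H y x" for x y using sym nadj_sym by metis
  note bl = block_sum[OF S U, of ?H, OF s]
  have "?H x y = K x y" if "x \<in> B - A" "y \<in> A - B" for x y
  proof -
    have "\<not> adj x y" using S that adj_sym unfolding separation_def by blast
    then show ?thesis by (simp add: nadj_def)
  qed
  then have "mass ?H (B - A) (A - B) = mass K (B - A) (A - B)"
    unfolding mass_def by (intro arg_cong2[of _ _ _ _ "(/)"] sum.cong refl) auto
  then show "holes K U U = holes K A A + holes K B B - holes K (A \<inter> B) (A \<inter> B) + 2 * mass K (B - A) (A - B)"
    unfolding holes_def bl(1-3) by simp
  show "holes K A A = holes K (A - B) (A - B) + holes K (A \<inter> B) (A \<inter> B) + 2 * holes K (A - B) (A \<inter> B)"
    "holes K B B = holes K (B - A) (B - A) + holes K (A \<inter> B) (A \<inter> B) + 2 * holes K (B - A) (A \<inter> B)"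
    unfolding holes_def bl(1,2) by auto
qed

lemma holes_mono: "(\<And>x y. x \<in> X \<Longrightarrow> y \<in> Y \<Longrightarrow> K x y \<le> L x y) \<Longrightarrow> holes K X Y \<le> holes L X Y"
  unfolding holes_def by (intro mass_mono mult_right_mono) (auto simp: nadj_bounds)

lemma holes_nonneg: "(\<And>x y. x \<in> X \<Longrightarrow> y \<in> Y \<Longrightarrow> 0 \<le> K x y) \<Longrightarrow> 0 \<le> holes K X Y"
  unfolding holes_def by (intro mass_nonneg mult_nonneg_nonneg) (auto simp: nadj_bounds)

lemma holes_le_mass: "(\<And>x y. x \<in> X \<Longrightarrow> y \<in> Y \<Longrightarrow> 0 \<le> K x y) \<Longrightarrow> holes K X Y \<le> mass K X Y"
  unfolding holes_def by (intro mass_mono) (auto simp: nadj_def)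

lemma holes_add: "holes (\<lambda>x y. K x y + L x y) X Y = holes K X Y + holes L X Y"
  by (simp add: holes_def mass_add distrib_right)

lemma holes_scale: "holes (\<lambda>x y. c * K x y) X Y = c * holes K X Y"
  using mass_scale[of c "\<lambda>x y. K x y * nadj x y" X Y] by (simp add: holes_def mult.assoc)

lemma holes_on_set: "finite X \<Longrightarrow> finite Y \<Longrightarrow> holes (on_set S K) X Y = holes K (X \<inter> S) (Y \<inter> S)"
proof -
  assume f: "finite X" "finite Y"
  have "(\<lambda>x y. on_set S K x y * nadj x y) = on_set S (\<lambda>x y. K x y * nadj x y)"
    by (intro ext) (simp add: on_set_def)
  then show ?thesis using mass_on_set[OF f, of S "\<lambda>x y. K x y * nadj x y"] by (simp add: holes_def)
qed

definition deficit :: "('a \<Rightarrow> 'a \<Rightarrow> real) \<Rightarrow> 'a set \<Rightarrow> real" where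
  "deficit K U = holes (\<lambda>_ _. 1) U U - holes K U U"

lemma deficit_nonneg: "(\<And>x y. K x y \<le> 1) \<Longrightarrow> 0 \<le> deficit K U"
  unfolding deficit_def using holes_mono[of U U K "\<lambda>_ _. 1"] by simp

lemma W_plus_holes: "W U + holes K U U = 1 - \<gamma> * excess U + (excess U)\<^sup>2 - deficit K U"
  by (simp add: W_def deficit_def)

lemma mass_one_block:
  assumes S: "separation U A B" and U: "U \<subseteq> V"
  shows "mass (\<lambda>_ _. c) (B - A) (A - B) = c * excess A * excess B"
    and "mass (\<lambda>_ _. c) (A \<inter> B) (A \<inter> B) = c"
    and "mass (\<lambda>_ _. c) (B - A) (B - A) = c * (excess B)\<^sup>2"
    and "mass (\<lambda>_ _. c) (A - B) (A - B) = c * (excess A)\<^sup>2"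
  using separation_parts(11,12)[OF S U] S k0 unfolding mass_const separation_def
  by (simp_all add: power2_eq_square)

end

section \<open>Deficits and gluing\<close>

lemmas monomials = ring_distribs add_divide_distrib diff_divide_distrib mult_ac power2_eq_square
  times_divide_eq_left times_divide_eq_right mult_1_left mult_1_right
  mult_minus_left mult_minus_right minus_minus

text \<open>The numbers \<open>p\<close>, \<open>r\<close>, \<open>t\<close> are the masses inside
  \<open>B - A\<close>, \<open>A - B\<close> and \<open>A \<inter> B\<close>; \<open>q\<close> is
  the mass between the first two, and \<open>u\<close> and \<open>v\<close> are the masses from
  \<open>B - A\<close> and from \<open>A - B\<close> to the overlap. The last two inequalities are
  semidefiniteness tested on the indicator of \<open>B - A\<close> minus that of \<open>A\<close>,
  and of \<open>A - B\<close> minus that of \<open>B\<close>.\<close>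

definition block_masses :: "real \<Rightarrow> real \<Rightarrow> real \<Rightarrow> real \<Rightarrow> real \<Rightarrow> real \<Rightarrow> real \<Rightarrow> real \<Rightarrow> real \<Rightarrow> bool" where
  "block_masses D a b p r t q u v \<longleftrightarrow>
    0 \<le> p \<and> 0 \<le> r \<and> 0 \<le> t \<and> 0 \<le> q \<and> 0 \<le> u \<and> 0 \<le> v \<and>
    p \<le> D * b\<^sup>2 \<and> r \<le> D * a\<^sup>2 \<and> q \<le> D * (a * b) \<and> t \<le> D \<and>
    (\<forall>s z. 0 \<le> s\<^sup>2 * p + 2 * s * z * q + z\<^sup>2 * r) \<and>
    2 * (q + u) \<le> p + (r + t + 2 * v) \<and> 2 * (q + v) \<le> r + (p + t + 2 * u)"

text \<open>The test function is \<open>a\<close> on \<open>B - A\<close> and \<open>- b\<close> on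
  \<open>A - B\<close>. It has sum zero, so the form vanishes on the constant weight 1, and the
  inequality for \<open>K\<close> can be rewritten for the gaps \<open>b\<^sup>2 - p\<close>,
  \<open>a\<^sup>2 - r\<close>, \<open>a * b - q\<close> between \<open>K\<close> and 1.\<close>

lemma weighted_square:
  assumes "block_masses D a b p r t q u v"
  shows "a\<^sup>2 * (b\<^sup>2 - p) + b\<^sup>2 * (a\<^sup>2 - r) \<le> 2 * a * b * (a * b - q)"
proof -
  have "0 \<le> a\<^sup>2 * p + 2 * a * (- b) * q + (- b)\<^sup>2 * r"
    using assms unfolding block_masses_def by blast
  then show ?thesis unfolding power2_eq_square by ((simp only: monomials)?; linarith)
qed

context sep_graph begin

section \<open>Deficits of separated sets\<close>

lemma deficit_alt: "deficit K U = holes (\<lambda>x y. 1 - K x y) U U"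
proof -
  have "holes (\<lambda>x y. 1 - K x y) U U + holes K U U = holes (\<lambda>x y. (1 - K x y) + K x y) U U"
    by (simp only: holes_add)
  then show ?thesis by (simp add: deficit_def)
qed

lemma deficit_block:
  assumes S: "separation U A B" and U: "U \<subseteq> V" and K: "kernel K" "\<And>x y. K x y \<le> 1"
  shows "2 * (excess A * excess B - mass K (B - A) (A - B)) + deficit K A \<le> deficit K U"
    and "2 * (excess A * excess B - mass K (B - A) (A - B)) + deficit K B \<le> deficit K U"
proof -
  let ?L = "\<lambda>x y. 1 - K x y"
  have s: "?L x y = ?L y x" for x y using kernel_sym[OF K(1)] by simp
  note b = holes_block[OF S U, of ?L, OF s]
  have n: "0 \<le> holes ?L P Q" for P Q using K(2) by (intro holes_nonneg) simp
  have "mass ?L (B - A) (A - B) + mass K (B - A) (A - B) = mass (\<lambda>x y. ?L x y + K x y) (B - A) (A - B)"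
    by (simp only: mass_add)
  also have "\<dots> = excess A * excess B" using mass_one_block(1)[OF S U, of 1] by simp
  finally have o: "mass ?L (B - A) (A - B) = excess A * excess B - mass K (B - A) (A - B)" by simp
show "2 * (excess A * excess B - mass K (B - A) (A - B)) + deficit K A \<le> deficit K U"
    unfolding deficit_alt using b o n[of "B - A" "B - A"] n[of "B - A" "A \<inter> B"] n[of "A - B" "A - B"] n[of "A - B" "A \<inter> B"]
    by ((simp only: monomials)?; linarith)
  show "2 * (excess A * excess B - mass K (B - A) (A - B)) + deficit K B \<le> deficit K U"
    unfolding deficit_alt using b o n[of "B - A" "B - A"] n[of "B - A" "A \<inter> B"] n[of "A - B" "A - B"] n[of "A - B" "A \<inter> B"]
    by ((simp only: monomials)?; linarith)
qed

text \<open>Write \<open>1 - K\<close> as \<open>(1 - D) + D * (1 - K / D)\<close>: a weight bounded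
  by \<open>D\<close> leaves the fraction \<open>1 - D\<close> of every hole unpaid, and the rest is
  the deficit of a weight bounded by 1.\<close>

lemma deficit_scaled:
  assumes "0 < D"
  shows "deficit K U = (1 - D) * deficit (\<lambda>_ _. 0) U + D * deficit (\<lambda>x y. K x y / D) U"
  using assms holes_scale[of "1 / D" K U U] holes_scale[of 0 K U U] by (simp add: deficit_def algebra_simps)

lemma kernel_blocks:
  assumes S: "separation U A B" and U: "U \<subseteq> V" and K: "kernel K" and D: "\<And>x y. K x y \<le> D"
  obtains p r t q u v where
    "mass K (B - A) (B - A) = p" "mass K (A - B) (A - B) = r" "mass K (A \<inter> B) (A \<inter> B) = t"
    "mass K (B - A) (A - B) = q"
    "mass K A A = r + t + 2 * v" "mass K B B = p + t + 2 * u"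
    "mass K U U = p + r + t + 2 * q + 2 * u + 2 * v"
    "block_masses D (excess A) (excess B) p r t q u v"
proof -
  define p where "p = mass K (B - A) (B - A)"
  define r where "r = mass K (A - B) (A - B)"
  define t where "t = mass K (A \<inter> B) (A \<inter> B)"
  define q where "q = mass K (B - A) (A - B)"
  define u where "u = mass K (B - A) (A \<inter> B)"
  define v where "v = mass K (A - B) (A \<inter> B)"
  have fin: "finite A" "finite B" using separation_parts[OF S U] by auto
  note bl = block_sum[OF S U, of K, OF kernel_sym[OF K], folded p_def r_def t_def q_def u_def v_def]
  have nn: "0 \<le> mass K P Q" for P Q using kernel_nonneg[OF K] by (intro mass_nonneg)
  have le: "mass K P Q \<le> mass (\<lambda>_ _. D) P Q" for P Q using D by (intro mass_mono)
  have qd: "\<And>s z. 0 \<le> s\<^sup>2 * p + 2 * s * z * q + z\<^sup>2 * r"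
    unfolding p_def q_def r_def using fin by (intro mass_quad[OF K]) auto
  have "0 \<le> 1\<^sup>2 * p + 2 * 1 * (-1) * mass K (B - A) A + (-1)\<^sup>2 * mass K A A"
    unfolding p_def using fin by (intro mass_quad[OF K]) auto
  then have e1: "2 * (q + u) \<le> p + (r + t + 2 * v)" using bl by simp
  have "0 \<le> 1\<^sup>2 * r + 2 * 1 * (-1) * mass K (A - B) B + (-1)\<^sup>2 * mass K B B"
    unfolding r_def using fin by (intro mass_quad[OF K]) auto
  then have e2: "2 * (q + v) \<le> r + (p + t + 2 * u)" using bl by simp
  note m1 = mass_one_block[OF S U, of D]
  show ?thesis
    by (rule that[OF p_def[symmetric] r_def[symmetric] t_def[symmetric] q_def[symmetric]])
      (use bl nn le[of "B - A" "B - A"] le[of "A - B" "A - B"] le[of "A \<inter> B" "A \<inter> B"] le[of "B - A" "A - B"] m1 qd e1 e2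
        in \<open>auto simp: block_masses_def p_def r_def t_def q_def u_def v_def mult.assoc\<close>)
qed

text \<open>Peeling off \<open>B\<close> proves a factor \<open>g\<close> as soon as \<open>g *
  (b\<^sup>2 - p) + 2 * g * (a * b - q) \<le> 2 * (a * b - q)\<close>. By
  \<open>weighted_square\<close> and \<open>2 * a * b \<le> a\<^sup>2 + b\<^sup>2\<close>, one of
  \<open>b\<^sup>2 - p\<close> and \<open>a\<^sup>2 - r\<close> is at most \<open>a * b - q\<close>,
  so peeling off the right side works for \<open>3 * g \<le> 2\<close>.\<close>

lemma deficit_two_thirds:
  assumes U: "U \<subseteq> V" "0 \<le> excess U" and K: "kernel K" "\<And>x y. K x y \<le> 1"
  shows "2 / 3 * ((excess U)\<^sup>2 - \<sigma>\<^sup>2 - mass K U U) \<le> deficit K U"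
  using U
proof (induction "card U" arbitrary: U rule: less_induct)
  case less
  show ?case
  proof (cases "\<sigma> < excess U")
    case False
    have "(excess U)\<^sup>2 \<le> \<sigma>\<^sup>2" using False less.prems by (intro power_mono) auto
    moreover have "0 \<le> mass K U U" using kernel_nonneg[OF K(1)] by (intro mass_nonneg)
    ultimately show ?thesis using deficit_nonneg[of K U, OF K(2)] by ((simp only: monomials)?; linarith)
  next
    case True
    then obtain A B where S: "separation U A B" using separation_exists less.prems by blast
    note pt = separation_parts[OF S less.prems(1)]
    define a where "a = excess A" define b where "b = excess B"
    obtain p r t q u v where
      "mass K (B - A) (B - A) = p" "mass K (A - B) (A - B) = r" "mass K (A \<inter> B) (A \<inter> B) = t"
      and q: "mass K (B - A) (A - B) = q"
      and m: "mass K A A = r + t + 2 * v" "mass K B B = p + t + 2 * u"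
        "mass K U U = p + r + t + 2 * q + 2 * u + 2 * v"
      and bm: "block_masses 1 a b p r t q u v"
      unfolding a_def b_def by (rule kernel_blocks[OF S less.prems(1) K])
    have nn: "0 \<le> u" "0 \<le> v" "0 \<le> t" "q \<le> a * b" using bm by (auto simp: block_masses_def)
    have ab: "0 < a" "0 < b" "excess U = a + b" using pt by (auto simp: a_def b_def)
    have A: "2 / 3 * (a\<^sup>2 - \<sigma>\<^sup>2 - (r + t + 2 * v)) \<le> deficit K A"
      using less.hyps[of A] pt m unfolding a_def by auto
    have B: "2 / 3 * (b\<^sup>2 - \<sigma>\<^sup>2 - (p + t + 2 * u)) \<le> deficit K B"
      using less.hyps[of B] pt m unfolding b_def by auto
    have d: "2 * (a * b - q) + deficit K A \<le> deficit K U" "2 * (a * b - q) + deficit K B \<le> deficit K U"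
      using deficit_block[OF S less.prems(1) K] q by (auto simp: a_def b_def)
    have w: "a\<^sup>2 * (b\<^sup>2 - p) + b\<^sup>2 * (a\<^sup>2 - r) \<le> 2 * a * b * (a * b - q)"
      using weighted_square[OF bm] .
    have "b\<^sup>2 - p \<le> a * b - q \<or> a\<^sup>2 - r \<le> a * b - q"
    proof (rule ccontr)
      assume "\<not> ?thesis"
      then have "a\<^sup>2 * (a * b - q) < a\<^sup>2 * (b\<^sup>2 - p)" "b\<^sup>2 * (a * b - q) < b\<^sup>2 * (a\<^sup>2 - r)"
        using ab by auto
      then have "(a\<^sup>2 + b\<^sup>2) * (a * b - q) < 2 * a * b * (a * b - q)" using w by (simp add: distrib_right)
      moreover have "2 * a * b * (a * b - q) \<le> (a\<^sup>2 + b\<^sup>2) * (a * b - q)"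
        using nn sum_squares_bound[of a b] by (intro mult_right_mono) auto
      ultimately show False by linarith
    qed
    moreover have "(a + b)\<^sup>2 = a\<^sup>2 + 2 * (a * b) + b\<^sup>2" by (simp add: power2_sum)
    ultimately show ?thesis using A B d m nn ab(3) by auto
  qed
qed


section \<open>Peeling, gluing and joining\<close>

text \<open>Of the holes meeting \<open>B - A\<close> only those towards \<open>A - B\<close> are
  counted. They turn the term \<open>2 * excess A * excess B\<close> of the square into
  \<open>2 * mass K (B - A) (A - B)\<close>.\<close>

lemma peel:
  assumes S: "separation U A B" and U: "U \<subseteq> V" and K: "kernel K" "\<And>x y. K x y \<le> 1"
  shows "W U + holes K U U \<le> W A + holes K A A - excess B * (\<gamma> - excess B) + 2 * mass K (B - A) (A - B)"
proof -
  have y: "excess U = excess A + excess B" using separation_parts[OF S U] by simp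
  show ?thesis
    unfolding W_plus_holes y using deficit_block(1)[OF S U K] unfolding power2_eq_square by ((simp only: monomials)?; linarith)
qed

lemma W_separation:
  assumes S: "separation U A B" and U: "U \<subseteq> V"
  shows "W U = W A + W B - 1 + holes (\<lambda>_ _. 1) (A \<inter> B) (A \<inter> B)"
proof -
  have y: "excess U = excess A + excess B" using separation_parts[OF S U] by simp
  show ?thesis
    unfolding W_def y holes_block(1)[OF S U refl] mass_one_block(1)[OF S U] power2_eq_square by ((simp only: monomials)?; linarith)
qed

lemma holes_one_le:
  assumes S: "separation U A B" and U: "U \<subseteq> V"
  shows "holes (\<lambda>_ _. 1) (A \<inter> B) (A \<inter> B) \<le> 1"
  using holes_le_mass[of "A \<inter> B" "A \<inter> B" "\<lambda>_ _. 1"] mass_one_block(2)[OF S U, of 1] by simp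

text \<open>
  The weight used on the side \<open>A\<close>: on pairs meeting \<open>A \<inter> B\<close>, which occur on both sides, only a fraction of
  \<open>K\<close> is kept, and the constant \<open>\<mu>\<close> on \<open>A \<inter> B\<close> pays for the overlap being counted twice.
\<close>

definition glue :: "real \<Rightarrow> real \<Rightarrow> ('a \<Rightarrow> 'a \<Rightarrow> real) \<Rightarrow> 'a set \<Rightarrow> 'a set \<Rightarrow> 'a \<Rightarrow> 'a \<Rightarrow> real" where
  "glue \<alpha> \<mu> K A B x y = \<alpha> * K x y + (1 - \<alpha>) * on_set (A - B) K x y + \<mu> * on_set (A \<inter> B) (\<lambda>_ _. 1) x y"

lemma kernel_glue: "kernel K \<Longrightarrow> 0 \<le> \<alpha> \<Longrightarrow> \<alpha> \<le> 1 \<Longrightarrow> 0 \<le> \<mu> \<Longrightarrow> kernel (glue \<alpha> \<mu> K A B)"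
  unfolding glue_def[abs_def] by (intro kernel_add kernel_scale kernel_on_set kernel_const) auto

lemma glue_le:
  assumes "\<And>x y. K x y \<le> D" "kernel K" "0 \<le> \<alpha>" "\<alpha> \<le> 1" "D \<le> D'" "\<alpha> * D + \<mu> \<le> D'"  "0 \<le> \<mu>"
  shows "glue \<alpha> \<mu> K A B x y \<le> D'"
proof -
  have 1: "\<alpha> * K x y \<le> \<alpha> * D" using assms by (intro mult_left_mono) auto
  have 2: "\<alpha> * K x y + (1 - \<alpha>) * K x y \<le> D" using assms(1)[of x y] by ((simp only: monomials)?; linarith)
  show ?thesis using 1 2 assms by (auto simp: glue_def on_set_def)
qed

lemma glue_mass:
  assumes S: "separation U A B" and U: "U \<subseteq> V"
  shows "mass (glue \<alpha> \<mu> K A B) A A = \<alpha> * mass K A A + (1 - \<alpha>) * mass K (A - B) (A - B) + \<mu>"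
    and "holes (glue \<alpha> \<mu> K A B) A A = \<alpha> * holes K A A + (1 - \<alpha>) * holes K (A - B) (A - B)
      + \<mu> * holes (\<lambda>_ _. 1) (A \<inter> B) (A \<inter> B)"
proof -
  have f: "finite A" using separation_parts[OF S U] by simp
  have i: "A \<inter> (A - B) = A - B" "A \<inter> (A \<inter> B) = A \<inter> B" by auto
  show "mass (glue \<alpha> \<mu> K A B) A A = \<alpha> * mass K A A + (1 - \<alpha>) * mass K (A - B) (A - B) + \<mu>"
    using mass_one_block(2)[OF S U, of 1]
    by (simp add: glue_def[abs_def] mass_add mass_scale mass_on_set[OF f f] i)
  show "holes (glue \<alpha> \<mu> K A B) A A = \<alpha> * holes K A A + (1 - \<alpha>) * holes K (A - B) (A - B)
      + \<mu> * holes (\<lambda>_ _. 1) (A \<inter> B) (A \<inter> B)"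
    by (simp add: glue_def[abs_def] holes_add holes_scale holes_on_set[OF f f] i)
qed

text \<open>Moving the masses to the left turns every \<open>holes - mass\<close> into minus the
  weight on adjacent pairs. As \<open>W U - W A - W B\<close> is minus the density of adjacent pairs
  in the overlap, the claim compares weights of adjacent pairs block by block: the overlap is where
  \<open>\<alpha> + \<beta> \<le> 1\<close> and \<open>\<mu> + \<nu> \<le> 1\<close> are needed, and
  between \<open>A - B\<close> and \<open>B - A\<close> no pair is adjacent.\<close>

lemma split_bound:
  assumes S: "separation U A B" and U: "U \<subseteq> V" and K: "kernel K"
    and c: "\<alpha> \<le> 1" "\<beta> \<le> 1" "\<alpha> + \<beta> \<le> 1" "\<mu> + \<nu> \<le> 1"
    and L: "L = glue \<alpha> \<mu> K A B" and M: "M = glue \<beta> \<nu> K B A"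
  shows "W U + holes K U U \<le> (W A + holes L A A) + (W B + holes M B B)
     + mass K U U - mass L A A - mass M B B"
proof -
  note S' = separation_swap[OF S]
  note s = kernel_sym[OF K]
  note hb = holes_block[OF S U s]
  note bs = block_sum[OF S U s]
  have c2: "mass K (A - B) (B - A) = mass K (B - A) (A - B)" using mass_commute[of K] s by blast
  have h: "holes K P Q \<le> mass K P Q" for P Q using kernel_nonneg[OF K] by (intro holes_le_mass)
  let ?T = "A \<inter> B"
  let ?e = "holes (\<lambda>_ _. 1) ?T ?T"
  have 1: "0 \<le> (1 - \<mu> - \<nu>) * (1 - ?e)"
    using holes_one_le[OF S U] c by (intro mult_nonneg_nonneg) auto
  have 2: "0 \<le> (1 - \<alpha> - \<beta>) * (mass K ?T ?T - holes K ?T ?T)"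
    using h c by (intro mult_nonneg_nonneg) auto
  have 3: "0 \<le> (1 - \<alpha>) * (mass K (A - B) ?T - holes K (A - B) ?T)"
    using h c by (intro mult_nonneg_nonneg) auto
  have 4: "0 \<le> (1 - \<beta>) * (mass K (B - A) ?T - holes K (B - A) ?T)"
    using h c by (intro mult_nonneg_nonneg) auto
  show ?thesis
    unfolding L M glue_mass[OF S U] glue_mass[OF S' U] hb(1) W_separation[OF S U] Int_commute[of B A]
    unfolding bs(1-3) hb(2,3)
    using 1 2 3 4 by ((simp only: monomials)?; linarith)
qed

text \<open>An alternative to gluing that assumes no bound on \<open>W A\<close> or
  \<open>W B\<close>. It says that for \<open>J = 1 / 2 - K\<close>, which is nonnegative, twice the
  \<open>J\<close>-weight of the holes in the overlap is at most the sum of their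
  \<open>J\<close>-weights in \<open>A\<close> and in \<open>B\<close>.\<close>

lemma join_bound:
  assumes S: "separation U A B" and U: "U \<subseteq> V" and K: "kernel K" "\<And>x y. K x y \<le> 1 / 2"
    and L: "L = on_set (A \<inter> B) K"
  shows "W U + holes K U U \<le> 1 - \<gamma> * excess U + (excess A)\<^sup>2 + (excess B)\<^sup>2
     - deficit L A / 2 - deficit L B / 2 + 2 * mass K (B - A) (A - B)"
proof -
  note s = kernel_sym[OF K(1)]
  let ?J = "\<lambda>x y. 1 / 2 - K x y"
  have sJ: "?J x y = ?J y x" for x y using s by simp
  note hb = holes_block[OF S U s]
  note hJ = holes_block[OF S U, of ?J, OF sJ]
  let ?T = "A \<inter> B"
  have f: "finite A" "finite B" using separation_parts[OF S U] by auto
  have i: "A \<inter> ?T = ?T" "B \<inter> ?T = ?T" by auto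
  have lin: "holes ?J P P = holes (\<lambda>_ _. 1) P P / 2 - holes K P P" for P
  proof -
    have "holes ?J P P + holes K P P = holes (\<lambda>x y. ?J x y + K x y) P P" by (simp only: holes_add)
    also have "\<dots> = holes (\<lambda>x y. 1 / 2 * 1) P P" by simp
    also have "\<dots> = 1 / 2 * holes (\<lambda>_ _. 1) P P" by (simp only: holes_scale)
    finally show ?thesis by simp
  qed
  have n: "0 \<le> holes ?J P Q" for P Q using K(2) by (intro holes_nonneg) simp
  have le: "holes ?J ?T ?T \<le> holes ?J A A" "holes ?J ?T ?T \<le> holes ?J B B"
    using hJ(2,3) n[of "A - B" "A - B"] n[of "A - B" ?T] n[of "B - A" "B - A"] n[of "B - A" ?T] by auto
  have y: "excess U = excess A + excess B" using separation_parts[OF S U] by simp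
  have d: "deficit L A = holes (\<lambda>_ _. 1) A A - holes K ?T ?T" "deficit L B = holes (\<lambda>_ _. 1) B B - holes K ?T ?T"
    unfolding deficit_def L holes_on_set[OF f(1) f(1)] holes_on_set[OF f(2) f(2)] i by auto
  show ?thesis
    unfolding hb(1) W_separation[OF S U] d unfolding W_def y
    using le[unfolded lin] by ((simp only: monomials)?; linarith)
qed

end

section \<open>The first alternative\<close>

text \<open>Two affine functions, the first nonnegative at 0, the second at 1, and their sum
  nonnegative throughout, are nonnegative at a common point: take 1, or else the zero of the
  first.\<close>

lemma linear_balance:
  fixes c0 c1 d0 d1 :: real
  assumes "0 \<le> c0" "0 \<le> d0 + d1" and s: "\<And>x. 0 \<le> x \<Longrightarrow> x \<le> 1 \<Longrightarrow> 0 \<le> (c0 + c1 * x) + (d0 + d1 * x)"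
  obtains x where "0 \<le> x" "x \<le> 1" "0 \<le> c0 + c1 * x" "0 \<le> d0 + d1 * x"
proof (cases "0 \<le> c0 + c1")
  case True
  then show ?thesis using that[of 1] assms by simp
next
  case False
  define x where "x = c0 / (- c1)"
  have c1: "c1 < 0" using False assms by linarith
  have x: "0 \<le> x" "x \<le> 1" using False c1 assms by (auto simp: x_def divide_simps)
  moreover have "c0 + c1 * x = 0" using c1 by (simp add: x_def)
  ultimately show ?thesis using that[of x] s[of x] by simp
qed

lemma block_massesD:
  assumes "block_masses D a b p r t q u v"
  shows "0 \<le> p" "0 \<le> r" "0 \<le> t" "0 \<le> q" "0 \<le> u" "0 \<le> v"
    "p \<le> D * b\<^sup>2" "r \<le> D * a\<^sup>2" "q \<le> D * (a * b)" "t \<le> D"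
    "2 * (q + u) \<le> p + (r + t + 2 * v)" "2 * (q + v) \<le> r + (p + t + 2 * u)"
  using assms by (auto simp: block_masses_def)

lemma block_masses_quad: "block_masses D a b p r t q u v \<Longrightarrow> 0 \<le> s\<^sup>2 * p + 2 * s * z * q + z\<^sup>2 * r"
  by (auto simp: block_masses_def)

text \<open>The last two inequalities of \<open>block_masses\<close>, combined with the coefficients
  \<alpha> and \<open>1 - \<alpha>\<close>. The right-hand side is the total mass of the two glued
  weights before the constants on the overlap are added.\<close>

lemma glued_mass_ge:
  assumes bm: "block_masses D a b p r t q u v" and \<alpha>: "0 \<le> \<alpha>" "\<alpha> \<le> 1"
  shows "(p + r + t + 2 * q + 2 * u + 2 * v) / 2 \<le> (r + \<alpha> * (t + 2 * v)) + (p + (1 - \<alpha>) * (t + 2 * u))"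
proof -
  have "0 \<le> \<alpha> * (p + (r + t + 2 * v) - 2 * (q + u))"
    "0 \<le> (1 - \<alpha>) * (r + (p + t + 2 * u) - 2 * (q + v))"
    using block_massesD(11,12)[OF bm] \<alpha> by auto
  then show ?thesis by ((simp only: monomials)?; linarith)
qed

context sep_graph begin

text \<open>The value \<open>2 / 3\<close> reproduces itself: for \<open>m\<close> the mass of
  \<open>K\<close>, both glued weights are given mass \<open>1 / 3 + m / 2\<close>, which stays
  below \<open>2 / 3\<close>, and \<open>2 * (2 / 3) + m - 2 * (1 / 3 + m / 2) = 2 / 3\<close>.
  Sides smaller than \<tau> are peeled off.\<close>

lemma bound_case1:
  assumes c: "0 < c" "c\<^sup>2 = 2 / 3" "c \<le> \<sigma>" "2 * c \<le> \<gamma>" and \<tau>: "\<tau> * \<sigma> = 1 / 3" and \<gamma>: "\<gamma> = \<sigma> + \<tau>"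
    and U: "U \<subseteq> V" "\<tau> \<le> excess U"
    and K: "kernel K" "\<And>x y. K x y \<le> 1" "mass K U U \<le> 2 / 3"
  shows "W U + holes K U U \<le> 2 / 3"
  using U K
proof (induction "card U" arbitrary: U K rule: less_induct)
  case less
  note K = less.prems(3,4,5)
  have \<tau>0: "0 < \<tau>" using \<tau> sigma_pos by (metis zero_less_mult_pos2 divide_pos_pos zero_less_numeral zero_less_one)
  \<comment> \<open>Here \<open>\<tau> * \<sigma> = 1 / 3 = c\<^sup>2 / 2\<close>. The outcome
    \<open>2 * \<tau> \<le> c \<le> \<sigma>\<close> guarantees that at most one side of a
    separation is smaller than \<tau>.\<close>
  have "\<tau> * c \<le> \<tau> * \<sigma>" using c \<tau>0 by simp
  then have "\<tau> * c \<le> c / 2 * c" using \<tau> c(2) by (simp add: power2_eq_square)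
  then have \<tau>c: "2 * \<tau> \<le> c" using c(1) by simp
  show ?case
  proof (cases "\<sigma> < excess U")
    case False
    \<comment> \<open>The product is \<open>2 / 3 - (1 - \<gamma> * y + y\<^sup>2)\<close> for
      \<open>y = excess U\<close>, as \<open>\<gamma> = \<sigma> + \<tau>\<close> and
      \<open>\<sigma> * \<tau> = 1 / 3\<close>.\<close>
    have "0 \<le> (excess U - \<tau>) * (\<sigma> - excess U)" using False less.prems by auto
    moreover have "\<gamma> * excess U = (\<sigma> + \<tau>) * excess U" using \<gamma> by simp
    ultimately show ?thesis
      using \<tau> deficit_nonneg[of K U, OF K(2)] unfolding W_plus_holes by ((simp only: monomials)?; linarith)
  next
    case True
    then obtain A B where S: "separation U A B" using separation_exists less.prems by blast
    have peeled: ?thesis if S: "separation U A B" and b: "excess B < \<tau>" for A B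
    proof -
      note pt = separation_parts[OF S less.prems(1)]
      define a where "a = excess A" define b where "b = excess B"
      have ab: "0 < a" "0 < b" "excess U = a + b" "b < \<tau>" using pt b by (auto simp: a_def b_def)
      obtain p r t q u v where
        "mass K (B - A) (B - A) = p" "mass K (A - B) (A - B) = r" "mass K (A \<inter> B) (A \<inter> B) = t"
        and q: "mass K (B - A) (A - B) = q"
        and m: "mass K A A = r + t + 2 * v" "mass K B B = p + t + 2 * u"
          "mass K U U = p + r + t + 2 * q + 2 * u + 2 * v"
        and bm: "block_masses 1 a b p r t q u v"
        unfolding a_def b_def by (rule kernel_blocks[OF S less.prems(1) K(1,2)])
      note nn = block_massesD[OF bm]
      have "\<tau> \<le> a" using ab True \<tau>c c by linarith
      then have A: "W A + holes K A A \<le> 2 / 3"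
        using less.hyps[of A K] pt K m nn by (auto simp: a_def)
      have r: "r \<le> c\<^sup>2 - p - 2 * q" using m(3) K(3) nn c(2) by linarith
      \<comment> \<open>The coefficients annihilate the worst case \<open>p = b\<^sup>2\<close>,
        \<open>q = b * (c - b)\<close>, \<open>r = (c - b)\<^sup>2\<close>: weight 1 on
        \<open>c * k\<close> vertices that include \<open>B - A\<close>, of mass
        \<open>c\<^sup>2 = 2 / 3\<close>.\<close>
      have "0 \<le> (c - b)\<^sup>2 * p + 2 * (c - b) * (- b) * q + (- b)\<^sup>2 * r"
        by (rule block_masses_quad[OF bm])
      moreover have "b\<^sup>2 * r \<le> b\<^sup>2 * (c\<^sup>2 - p - 2 * q)" using r by (intro mult_left_mono) auto
      ultimately have "0 \<le> (c - b)\<^sup>2 * p + 2 * (c - b) * (- b) * q + b\<^sup>2 * (c\<^sup>2 - p - 2 * q)" by simp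
      also have "\<dots> = c * ((c - 2 * b) * p + b\<^sup>2 * c - 2 * b * q)" by algebra
      finally have "2 * b * q \<le> (c - 2 * b) * p + b\<^sup>2 * c" using c(1) by (simp add: zero_le_mult_iff)
      also have "\<dots> \<le> (c - 2 * b) * b\<^sup>2 + b\<^sup>2 * c"
        using ab \<tau>c nn(7) by (intro add_mono mult_left_mono) auto
      also have "\<dots> = 2 * b * (b * (c - b))" by algebra
      finally have "2 * b * q \<le> 2 * b * (b * (c - b))" .
      then have "2 * q \<le> 2 * (b * (c - b))" using ab by simp
      also have "\<dots> \<le> b * (\<gamma> - b)" using mult_left_mono[OF c(4), of b] ab zero_le_square[of b]
        by ((simp only: monomials)?; linarith)
      finally show ?thesis
        using peel[OF S less.prems(1) K(1,2)] A q by (simp add: b_def)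
    qed
    consider "excess B < \<tau>" | "excess A < \<tau>" | "\<tau> \<le> excess A" "\<tau> \<le> excess B" by linarith
    then show ?thesis
    proof cases
      case 1 then show ?thesis using peeled[OF S] by simp
    next
      case 2 then show ?thesis using peeled[OF separation_swap[OF S]] by simp
    next
      case 3
      note pt = separation_parts[OF S less.prems(1)]
      note S' = separation_swap[OF S]
      obtain p r t q u v where
        p: "mass K (B - A) (B - A) = p" "mass K (A - B) (A - B) = r" "mass K (A \<inter> B) (A \<inter> B) = t"
        and q: "mass K (B - A) (A - B) = q"
        and m: "mass K A A = r + t + 2 * v" "mass K B B = p + t + 2 * u"
          "mass K U U = p + r + t + 2 * q + 2 * u + 2 * v"
        and bm: "block_masses 1 (excess A) (excess B) p r t q u v"
        by (rule kernel_blocks[OF S less.prems(1) K(1,2)])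
      note nn = block_massesD[OF bm]
      define m where "m = p + r + t + 2 * q + 2 * u + 2 * v"
      have m23: "m \<le> 2 / 3" using m(3) K(3) by (simp add: m_def)
      define pA where "pA x = r + x * (t + 2 * v)" for x
      define pB where "pB x = p + (1 - x) * (t + 2 * u)" for x
      have half: "m / 2 \<le> pA x + pB x" if "0 \<le> x" "x \<le> 1" for x
        using glued_mass_ge[OF bm that] by (simp add: m_def pA_def pB_def)
      \<comment> \<open>The constants on the overlap are determined by the prescribed masses. What
        remains is that both glued weights stay below 1, that is,
        \<open>\<alpha> + \<mu> \<le> 1\<close> and \<open>(1 - \<alpha>) + \<nu> \<le> 1\<close>,
        two affine conditions on \<alpha>.\<close>
      obtain \<alpha> where \<alpha>: "0 \<le> \<alpha>" "\<alpha> \<le> 1" and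
        "0 \<le> (2 / 3 + r - m / 2) + (t + 2 * v - 1) * \<alpha>"
        "0 \<le> (p + t + 2 * u - 1 / 3 - m / 2) + (1 - (t + 2 * u)) * \<alpha>"
      proof (rule linear_balance)
        show "0 \<le> 2 / 3 + r - m / 2" using m23 nn by linarith
        show "0 \<le> p + t + 2 * u - 1 / 3 - m / 2 + (1 - (t + 2 * u))" using m23 nn by linarith
        show "0 \<le> 2 / 3 + r - m / 2 + (t + 2 * v - 1) * x + (p + t + 2 * u - 1 / 3 - m / 2 + (1 - (t + 2 * u)) * x)"
          if "0 \<le> x" "x \<le> 1" for x
          using half[OF that] m23 unfolding pA_def pB_def by ((simp only: monomials)?; linarith)
      qed
      then have f: "\<alpha> + (1 / 3 + m / 2 - pA \<alpha>) \<le> 1" "(1 - \<alpha>) + (1 / 3 + m / 2 - pB \<alpha>) \<le> 1"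
        unfolding pA_def pB_def by ((simp only: monomials)?; linarith)+
      define \<mu> where "\<mu> = 1 / 3 + m / 2 - pA \<alpha>"
      define \<nu> where "\<nu> = 1 / 3 + m / 2 - pB \<alpha>"
      have "\<alpha> * (t + 2 * v) \<le> t + 2 * v" "(1 - \<alpha>) * (t + 2 * u) \<le> t + 2 * u"
        using \<alpha> nn by (auto intro!: mult_left_le_one_le)
      then have "pA \<alpha> \<le> 1 / 3 + m / 2" "pB \<alpha> \<le> 1 / 3 + m / 2"
        using m23 nn(1-6) unfolding pA_def pB_def m_def by ((simp only: monomials)?; linarith)+
      then have \<mu>0: "0 \<le> \<mu>" "0 \<le> \<nu>" by (simp_all add: \<mu>_def \<nu>_def)
      have \<mu>\<nu>: "\<mu> + \<nu> \<le> 1" using half[OF \<alpha>] m23 unfolding \<mu>_def \<nu>_def by linarith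
      define L where "L = glue \<alpha> \<mu> K A B"
      define M where "M = glue (1 - \<alpha>) \<nu> K B A"
      have massL: "mass L A A = 1 / 3 + m / 2"
        unfolding L_def glue_mass[OF S less.prems(1)] m p \<mu>_def pA_def by (simp add: algebra_simps)
      have massM: "mass M B B = 1 / 3 + m / 2"
        unfolding M_def glue_mass[OF S' less.prems(1)] m p \<nu>_def pB_def by (simp add: algebra_simps)
      have L: "kernel L" "\<And>x y. L x y \<le> 1"
        unfolding L_def using \<alpha> \<mu>0 f(1)[folded \<mu>_def]
        by (simp_all add: kernel_glue[OF K(1)] glue_le[OF K(2,1)])
      have M: "kernel M" "\<And>x y. M x y \<le> 1"
        unfolding M_def using \<alpha> \<mu>0 f(2)[folded \<nu>_def]
        by (simp_all add: kernel_glue[OF K(1)] glue_le[OF K(2,1)])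
      have "W A + holes L A A \<le> 2 / 3"
        using less.hyps[of A L, OF pt(9,3) 3(1) L] massL m23 by simp
      moreover have "W B + holes M B B \<le> 2 / 3"
        using less.hyps[of B M, OF pt(10,4) 3(2) M] massM m23 by simp
      moreover have "W U + holes K U U \<le> (W A + holes L A A) + (W B + holes M B B) + mass K U U - mass L A A - mass M B B"
        using split_bound[OF S less.prems(1) K(1) _ _ _ \<mu>\<nu> L_def M_def] \<alpha> by simp
      moreover have "mass K U U = m" using m by (simp add: m_def)
      ultimately show ?thesis using massL massM by linarith
    qed
  qed
qed

end

section \<open>Good sets: the induction hypothesis shared by the second and third
  alternatives\<close>

section \<open>The third alternative\<close>

context sep_graph begin

definition good :: "'a set \<Rightarrow> bool" where
  "good U \<longleftrightarrow> (\<forall>K. kernel K \<longrightarrow> (\<forall>x y. K x y \<le> 1 / 2) \<longrightarrow> mass K U U \<le> 1 / 2 \<longrightarrow>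
     W U + holes K U U \<le> 1 / 4 + mass K U U / 2)"

lemma goodD:
  "good U \<Longrightarrow> kernel K \<Longrightarrow> (\<And>x y. K x y \<le> 1 / 2) \<Longrightarrow> mass K U U \<le> 1 / 2 \<Longrightarrow>
     W U + holes K U U \<le> 1 / 4 + mass K U U / 2"
  by (auto simp: good_def)

text \<open>The bound at mass \<open>1 / 2\<close> is \<open>1 / 2\<close>, and the constant
  \<open>1 / 2\<close> on the overlap has mass exactly \<open>1 / 2\<close>. Adding the two sides
  gives \<open>W U \<le> 0\<close>, after which \<open>holes \<le> mass\<close> suffices because the
  mass is at most \<open>1 / 2\<close>.\<close>

lemma good_glue:
  assumes S: "separation U A B" and U: "U \<subseteq> V" and g: "good A" "good B"
  shows "good U"
  unfolding good_def
proof (intro allI impI)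
  fix K :: "'a \<Rightarrow> 'a \<Rightarrow> real"
  assume K: "kernel K" "\<forall>x y. K x y \<le> 1 / 2" "mass K U U \<le> 1 / 2"
  define L where "L = on_set (A \<inter> B) (\<lambda>_ _. 1 / 2 :: real)"
  have L: "kernel L" "\<And>x y. L x y \<le> 1 / 2"
    unfolding L_def by (auto intro!: kernel_on_set kernel_const) (auto simp: on_set_def)
  have f: "finite A" "finite B" using separation_parts[OF S U] by auto
  have i: "A \<inter> (A \<inter> B) = A \<inter> B" "B \<inter> (A \<inter> B) = A \<inter> B" by auto
  have m: "mass L A A = 1 / 2" "mass L B B = 1 / 2"
    unfolding L_def mass_on_set[OF f(1) f(1)] mass_on_set[OF f(2) f(2)] i
    using mass_one_block(2)[OF S U] by auto
  have "holes (\<lambda>_ _. 1 / 2) (A \<inter> B) (A \<inter> B) = 1 / 2 * holes (\<lambda>_ _. 1) (A \<inter> B) (A \<inter> B)"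
    using holes_scale[of "1 / 2" "\<lambda>_ _. 1"] by simp
  then have h: "holes L A A = holes (\<lambda>_ _. 1) (A \<inter> B) (A \<inter> B) / 2" "holes L B B = holes (\<lambda>_ _. 1) (A \<inter> B) (A \<inter> B) / 2"
    unfolding L_def holes_on_set[OF f(1) f(1)] holes_on_set[OF f(2) f(2)] i by auto
  have "W U \<le> 0"
    using goodD[OF g(1) L] goodD[OF g(2) L] unfolding m h W_separation[OF S U] by simp
  moreover have "holes K U U \<le> mass K U U" using kernel_nonneg[OF K(1)] by (intro holes_le_mass)
  ultimately show "W U + holes K U U \<le> 1 / 4 + mass K U U / 2" using K(3) by simp
qed

lemma good_peel:
  assumes S: "separation U A B" and U: "U \<subseteq> V" and g: "good A"
    and b: "excess B \<le> 1 / 2 \<and> 1 \<le> \<gamma> \<or> 1 / 12 \<le> excess B * (\<gamma> - excess B)"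
  shows "good U"
  unfolding good_def
proof (intro allI impI)
  fix K :: "'a \<Rightarrow> 'a \<Rightarrow> real"
  assume K: "kernel K" and K1: "\<forall>x y. K x y \<le> 1 / 2" and K2: "mass K U U \<le> 1 / 2"
  have Kle: "K x y \<le> 1 / 2" "K x y \<le> 1" for x y using K1 by (auto intro: order_trans[where y="1/2"])
  define b where "b = excess B"
  have b0: "0 < b" using separation_parts[OF S U] by (simp add: b_def)
  obtain p r t q u v where
    "mass K (B - A) (B - A) = p" "mass K (A - B) (A - B) = r" "mass K (A \<inter> B) (A \<inter> B) = t"
    and q: "mass K (B - A) (A - B) = q"
    and m: "mass K A A = r + t + 2 * v" "mass K B B = p + t + 2 * u"
      "mass K U U = p + r + t + 2 * q + 2 * u + 2 * v"
    and bm: "block_masses (1 / 2) (excess A) b p r t q u v"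
    unfolding b_def by (rule kernel_blocks[OF S U K Kle(1)])
  note nn = block_massesD[OF bm]
  \<comment> \<open>Peeling costs \<open>2 * q\<close> and gains \<open>b * (\<gamma> - b)\<close>,
    while the right-hand side of the bound drops by at least \<open>p / 2 + q\<close> when
    \<open>U\<close> is replaced by \<open>A\<close>.\<close>
  have "q \<le> p / 2 + b * (\<gamma> - b)"
  proof (cases "b \<le> 1 / 2 \<and> 1 \<le> \<gamma>")
    case True
    have "0 \<le> 1\<^sup>2 * p + 2 * 1 * (- b) * q + (- b)\<^sup>2 * r" by (rule block_masses_quad[OF bm])
    moreover have "b\<^sup>2 * r \<le> b\<^sup>2 * (1 / 2)" using K2 m nn by (intro mult_left_mono) auto
    ultimately have "b * (2 * q) \<le> b * b" using nn(7) by (simp add: power2_eq_square)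
    then have "2 * q \<le> b" using b0 by simp
    moreover have "b * (1 / 2) \<le> b * (\<gamma> - b)" using True b0 by (intro mult_left_mono) auto
    ultimately show ?thesis using nn by linarith
  next
    case False
    \<comment> \<open>Together with \<open>p + r + 2 * q \<le> 1 / 2\<close> this gives
      \<open>q \<le> p / 2 + 1 / 12\<close>, whence the threshold \<open>1 / 12\<close>.\<close>
    have "0 \<le> 2\<^sup>2 * p + 2 * 2 * (- 1) * q + (- 1)\<^sup>2 * r" by (rule block_masses_quad[OF bm])
    then have "2 * q - p \<le> 1 / 6" using K2 m nn by (simp add: power2_eq_square)
    then show ?thesis using False b by (auto simp: b_def)
  qed
  moreover have "W A + holes K A A \<le> 1 / 4 + (r + t + 2 * v) / 2"
    using goodD[OF g K] Kle K2 m nn by simp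
  ultimately show "W U + holes K U U \<le> 1 / 4 + mass K U U / 2"
    using peel[OF S U K Kle(2)] nn(5) unfolding q m(3) b_def[symmetric] by (simp add: add_divide_distrib)
qed

text \<open>For a side \<open>B\<close> of intermediate size, not known to be good but with a direct
  bound for all weights up to 1. The weight on \<open>A\<close> is made as massive as goodness
  allows, and \<open>B\<close> receives the remaining constant on the overlap.\<close>

lemma good_attach:
  assumes S: "separation U A B" and U: "U \<subseteq> V" and g: "good A"
    and B: "\<And>L. kernel L \<Longrightarrow> (\<And>x y. L x y \<le> 1) \<Longrightarrow> W B + holes L B B \<le> c + s * mass L B B"
    and s: "0 \<le> s" "s \<le> 1" "c + 3 / 4 * s \<le> 3 / 4"
  shows "good U"
  unfolding good_def
proof (intro allI impI)
  fix K :: "'a \<Rightarrow> 'a \<Rightarrow> real"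
  assume K: "kernel K" and K1: "\<forall>x y. K x y \<le> 1 / 2" and K2: "mass K U U \<le> 1 / 2"
  have Kle: "K x y \<le> 1 / 2" for x y using K1 by auto
  note S' = separation_swap[OF S]
  obtain p r t q u v where
    p: "mass K (B - A) (B - A) = p" "mass K (A - B) (A - B) = r" "mass K (A \<inter> B) (A \<inter> B) = t"
    and q: "mass K (B - A) (A - B) = q"
    and mA: "mass K A A = r + t + 2 * v" and mB: "mass K B B = p + t + 2 * u"
    and mU: "mass K U U = p + r + t + 2 * q + 2 * u + 2 * v"
    and bm: "block_masses (1 / 2) (excess A) (excess B) p r t q u v"
    by (rule kernel_blocks[OF S U K Kle])
  note nn = block_massesD[OF bm]
  define m where "m = p + r + t + 2 * q + 2 * u + 2 * v"
  have m: "m \<le> 1 / 2" using mU K2 by (simp add: m_def)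
  \<comment> \<open>With this choice the glued weight on \<open>A\<close> has mass exactly
    \<open>1 / 2\<close> and is bounded by \<open>\<rho> / 2 + (1 - \<rho>) / 2 = 1 / 2\<close>. If
    the denominator is 0, then \<open>r = 0\<close>, and division by zero yields the value
    \<open>\<rho> = 0\<close>, which also fits.\<close>
  define \<rho> where "\<rho> = r / (1 / 2 - t - 2 * v)"
  have d: "0 \<le> 1 / 2 - t - 2 * v" "r \<le> 1 / 2 - t - 2 * v" using m nn(1-6) unfolding m_def by linarith+
  have \<rho>: "0 \<le> \<rho>" "\<rho> \<le> 1" using d nn unfolding \<rho>_def by (auto intro: divide_le_eq_1[THEN iffD2])
  have \<rho>r: "\<rho> * (1 / 2 - t - 2 * v) = r" using d nn(2) unfolding \<rho>_def by (cases "1 / 2 - t - 2 * v = 0") auto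
  define L where "L = glue \<rho> ((1 - \<rho>) / 2) K A B"
  define M where "M = glue (1 - \<rho>) ((1 + \<rho>) / 2) K B A"
  have massL: "mass L A A = 1 / 2"
    using \<rho>r unfolding L_def glue_mass[OF S U] mA p by ((simp only: monomials)?; linarith)
  have massM: "mass M B B = p + (1 - \<rho>) * (t + 2 * u) + (1 + \<rho>) / 2"
    unfolding M_def glue_mass[OF S' U] mB p by ((simp only: monomials)?; linarith)
  have L: "kernel L" unfolding L_def using \<rho> by (intro kernel_glue[OF K]) auto
  have L_le: "L x y \<le> 1 / 2" for x y
    unfolding L_def by (rule glue_le[OF Kle K]) (use \<rho> in \<open>auto simp: field_simps\<close>)
  have M: "kernel M" unfolding M_def using \<rho> by (intro kernel_glue[OF K]) auto
  have M_le: "M x y \<le> 1" for x y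
    unfolding M_def by (rule glue_le[OF Kle K]) (use \<rho> in \<open>auto simp: field_simps\<close>)
  have 1: "W A + holes L A A \<le> 1 / 2" using goodD[OF g L L_le] massL by simp
  have 2: "W B + holes M B B \<le> c + s * mass M B B" using B M M_le by simp
  have 3: "W U + holes K U U \<le> (W A + holes L A A) + (W B + holes M B B) + mass K U U - mass L A A - mass M B B"
    using \<rho> by (intro split_bound[OF S U K _ _ _ _ L_def M_def]) (auto simp: field_simps)
  have "m / 2 \<le> r + \<rho> * (t + 2 * v) + (p + (1 - \<rho>) * (t + 2 * u))"
    using glued_mass_ge[OF bm \<rho>] unfolding m_def .
  then have 4: "(1 + m) / 2 \<le> mass M B B" using \<rho>r unfolding massM by ((simp only: monomials)?; linarith)
  have "0 \<le> (1 - s) * (mass M B B - (1 + m) / 2)" "0 \<le> s * (1 / 2 - m)"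
    using 4 s m by auto
  moreover have "mass K U U = m" using mU by (simp add: m_def)
  ultimately show "W U + holes K U U \<le> 1 / 4 + mass K U U / 2"
    using 1 2 3 massL s by ((simp only: monomials)?; linarith)
qed

lemma two_thirds_bound:
  assumes "U \<subseteq> V" "0 \<le> excess U" "kernel K" "\<And>x y. K x y \<le> 1"
  shows "W U + holes K U U \<le> 1 - \<gamma> * excess U + (excess U)\<^sup>2 / 3 + 2 / 3 * \<sigma>\<^sup>2 + 2 / 3 * mass K U U"
  unfolding W_plus_holes using deficit_two_thirds[OF assms] by ((simp only: monomials)?; linarith)

text \<open>The numbers \<open>12308 / 10000\<close> and \<open>20962 / 10000\<close> are the
  rounded roots of \<open>f y = 1 / 6\<close>; between them the direct estimate suffices, since
  \<open>1 / 6 + 2 / 3 * m \<le> 1 / 4 + m / 2\<close> for \<open>m \<le> 1 / 2\<close>. Larger sets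
  are separated, and the treatment depends on the sizes of the two sides.\<close>

lemma good_case3:
  assumes \<sigma>: "\<sigma> = 1 / 5" and \<gamma>: "\<gamma> = 1109 / 1000"
    and U: "U \<subseteq> V" "12308 / 10000 \<le> excess U"
  shows "good U"
  using U
proof (induction "card U" arbitrary: U rule: less_induct)
  case less
  have \<gamma>1: "1 \<le> \<gamma>" by (simp add: \<gamma>)
  define f where "f y = 1 - 1109 / 1000 * y + y\<^sup>2 / 3 + 2 / 75" for y :: real
  have direct: "W U + holes K U U \<le> f (excess U) + 2 / 3 * mass K U U"
    if "U \<subseteq> V" "0 \<le> excess U" "kernel K" "\<And>x y. K x y \<le> 1" for U K
    using two_thirds_bound[OF that] by (simp add: \<sigma> \<gamma> f_def power2_eq_square)
  show ?case
  proof (cases "excess U \<le> 20962 / 10000")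
    case True
    have "0 \<le> (excess U - 12308 / 10000) * (20962 / 10000 - excess U)" using True less.prems by auto
    then have "f (excess U) \<le> 1 / 6" unfolding f_def by ((simp only: monomials)?; linarith)
    moreover have "W U + holes K U U \<le> f (excess U) + 2 / 3 * mass K U U"
      if "kernel K" "\<forall>x y. K x y \<le> 1 / 2" for K
      using less.prems that by (intro direct) (auto intro: order_trans[where y="1/2"])
    ultimately show ?thesis unfolding good_def by fastforce
  next
    case False
    have "\<sigma> < excess U" using False \<sigma> by simp
    then obtain A B where S: "separation U A B" and le: "excess B \<le> excess A"
      using separation_ordered less.prems by blast
    note pt = separation_parts[OF S less.prems(1)]
    define a where "a = excess A" define b where "b = excess B"
    have ab: "0 < a" "0 < b" "excess U = a + b" "b \<le> a" using pt le by (auto simp: a_def b_def)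
    have gA: "good A" if "12308 / 10000 \<le> a" using less.hyps[of A] pt that by (simp add: a_def)
    have gB: "good B" if "12308 / 10000 \<le> b" using less.hyps[of B] pt that by (simp add: b_def)
    show ?thesis
    proof (cases "12308 / 10000 \<le> a")
      case True
      consider "b \<le> 1 / 2" | "1 / 2 \<le> b" "b \<le> 101 / 100" | "101 / 100 \<le> b" "b \<le> 12308 / 10000"
        | "12308 / 10000 \<le> b" by linarith
      then show ?thesis
      proof cases
        case 1
        then show ?thesis using good_peel[OF S less.prems(1) gA[OF True]] \<gamma>1 by (simp add: b_def)
      next
        case 2
        then have "0 \<le> (b - 1 / 2) * (101 / 100 - b)" by auto
        then have "1 / 12 \<le> b * (\<gamma> - b)" using 2 unfolding \<gamma> by ((simp only: monomials)?; linarith)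
        then show ?thesis using good_peel[OF S less.prems(1) gA[OF True]] by (simp add: b_def)
      next
        case 3
        then have "0 \<le> (b - 101 / 100) * (12308 / 10000 - b)" by auto
        then have "f b \<le> 1 / 4" using 3 unfolding f_def by ((simp only: monomials)?; linarith)
        moreover have "W B + holes L B B \<le> f b + 2 / 3 * mass L B B"
          if "kernel L" "\<And>x y. L x y \<le> 1" for L
          using direct[of B L] pt(4,14) that by (simp add: b_def)
        ultimately show ?thesis
          by (intro good_attach[OF S less.prems(1) gA[OF True], of "f b" "2 / 3"]) auto
      next
        case 4
        then show ?thesis using good_glue[OF S less.prems(1) gA[OF True] gB] by simp
      qed
    next
      case a: False
      show ?thesis unfolding good_def
      proof (intro allI impI)
        fix K :: "'a \<Rightarrow> 'a \<Rightarrow> real"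
        assume K: "kernel K" and K1: "\<forall>x y. K x y \<le> 1 / 2" and K2: "mass K U U \<le> 1 / 2"
        have Kle: "K x y \<le> 1 / 2" "K x y \<le> 1" for x y using K1 by (auto intro: order_trans[where y="1/2"])
        note S' = separation_swap[OF S]
        obtain p r t q u v where
          p: "mass K (B - A) (B - A) = p" "mass K (A - B) (A - B) = r" "mass K (A \<inter> B) (A \<inter> B) = t"
          and q: "mass K (B - A) (A - B) = q"
          and mA: "mass K A A = r + t + 2 * v" and mB: "mass K B B = p + t + 2 * u"
          and mU: "mass K U U = p + r + t + 2 * q + 2 * u + 2 * v"
          and bm: "block_masses (1 / 2) a b p r t q u v"
          unfolding a_def b_def by (rule kernel_blocks[OF S less.prems(1) K Kle(1)])
        note nn = block_massesD[OF bm]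
        define m where "m = p + r + t + 2 * q + 2 * u + 2 * v"
        have m: "m \<le> 1 / 2" "mass K U U = m" using mU K2 by (simp_all add: m_def)
        have "W U + holes K U U \<le> 1 / 4 + m / 2"
        proof (cases "b \<le> 1")
          case True
          \<comment> \<open>The coefficients make the factor \<open>2 / 3\<close> on the mass of
            \<open>A\<close> and the peeling loss \<open>2 * q\<close> fit under
            \<open>3 / 4 * m\<close>: on the blocks \<open>p\<close>, \<open>q\<close>,
            \<open>r\<close> the difference is this form divided by 12.\<close>
          have "0 \<le> 3\<^sup>2 * p + 2 * 3 * (- 1) * q + (- 1)\<^sup>2 * r" by (rule block_masses_quad[OF bm])
          then have 1: "2 / 3 * (r + t + 2 * v) + 2 * q \<le> 3 / 4 * m"
            using nn(1-6) unfolding m_def by ((simp only: monomials)?; linarith)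
          have "0 \<le> (b - 109 / 1000) * (1 - b)" using True ab False a by auto
          then have 2: "109 / 1000 \<le> b * (\<gamma> - b)" unfolding \<gamma> by ((simp only: monomials)?; linarith)
          have "0 \<le> (a - 10962 / 10000) * (12308 / 10000 - a)" using a ab True False by auto
          then have 3: "f a \<le> 22 / 100" using a ab True False unfolding f_def by ((simp only: monomials)?; linarith)
          have "W A + holes K A A \<le> f a + 2 / 3 * (r + t + 2 * v)"
            using direct[of A K] pt K Kle(2) mA by (simp add: a_def)
          then show ?thesis using peel[OF S less.prems(1) K Kle(2)] 1 2 3 m unfolding q b_def[symmetric]
            by ((simp only: monomials)?; linarith)
        next
          case b: False
          have "2 * q \<le> p + r" using block_masses_quad[OF bm, of 1 "-1"] by simp
          then have 1: "4 * q + t + (u + v) / 2 \<le> m" using nn(1-6) unfolding m_def by ((simp only: monomials)?; linarith)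
          \<comment> \<open>Neither joining nor gluing suffices for all pairs of sizes in this
            range: joining is too weak when both sides are large, gluing when both are small. A
            mixture of the two bounds works.\<close>
          define J where "J = on_set (A \<inter> B) K"
          have J: "kernel J" "\<And>x y. J x y \<le> 1"
            unfolding J_def using kernel_on_set[OF K] Kle by (auto simp: on_set_def)
          have f: "finite A" "finite B" using pt by auto
          have i: "A \<inter> (A \<inter> B) = A \<inter> B" "B \<inter> (A \<inter> B) = A \<inter> B" by auto
          have mJ: "mass J A A = t" "mass J B B = t"
            unfolding J_def mass_on_set[OF f(1) f(1)] mass_on_set[OF f(2) f(2)] i p by auto
          have 2: "W U + holes K U U \<le> 1 - 1109 / 1000 * (a + b) + 2 / 3 * (a\<^sup>2 + b\<^sup>2) + 2 / 75 + 2 / 3 * t + 2 * q"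
            using join_bound[OF S less.prems(1) K Kle(1) J_def] 
              deficit_two_thirds[OF pt(3) _ J] deficit_two_thirds[OF pt(4) _ J] pt(13,14)
            unfolding mJ q ab(3) \<sigma> \<gamma> a_def[symmetric] b_def[symmetric] by ((simp only: monomials)?; linarith)
          define L where "L = glue (1 / 2) (1 / 2) K A B"
          define M where "M = glue (1 / 2) (1 / 2) K B A"
          have massL: "mass L A A = r + t / 2 + v + 1 / 2"
            unfolding L_def glue_mass[OF S less.prems(1)] mA p by ((simp only: monomials)?; linarith)
          have massM: "mass M B B = p + t / 2 + u + 1 / 2"
            unfolding M_def glue_mass[OF S' less.prems(1)] mB p by ((simp only: monomials)?; linarith)
          have L: "kernel L" "\<And>x y. L x y \<le> 1" unfolding L_def
            by (simp_all add: kernel_glue[OF K] glue_le[OF Kle(1) K])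
          have M: "kernel M" "\<And>x y. M x y \<le> 1" unfolding M_def
            by (simp_all add: kernel_glue[OF K] glue_le[OF Kle(1) K])
          have 3: "W A + holes L A A \<le> f a + 2 / 3 * mass L A A" "W B + holes M B B \<le> f b + 2 / 3 * mass M B B"
            using direct[OF _ _ L] direct[OF _ _ M] pt by (simp_all add: a_def b_def)
          have 4: "W U + holes K U U \<le> (W A + holes L A A) + (W B + holes M B B) + mass K U U - mass L A A - mass M B B"
            by (intro split_bound[OF S less.prems(1) K _ _ _ _ L_def M_def]) auto
          have "0 \<le> (a - 1) * (12308 / 10000 - a)" "0 \<le> (b - 1) * (12308 / 10000 - b)"
            using a b ab by auto
          then show ?thesis
            using 1 2 3 4 m m_def a ab unfolding massL massM f_def by ((simp only: monomials)?; linarith)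
        qed
        then show "W U + holes K U U \<le> 1 / 4 + mass K U U / 2" using m by simp
      qed
    qed
  qed
qed

end

section \<open>Lower bounds for the deficit\<close>

lemma quadratic_concave:
  fixes c d e x :: real
  assumes "0 \<le> c" "l \<le> x" "x \<le> h" "0 \<le> e + d * l - c * l\<^sup>2" "0 \<le> e + d * h - c * h\<^sup>2"
  shows "0 \<le> e + d * x - c * x\<^sup>2"
proof (cases "l = h")
  case True then show ?thesis using assms by auto
next
  case False
  then have lh: "0 < h - l" using assms by simp
  have "0 \<le> (h - x) * (e + d * l - c * l\<^sup>2) + (x - l) * (e + d * h - c * h\<^sup>2)
      + c * ((x - l) * (h - x)) * (h - l)" using assms by auto
  also have "\<dots> = (h - l) * (e + d * x - c * x\<^sup>2)" by algebra
  finally show ?thesis using lh by (simp add: zero_le_mult_iff)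
qed

text \<open>
  \<open>slope \<sigma> y\<close> is the factor \<open>g\<close> for which \<open>deficit K U \<ge> g (y\<^sup>2 - mass K U U)\<close> can be proved by averaging
  the two ways of peeling; the averaging breaks down for \<open>y\<close> slightly beyond \<open>4 \<sigma>\<close>.
\<close>

definition slope :: "real \<Rightarrow> real \<Rightarrow> real" where
  "slope s y = (if y \<le> s then 0 else if y \<le> 2 * s then 1 - s / y else 3 / 4 - s / (2 * y))"

lemma slope_mult: "0 < y \<Longrightarrow> slope s y * y = (if y \<le> s then 0 else if y \<le> 2 * s then y - s else 3 / 4 * y - s / 2)"
  by (auto simp: slope_def field_simps)

lemma slope_bounds: "0 < s \<Longrightarrow> 0 \<le> slope s y" "0 < s \<Longrightarrow> slope s y \<le> 1"
  by (auto simp: slope_def field_simps)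

lemma slope_mono:
  assumes s: "0 < s" and x: "0 < x" "x \<le> y"
  shows "slope s x \<le> slope s y"
proof -
  have y: "0 < y" using x by simp
  consider "x \<le> s" | "s < x" "y \<le> 2 * s" | "2 * s < x" | "s < x" "x \<le> 2 * s" "2 * s < y" by linarith
  then show ?thesis
  proof cases
    case 1 then show ?thesis using slope_bounds(1)[OF s] by (simp add: slope_def)
  next
    case 2 then show ?thesis using s x y by (auto simp: slope_def field_simps)
  next
    case 3 then show ?thesis using s x y by (auto simp: slope_def field_simps)
  next
    case 4
    have "1 - s / x \<le> 1 / 2" "1 / 2 \<le> 3 / 4 - s / (2 * y)" using 4 s x y by (auto simp: field_simps)
    moreover have "slope s x = 1 - s / x" "slope s y = 3 / 4 - s / (2 * y)" using 4 s by (auto simp: slope_def)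
    ultimately show ?thesis by linarith
  qed
qed

text \<open>Here \<open>P\<close>, \<open>R\<close>, \<open>E\<close> stand for
  \<open>b\<^sup>2 - p\<close>, \<open>a\<^sup>2 - r\<close>, \<open>a * b - q\<close>, and each
  disjunct says that peeling off one side proves the factor \<open>G\<close>. If both fail, so does
  their average with weights \<open>w\<close> and \<open>1 - w\<close>; the last two hypotheses put
  its coefficients below those of the inequality from \<open>weighted_square\<close>.\<close>

lemma peel_choice:
  fixes a b P R E G ga gb w :: real
  assumes ab: "0 < a" "0 < b" and PR: "0 \<le> P" "0 \<le> R" and q: "a\<^sup>2 * P + b\<^sup>2 * R \<le> 2 * a * b * E"
    and w: "0 \<le> w" "w \<le> 1" and G: "G \<le> 1"
    and c: "b * (G - (1 - w) * gb) \<le> (1 - G) * a" "a * (G - w * ga) \<le> (1 - G) * b"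
  shows "G * P + (G - ga) * R \<le> 2 * (1 - G) * E \<or> G * R + (G - gb) * P \<le> 2 * (1 - G) * E"
proof (rule ccontr)
  assume n: "\<not> ?thesis"
  define d where "d = 2 * (1 - G) * E"
  have "w * d + (1 - w) * d < w * (G * P + (G - ga) * R) + (1 - w) * (G * R + (G - gb) * P)"
  proof (cases "w = 0")
    case True then show ?thesis using n by (simp add: d_def)
  next
    case False
    have "w * d < w * (G * P + (G - ga) * R)" using n False w by (simp add: d_def)
    moreover have "(1 - w) * d \<le> (1 - w) * (G * R + (G - gb) * P)"
      using n w by (intro mult_left_mono) (auto simp: d_def)
    ultimately show ?thesis by simp
  qed
  then have "d < P * (G - (1 - w) * gb) + R * (G - w * ga)" by ((simp only: monomials)?; linarith)
  then have "a * b * d < a * b * (P * (G - (1 - w) * gb) + R * (G - w * ga))" using ab by simp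
  also have "\<dots> = a * P * (b * (G - (1 - w) * gb)) + b * R * (a * (G - w * ga))" by algebra
  also have "\<dots> \<le> a * P * ((1 - G) * a) + b * R * ((1 - G) * b)"
    using c ab PR by (intro add_mono mult_left_mono) auto
  also have "\<dots> = (1 - G) * (a\<^sup>2 * P + b\<^sup>2 * R)" by algebra
  also have "\<dots> \<le> (1 - G) * (2 * a * b * E)" using q G by (intro mult_left_mono) auto
  also have "\<dots> = a * b * d" by (simp add: d_def)
  finally show False by simp
qed

text \<open>With \<open>N = (1 - G) * (a + b)\<close> the requirements become
  \<open>b - N \<le> (1 - w) * slope s b * b\<close> and
  \<open>a - N \<le> w * slope s a * a\<close>. The two nonzero pieces of \<open>slope\<close> give
  \<open>N = s\<close> and \<open>N = (a + b) / 4 + s / 2\<close>. Either \<open>w = 1\<close>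
  works, or \<open>w\<close> makes the second requirement an equality and the first is
  checked.\<close>

lemma slope_weight:
  assumes s: "0 < s" and ab: "0 < b" "b \<le> a" and y: "s < a + b" "a + b \<le> 15 / 4 * s"
  defines "G \<equiv> slope s (a + b)"
  obtains w where "0 \<le> w" "w \<le> 1" "b * (G - (1 - w) * slope s b) \<le> (1 - G) * a" "a * (G - w * slope s a) \<le> (1 - G) * b"
proof -
  define N where "N = (1 - G) * (a + b)"
  have a: "0 < a" using ab by simp
  note T = that
  have red: ?thesis if "0 \<le> w" "w \<le> 1" "b - N \<le> (1 - w) * (slope s b * b)" "a - N \<le> w * (slope s a * a)" for w
    using that(3,4) by (intro T[of w]) (use that(1,2) in \<open>auto simp: N_def algebra_simps\<close>)
  have N: "N = a + b - slope s (a + b) * (a + b)" by (simp add: N_def G_def algebra_simps)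
  note sa = slope_mult[OF a, of s] and sb = slope_mult[OF ab(1), of s]
  show ?thesis
  proof (cases "a + b \<le> 2 * s")
    case True
    then have N': "N = s" using y a ab unfolding N by (subst slope_mult) auto
    show ?thesis using True ab y by (intro red[of 1]) (auto simp: N' sa sb)
  next
    case False
    then have "slope s (a + b) * (a + b) = 3 / 4 * (a + b) - s / 2"
      using slope_mult[of "a + b" s] s a ab by auto
    then have N': "N = a / 4 + b / 4 + s / 2" unfolding N by ((simp only: monomials)?; linarith)
    consider "b \<le> s" | "s < b" "a \<le> 2 * s" | "s < b" "2 * s < a" by linarith
    then show ?thesis
    proof cases
      case 1
      then show ?thesis using False ab by (intro red[of 1]) (auto simp: N' sa sb)
    next
      case 2
      have a1: "0 < a - s" using 2 ab by simp
      define w where "w = (a - N) / (a - s)"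
      have w: "0 \<le> w" "w \<le> 1" using 2 ab a1 unfolding w_def N' by (auto simp: field_simps)
      \<comment> \<open>The remaining inequality, multiplied by \<open>a - s\<close>, holds with
        slack exactly a quarter of this square.\<close>
      have "0 \<le> ((a - s) - (b - s))\<^sup>2" by simp
      then have "(b - N) * (a - s) \<le> (N - s) * (b - s)" unfolding N' by ((simp only: monomials)?; linarith)
      then have "b - N \<le> (N - s) * (b - s) / (a - s)" using a1 by (simp add: field_simps)
      also have "(N - s) * (b - s) / (a - s) = (1 - w) * (b - s)" using a1 by (simp add: w_def field_simps)
      finally show ?thesis using w a1 2 ab by (intro red[of w]) (auto simp: sa sb w_def)
    next
      case 3
      have a1: "0 < 3 / 4 * a - s / 2" using 3 ab s by simp
      define w where "w = (a - N) / (3 / 4 * a - s / 2)"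
      have w: "0 \<le> w" "w \<le> 1" using 3 ab a1 unfolding w_def N' by (auto simp: field_simps)
      have b2: "b \<le> 2 * s" using 3 y s by simp
      \<comment> \<open>This is where \<open>15 / 4 * s\<close> enters: with
        \<open>2 * s < a\<close> it gives \<open>b < 7 / 4 * s\<close>, hence
        \<open>9 * b \<le> 16 * s\<close>.\<close>
      have "0 \<le> (2 * s - b)\<^sup>2" "0 \<le> (a - 2 * s)\<^sup>2" "0 \<le> (a - 2 * s) * (16 * s - 9 * b)"
        using 3 y s by auto
      then have "(b - N) * (3 / 4 * a - s / 2) \<le> b / 4 * (b - s)"
        unfolding N' by ((simp only: monomials)?; linarith)
      then have "b - N \<le> b / 4 * (b - s) / (3 / 4 * a - s / 2)" by (rule mult_imp_le_div_pos[OF a1])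
      also have "b / 4 * (b - s) / (3 / 4 * a - s / 2) = (1 - w) * (b - s)"
      proof -
        have "1 - w = (b / 4) / (3 / 4 * a - s / 2)" using a1 unfolding w_def N' by (simp add: field_simps)
        then show ?thesis by simp
      qed
      finally have bN: "b - N \<le> (1 - w) * (b - s)" .
      have "a - N \<le> w * (3 / 4 * a - s / 2)" using a1 by (simp add: w_def)
      then show ?thesis using w 3 b2 bN by (intro red[of w]) (auto simp: sa sb)
    qed
  qed
qed

context sep_graph begin

section \<open>Lower bounds for the number of holes\<close>

lemma deficit_zero: "deficit (\<lambda>_ _. 0) U = holes (\<lambda>_ _. 1) U U"
  using holes_scale[of 0 "\<lambda>_ _. 0" U U] by (simp add: deficit_def)

lemma holes_one_separation:
  assumes S: "separation U A B" and U: "U \<subseteq> V"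
  shows "2 * (excess A * excess B) + holes (\<lambda>_ _. 1) A A \<le> holes (\<lambda>_ _. 1) U U"
proof -
  have "mass (\<lambda>_ _. 0 :: real) (B - A) (A - B) = 0" using mass_const[of 0] by simp
  then show ?thesis
    using deficit_block(1)[OF S U kernel_const[of 0]] unfolding deficit_zero by simp
qed

text \<open>The tight separation has \<open>excess A = \<sigma>\<close>: such an \<open>A\<close>
  need not contain further holes, and the cross pairs alone give the bound.\<close>

lemma holes_ge_linear:
  assumes "U \<subseteq> V" "excess U \<le> 2 * \<sigma>"
  shows "2 * \<sigma> * (excess U - \<sigma>) \<le> holes (\<lambda>_ _. 1) U U"
  using assms
proof (induction "card U" arbitrary: U rule: less_induct)
  case less
  have nn: "0 \<le> holes (\<lambda>_ _. 1) X X" for X by (intro holes_nonneg) simp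
  show ?case
  proof (cases "\<sigma> < excess U")
    case False
    have "0 \<le> \<sigma> * (\<sigma> - excess U)" using False sigma_pos by simp
    then show ?thesis using nn[of U] by ((simp only: monomials)?; linarith)
  next
    case True
    then obtain A B where S: "separation U A B" and le: "excess B \<le> excess A"
      using separation_ordered less.prems by blast
    note pt = separation_parts[OF S less.prems(1)]
    note h = holes_one_separation[OF S less.prems(1)]
    have y: "excess U = excess A + excess B" using pt by simp
    show ?thesis
    proof (cases "excess A \<le> \<sigma>")
      case True
      have "0 \<le> (\<sigma> - excess A) * (\<sigma> - excess B)" using True le by auto
      then show ?thesis using h nn[of A] unfolding y by ((simp only: monomials)?; linarith)
    next
      case False
      have "2 * \<sigma> * (excess A - \<sigma>) \<le> holes (\<lambda>_ _. 1) A A"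
        using less.hyps[of A] pt less.prems by simp
      moreover have "0 \<le> (excess A - \<sigma>) * excess B" using False pt by auto
      ultimately show ?thesis using h unfolding y by ((simp only: monomials)?; linarith)
    qed
  qed
qed

text \<open>This is the balanced separation with both excesses \<open>y / 2\<close>: cross pairs
  \<open>y\<^sup>2 / 2\<close> plus the linear bound for one half. It agrees with the linear bound
  at \<open>y = 2 * \<sigma>\<close>.\<close>

lemma holes_ge_quadratic:
  assumes "U \<subseteq> V" "0 \<le> excess U"
  shows "(excess U)\<^sup>2 / 2 + \<sigma> * excess U - 2 * \<sigma>\<^sup>2 \<le> holes (\<lambda>_ _. 1) U U"
  using assms
proof (induction "card U" arbitrary: U rule: less_induct)
  case less
  show ?case
  proof (cases "excess U \<le> 2 * \<sigma>")
    case True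
    have "0 \<le> excess U * (2 * \<sigma> - excess U)" using True less.prems by simp
    then show ?thesis using holes_ge_linear[OF less.prems(1) True] by ((simp only: monomials)?; linarith)
  next
    case False
    then have "\<sigma> < excess U" using sigma_pos by simp
    then obtain A B where S: "separation U A B" and le: "excess B \<le> excess A"
      using separation_ordered less.prems by blast
    note pt = separation_parts[OF S less.prems(1)]
    note h = holes_one_separation[OF S less.prems(1)]
    have y: "excess U = excess A + excess B" using pt by simp
    show ?thesis
    proof (cases "excess A \<le> 2 * \<sigma>")
      case True
      have "0 \<le> (excess A - excess B) * (2 * \<sigma> - (excess A - excess B))"
        using True le pt by (intro mult_nonneg_nonneg) auto
      then show ?thesis
        using h holes_ge_linear[OF pt(3) True] unfolding y by ((simp only: monomials)?; linarith)
    next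
      case False
      have "(excess A)\<^sup>2 / 2 + \<sigma> * excess A - 2 * \<sigma>\<^sup>2 \<le> holes (\<lambda>_ _. 1) A A"
        using less.hyps[of A] pt by simp
      moreover have "0 \<le> excess B * (2 * excess A - excess B - 2 * \<sigma>)"
        using False le pt by (intro mult_nonneg_nonneg) auto
      ultimately show ?thesis using h unfolding y by ((simp only: monomials)?; linarith)
    qed
  qed
qed

text \<open>The scheme of \<open>deficit_two_thirds\<close> with a factor growing with the size: the
  sides contribute their own, smaller factors, and the side to be peeled off is found by
  \<open>peel_choice\<close>.\<close>

lemma deficit_slope:
  assumes U: "U \<subseteq> V" "0 < excess U" "excess U \<le> 15 / 4 * \<sigma>" and K: "kernel K" "\<And>x y. K x y \<le> 1"
  shows "slope \<sigma> (excess U) * ((excess U)\<^sup>2 - mass K U U) \<le> deficit K U"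
  using U
proof (induction "card U" arbitrary: U rule: less_induct)
  case less
  show ?case
  proof (cases "\<sigma> < excess U")
    case False
    then show ?thesis using deficit_nonneg[of K U, OF K(2)] by (simp add: slope_def)
  next
    case True
    then obtain A B where S: "separation U A B" and le: "excess B \<le> excess A"
      using separation_ordered less.prems by blast
    note pt = separation_parts[OF S less.prems(1)]
    define a where "a = excess A" define b where "b = excess B"
    define G where "G = slope \<sigma> (a + b)"
    have ab: "0 < a" "0 < b" "excess U = a + b" "b \<le> a" using pt le by (auto simp: a_def b_def)
    obtain p r t q u v where
      "mass K (B - A) (B - A) = p" "mass K (A - B) (A - B) = r" "mass K (A \<inter> B) (A \<inter> B) = t"
      and q: "mass K (B - A) (A - B) = q"
      and m: "mass K A A = r + t + 2 * v" "mass K B B = p + t + 2 * u"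
        "mass K U U = p + r + t + 2 * q + 2 * u + 2 * v"
      and bm: "block_masses 1 a b p r t q u v"
      unfolding a_def b_def by (rule kernel_blocks[OF S less.prems(1) K])
    note nn = block_massesD[OF bm]
    have A: "slope \<sigma> a * (a\<^sup>2 - (r + t + 2 * v)) \<le> deficit K A"
      using less.hyps[of A] pt m less.prems(3) unfolding a_def by auto
    have B: "slope \<sigma> b * (b\<^sup>2 - (p + t + 2 * u)) \<le> deficit K B"
      using less.hyps[of B] pt m less.prems(3) unfolding b_def by auto
    have d: "2 * (a * b - q) + deficit K A \<le> deficit K U" "2 * (a * b - q) + deficit K B \<le> deficit K U"
      using deficit_block[OF S less.prems(1) K] q by (auto simp: a_def b_def)
    have gG: "slope \<sigma> a \<le> G" "slope \<sigma> b \<le> G" "G \<le> 1" "0 \<le> G"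
      unfolding G_def using ab sigma_pos slope_bounds[OF sigma_pos] by (auto intro: slope_mono)
    obtain w where w: "0 \<le> w" "w \<le> 1" "b * (G - (1 - w) * slope \<sigma> b) \<le> (1 - G) * a" "a * (G - w * slope \<sigma> a) \<le> (1 - G) * b"
      using slope_weight[OF sigma_pos ab(2,4)] True less.prems(3) unfolding ab(3) G_def by blast
    have "G * (b\<^sup>2 - p) + (G - slope \<sigma> a) * (a\<^sup>2 - r) \<le> 2 * (1 - G) * (a * b - q) \<or>
        G * (a\<^sup>2 - r) + (G - slope \<sigma> b) * (b\<^sup>2 - p) \<le> 2 * (1 - G) * (a * b - q)"
      using nn by (intro peel_choice[OF ab(1,2) _ _ weighted_square[OF bm] w(1,2) gG(3) w(3,4)]) auto
    moreover have "0 \<le> (G - slope \<sigma> a) * (t + 2 * v)" "0 \<le> (G - slope \<sigma> b) * (t + 2 * u)"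
      "0 \<le> G * u" "0 \<le> G * v" using gG nn by auto
    ultimately show ?thesis
      unfolding m ab(3) G_def[symmetric] power2_sum using A B d
      by (elim disjE) ((simp only: monomials)?; linarith)+
  qed
qed

lemma deficit_slope_scaled:
  assumes U: "U \<subseteq> V" "0 < excess U" "excess U \<le> 15 / 4 * \<sigma>" and K: "kernel K" "\<And>x y. K x y \<le> D"
    and D: "0 < D" "D \<le> 1"
  shows "(1 - D) * holes (\<lambda>_ _. 1) U U + slope \<sigma> (excess U) * (D * (excess U)\<^sup>2 - mass K U U) \<le> deficit K U"
proof -
  define L where "L = (\<lambda>x y. K x y / D)"
  have L: "kernel L" using kernel_scale[of "1 / D" K] K(1) D(1) by (simp add: L_def)
  have L1: "L x y \<le> 1" for x y using K(2) D by (simp add: L_def)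
  have m: "mass L U U = mass K U U / D" using mass_scale[of "1 / D" K] by (simp add: L_def)
  have "D * (slope \<sigma> (excess U) * ((excess U)\<^sup>2 - mass K U U / D)) \<le> D * deficit L U"
    using deficit_slope[OF U L L1] D unfolding m by (intro mult_left_mono) auto
  moreover have "D * (slope \<sigma> (excess U) * ((excess U)\<^sup>2 - mass K U U / D))
      = slope \<sigma> (excess U) * (D * (excess U)\<^sup>2 - mass K U U)" using D by (simp add: field_simps)
  ultimately show ?thesis
    unfolding deficit_scaled[OF D(1), of K] deficit_zero L_def[symmetric] by simp
qed

end

section \<open>Deficits of weights with bounded row sums\<close>

text \<open>
  The constant \<open>249 / 1000\<close> is just below \<open>1 / 4\<close>, with which the inequality behind \<open>at_sigma\<close> would read
  \<open>y\<^sup>2 / 4 \<le> s (y - s)\<close> and hold at \<open>y = 2 s\<close> only.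
\<close>

definition row_gain :: "real \<Rightarrow> real \<Rightarrow> real" where
  "row_gain s y = (if y \<le> 2 * s then s * (y - s) else y\<^sup>2 / 4 + s * y / 2 - s\<^sup>2) + 249 / 1000 * (y * (y - 1))"

lemma row_gain_ge:
  assumes "0 \<le> s" "0 \<le> y"
  shows "y\<^sup>2 / 4 + s * y / 2 - s\<^sup>2 + 249 / 1000 * (y * (y - 1)) \<le> row_gain s y"
proof (cases "y \<le> 2 * s")
  case True
  then have "0 \<le> y * (2 * s - y)" using assms by auto
  then show ?thesis using True unfolding row_gain_def by ((simp only: monomials if_True)?; linarith)
qed (simp add: row_gain_def)

locale sigma2 =
  fixes s :: real
  assumes s2: "s\<^sup>2 = 5 / 18" and s_lo: "5270462 / 10000000 \<le> s" and s_hi: "s \<le> 5270463 / 10000000"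
begin

context
  fixes a b y c :: real
  assumes ab: "0 < b" "b \<le> a" and y: "y = a + b" "1 \<le> y" "y \<le> 124 / 100" and c: "c * y = 2 * y - 1"
begin

lemma c_bounds: "1 \<le> c" "1 + 8064 / 10000 * (y - 1) \<le> c"
proof -
  have cy: "(c - 1) * y = y - 1" using c by ((simp only: monomials)?; linarith)
  have "c - 1 = (y - 1) / y" using cy y by (simp add: eq_divide_eq)
  moreover have "(y - 1) / (124 / 100) \<le> (y - 1) / y" using y by (intro divide_left_mono) auto
  moreover have "8064 / 10000 * (y - 1) \<le> (y - 1) / (124 / 100)" using y(2) by (simp add: field_simps)
  ultimately show "1 + 8064 / 10000 * (y - 1) \<le> c" by linarith
  then show "1 \<le> c" using y by ((simp only: monomials)?; linarith)
qed

lemma at_sigma: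
  assumes "y \<le> 2 * s"
  shows "s * (y - s) + 249 / 1000 * (y * (y - 1)) \<le> c * (s * (y - s))"
proof -
  have "0 \<le> (y - 1) * (2 * s - y)" using assms y by auto
  moreover have "0 \<le> (s - 5270462 / 10000000) * y" using y s_lo by auto
  ultimately have "0 \<le> s * (y - s) - 249 / 1000 * y\<^sup>2"
    using s2 s_lo s_hi y by ((simp only: monomials)?; linarith)
  then have "0 \<le> (c - 1) * (s * (y - s) - 249 / 1000 * y\<^sup>2)" using c_bounds by auto
  also have "\<dots> = (c - 1) * (s * (y - s)) - 249 / 1000 * (y * (c * y - y))" by algebra
  finally show ?thesis unfolding c by ((simp only: monomials)?; linarith)
qed

text \<open>For fixed \<open>y\<close> the difference of the two sides is concave in
  \<open>a\<close>, so it is enough to check the ends \<open>a = y / 2\<close> and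
  \<open>a = s\<close> of the range.\<close>

lemma row_gain_small:
  assumes "a \<le> s"
  shows "row_gain s y \<le> c * (a * b)"
proof -
  have y2: "y \<le> 2 * s" using assms ab y by simp
  have "0 \<le> - row_gain s y + c * y * a - c * a\<^sup>2"
  proof (rule quadratic_concave)
    \<comment> \<open>The quadratic in \<open>y\<close> to be shown nonnegative has a barely
      negative discriminant; its minimum is near \<open>10519 / 10000\<close>.\<close>
    have "0 \<le> (y - 10519 / 10000)\<^sup>2" "0 \<le> (5270463 / 10000000 - s) * y" using y s_hi by auto
    then have "0 \<le> y * (2 * y - 1) / 4 - row_gain s y"
      unfolding row_gain_def if_P[OF y2] using s2 y by ((simp only: monomials)?; linarith)
    moreover have "c * y * (y / 2) - c * (y / 2)\<^sup>2 = y * (c * y) / 4" by (simp add: power2_eq_square)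
    ultimately show "0 \<le> - row_gain s y + c * y * (y / 2) - c * (y / 2)\<^sup>2" unfolding c by linarith
    show "0 \<le> - row_gain s y + c * y * s - c * s\<^sup>2"
      unfolding row_gain_def if_P[OF y2] using at_sigma[OF y2] by ((simp only: monomials)?; linarith)
  qed (use assms ab y c_bounds in auto)
  then show ?thesis using y(1) by (simp add: algebra_simps power2_eq_square)
qed

text \<open>Again concave in \<open>a\<close>, on the range from \<open>s\<close> or
  \<open>y / 2\<close>, whichever is larger, to 1.\<close>

lemma row_gain_medium:
  assumes a: "s \<le> a" "a \<le> 1"
  shows "row_gain s y \<le> c * (a * b) + s * (a - s)"
proof -
  have "0 \<le> (- row_gain s y - s\<^sup>2) + (c * y + s) * a - c * a\<^sup>2"
  proof (cases "y \<le> 2 * s")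
    case y2: True
    show ?thesis
    proof (rule quadratic_concave)
      show "0 \<le> - row_gain s y - s\<^sup>2 + (c * y + s) * s - c * s\<^sup>2"
        unfolding row_gain_def if_P[OF y2] using at_sigma[OF y2] by ((simp only: monomials)?; linarith)
      have "0 \<le> (y - 1) * (c - s - 249 / 1000 * y)"
        using c_bounds s_hi y by (intro mult_nonneg_nonneg) auto
      then show "0 \<le> - row_gain s y - s\<^sup>2 + (c * y + s) * 1 - c * 1\<^sup>2"
        unfolding row_gain_def if_P[OF y2] by ((simp only: monomials)?; linarith)
    qed (use a c_bounds in auto)
  next
    case y2: False
    show ?thesis
    proof (rule quadratic_concave)
      have "0 \<le> y * (y - 1)" using y by auto
      moreover have "(c * y + s) * (y / 2) - c * (y / 2)\<^sup>2 = y * (c * y) / 4 + s * y / 2"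
        by ((simp only: monomials)?; linarith)
      ultimately show "0 \<le> - row_gain s y - s\<^sup>2 + (c * y + s) * (y / 2) - c * (y / 2)\<^sup>2"
        unfolding row_gain_def if_not_P[OF y2] c by ((simp only: monomials)?; linarith)
      have "0 \<le> (y - 1) * (c - (1 + 8064 / 10000 * (y - 1)))" using y c_bounds by auto
      moreover have "0 \<le> (y - 107 / 100)\<^sup>2" "0 \<le> (5270463 / 10000000 - s) * y" using y s_hi by auto
      ultimately show "0 \<le> - row_gain s y - s\<^sup>2 + (c * y + s) * 1 - c * 1\<^sup>2"
        unfolding row_gain_def if_not_P[OF y2] using y s_lo by ((simp only: monomials)?; linarith)
    qed (use a ab y c_bounds in auto)
  qed
  then show ?thesis using y(1) by (simp add: algebra_simps power2_eq_square)
qed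

lemma row_gain_large:
  assumes a: "1 \<le> a"
  shows "row_gain s y \<le> c * (a * b) + row_gain s a"
proof (cases "y \<le> 2 * s")
  case y2: True
  have a2: "a \<le> 2 * s" using y2 y ab by simp
  have "c * 1 \<le> c * a" using a c_bounds by (intro mult_left_mono) auto
  then have "s + 249 / 1000 * (y + a - 1) \<le> c * a" using c_bounds s_hi y ab by ((simp only: monomials)?; linarith)
  then have "b * (s + 249 / 1000 * (y + a - 1)) \<le> b * (c * a)" using ab by simp
  then show ?thesis
    unfolding row_gain_def if_P[OF y2] if_P[OF a2] unfolding y(1) by ((simp only: monomials)?; linarith)
next
  case y2: False
  have "0 \<le> a * (c - (1 + 8064 / 10000 * (y - 1)))" "0 \<le> (a - 1) * (y - 1)"
    using a c_bounds y by auto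
  then have "(y + a) / 4 + s / 2 + 249 / 1000 * (y + a - 1) \<le> c * a"
    using y2 s_lo s_hi a y by ((simp only: monomials)?; linarith)
  then have "b * ((y + a) / 4 + s / 2 + 249 / 1000 * (y + a - 1)) \<le> b * (c * a)" using ab by simp
  moreover have "a\<^sup>2 / 4 + s * a / 2 - s\<^sup>2 + 249 / 1000 * (a * (a - 1)) \<le> row_gain s a"
    using a s_lo by (intro row_gain_ge) auto
  ultimately show ?thesis
    unfolding row_gain_def[of s y] if_not_P[OF y2] unfolding y(1) by ((simp only: monomials)?; linarith)
qed

end

end

context sep_graph begin

text \<open>Bounded row sums give \<open>p + q \<le> b / 2\<close> and
  \<open>r + q \<le> a / 2\<close>, and the test function \<open>a\<close>, \<open>- b\<close> then
  yields \<open>2 * q \<le> a * b / y\<close>. Equality holds for the constant weight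
  \<open>1 / (2 * y)\<close> on the symmetric difference. Such a weight leaves the fraction
  \<open>1 - 1 / (2 * y)\<close> of the holes unpaid instead of the half guaranteed by
  \<open>K \<le> 1 / 2\<close>; on \<open>y\<^sup>2 / 2\<close> holes the gain is
  \<open>y * (y - 1) / 4\<close>, whose coefficient is lowered slightly in
  \<open>row_gain\<close>.\<close>

lemma deficit_row_gain:
  assumes \<sigma>: "sigma2 \<sigma>" and U: "U \<subseteq> V" "1 \<le> excess U" "excess U \<le> 124 / 100"
    and K: "kernel K" "\<And>x y. K x y \<le> 1 / 2" and rows: "\<And>x. x \<in> U \<Longrightarrow> (\<Sum>z\<in>U. K x z) \<le> real k / 2"
  shows "row_gain \<sigma> (excess U) \<le> deficit K U"
  using U rows
proof (induction "card U" arbitrary: U rule: less_induct)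
  case less
  interpret sigma2 \<sigma> by fact
  have "\<sigma> < excess U" using less.prems s_hi by simp
  then obtain A B where S: "separation U A B" and le: "excess B \<le> excess A"
    using separation_ordered less.prems by blast
  note pt = separation_parts[OF S less.prems(1)]
  define a where "a = excess A" define b where "b = excess B" define y where "y = a + b"
  have ab: "0 < b" "b \<le> a" "excess U = y" using pt le by (auto simp: a_def b_def y_def)
  have y: "1 \<le> y" "y \<le> 124 / 100" using less.prems ab by auto
  define c where "c = 2 - 1 / y"
  have c: "c * y = 2 * y - 1" using y by (simp add: c_def field_simps)
  have K1: "K x z \<le> 1" for x z using K(2)[of x z] by simp
  obtain p r t q u v where
    p: "mass K (B - A) (B - A) = p" "mass K (A - B) (A - B) = r" "mass K (A \<inter> B) (A \<inter> B) = t"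
    and q: "mass K (B - A) (A - B) = q"
    and m: "mass K A A = r + t + 2 * v" "mass K B B = p + t + 2 * u"
      "mass K U U = p + r + t + 2 * q + 2 * u + 2 * v"
    and bm: "block_masses (1 / 2) a b p r t q u v"
    unfolding a_def b_def by (rule kernel_blocks[OF S less.prems(1) K])
  have rowmass: "mass K X (X \<union> Y) \<le> real (card X) / real k / 2" if "X \<subseteq> U" "Y \<subseteq> U" for X Y
  proof -
    have "(\<Sum>x\<in>X. \<Sum>z\<in>X \<union> Y. K x z) \<le> (\<Sum>x\<in>X. real k / 2)"
    proof (intro sum_mono)
      fix x assume "x \<in> X"
      have "(\<Sum>z\<in>X \<union> Y. K x z) \<le> (\<Sum>z\<in>U. K x z)"
        using that pt kernel_nonneg[OF K(1)] by (intro sum_mono2) auto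
      then show "(\<Sum>z\<in>X \<union> Y. K x z) \<le> real k / 2" using less.prems(4)[of x] that \<open>x \<in> X\<close> by auto
    qed
    then have "mass K X (X \<union> Y) \<le> (real (card X) * (real k / 2)) / (real k)\<^sup>2"
      unfolding mass_def by (intro divide_right_mono) auto
    then show ?thesis using k0 by (simp add: power2_eq_square field_simps)
  qed
  have fin: "finite (B - A)" "finite (A - B)" and sub: "B - A \<subseteq> U" "A - B \<subseteq> U" using pt by auto
  have "mass K (B - A) ((B - A) \<union> (A - B)) = p + q" using fin p q by (subst mass_union_right) auto
  then have 1: "p + q \<le> b / 2" using rowmass[OF sub] pt(11) by (simp add: b_def)
  have "mass K (A - B) ((A - B) \<union> (B - A)) = r + q"
    using fin p q mass_commute[of K "A - B" "B - A"] kernel_sym[OF K(1)] by (subst mass_union_right) auto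
  then have 2: "r + q \<le> a / 2" using rowmass[OF sub(2,1)] pt(12) by (simp add: a_def)
  have "0 \<le> a\<^sup>2 * p + 2 * a * (- b) * q + (- b)\<^sup>2 * r" by (rule block_masses_quad[OF bm])
  moreover have "a\<^sup>2 * p \<le> a\<^sup>2 * (b / 2 - q)" "b\<^sup>2 * r \<le> b\<^sup>2 * (a / 2 - q)"
    using 1 2 by (intro mult_left_mono; simp)+
  ultimately have "2 * (q * y) * y \<le> a * b * y" unfolding y_def by ((simp only: monomials)?; linarith)
  then have "2 * q * y \<le> a * b" using y by simp
  then have "2 * q \<le> a * b / y" using y by (simp add: pos_le_divide_eq)
  also have "a * b / y = (2 - c) * (a * b)" by (simp add: c_def)
  finally have 3: "c * (a * b) + deficit K A \<le> deficit K U"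
    using deficit_block(1)[OF S less.prems(1) K(1) K1] unfolding q a_def[symmetric] b_def[symmetric]
    by ((simp only: monomials)?; linarith)
  have half: "holes (\<lambda>_ _. 1) A A / 2 \<le> deficit K A"
  proof -
    have "holes K A A \<le> holes (\<lambda>x y. 1 / 2 * 1) A A" using K(2) by (intro holes_mono) simp
    then show ?thesis unfolding holes_scale deficit_def by simp
  qed
  have "row_gain \<sigma> y \<le> c * (a * b) + deficit K A"
  proof (cases "1 \<le> a")
    case True
    have "row_gain \<sigma> a \<le> deficit K A"
      unfolding a_def
    proof (rule less.hyps)
      show "(\<Sum>z\<in>A. K x z) \<le> real k / 2" if "x \<in> A" for x
      proof -
        have "(\<Sum>z\<in>A. K x z) \<le> (\<Sum>z\<in>U. K x z)"
          using pt kernel_nonneg[OF K(1)] by (intro sum_mono2) auto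
        then show ?thesis using less.prems(4)[of x] that pt by auto
      qed
    qed (use pt True y ab in \<open>auto simp: a_def y_def b_def\<close>)
    then show ?thesis using row_gain_large[OF ab(1,2) y_def y c True] by simp
  next
    case False
    show ?thesis
    proof (cases "a \<le> \<sigma>")
      case True
      have "0 \<le> holes (\<lambda>_ _. 1) A A" by (intro holes_nonneg) simp
      then show ?thesis using row_gain_small[OF ab(1,2) y_def y c True] half by simp
    next
      case a: False
      have "2 * \<sigma> * (a - \<sigma>) \<le> holes (\<lambda>_ _. 1) A A"
        unfolding a_def using False s_lo by (intro holes_ge_linear pt) (simp add: a_def)
      then show ?thesis using row_gain_medium[OF ab(1,2) y_def y c] a False half by simp
    qed
  qed
  then show ?case using 3 ab by simp
qed

end

section \<open>The second alternative\<close>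

text \<open>The tangent to \<open>1 / y\<close> at the point \<open>1 / i\<close> lies below it.
  This makes \<open>slope\<close> accessible to linear arithmetic; every later value of
  \<open>i\<close> is the reciprocal of a chosen point of tangency.\<close>

lemma slope_le:
  assumes "0 < s" "0 < y"
  shows "s < y \<Longrightarrow> y \<le> 2 * s \<Longrightarrow> slope s y \<le> 1 - s * (2 * i - y * i\<^sup>2)"
    and "2 * s \<le> y \<Longrightarrow> slope s y \<le> 3 / 4 - s / 2 * (2 * i - y * i\<^sup>2)"
proof -
  have "0 \<le> (1 - y * i)\<^sup>2 / y" using assms by simp
  also have "(1 - y * i)\<^sup>2 / y = 1 / y - (2 * i - y * i\<^sup>2)"
    using assms by (simp add: field_simps power2_eq_square)
  finally have i: "2 * i - y * i\<^sup>2 \<le> 1 / y" by simp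
  have i1: "s * (2 * i - y * i\<^sup>2) \<le> s / y" using mult_left_mono[OF i, of s] assms by simp
  then show "s < y \<Longrightarrow> y \<le> 2 * s \<Longrightarrow> slope s y \<le> 1 - s * (2 * i - y * i\<^sup>2)"
    by (simp add: slope_def)
  have i2: "s / 2 * (2 * i - y * i\<^sup>2) \<le> s / (2 * y)" using i1 by simp
  show "slope s y \<le> 3 / 4 - s / 2 * (2 * i - y * i\<^sup>2)" if "2 * s \<le> y"
  proof (cases "y = 2 * s")
    case True
    then have "slope s y = 3 / 4 - s / (2 * y)" using assms by (simp add: slope_def)
    then show ?thesis using i2 by linarith
  next
    case False
    then have "slope s y = 3 / 4 - s / (2 * y)" using assms that by (simp add: slope_def)
    then show ?thesis using i2 by linarith
  qed
qed

lemma slope_ge_half: "0 < s \<Longrightarrow> 2 * s \<le> y \<Longrightarrow> 1 / 2 \<le> slope s y"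
  by (cases "y = 2 * s") (auto simp: slope_def field_simps)

context sep_graph begin

section \<open>Estimates for weights bounded by 1/2 or 3/4 and for bounded row sums\<close>

text \<open>The test function is \<open>k\<close> at \<open>x\<close> minus the indicator of
  \<open>X\<close>: twice the row sum over \<open>k\<close> is at most \<open>K x x\<close> plus the
  mass of \<open>K\<close>, hence at most 1.\<close>

lemma row_le:
  assumes K: "kernel K" "\<And>x y. K x y \<le> 1 / 2" and X: "finite X" "x \<in> X" "mass K X X \<le> 1 / 2"
  shows "(\<Sum>z\<in>X. K x z) \<le> real k / 2"
proof -
  have "0 \<le> (real k)\<^sup>2 * mass K {x} {x} + 2 * real k * (- 1) * mass K {x} X + (- 1)\<^sup>2 * mass K X X"
    using X by (intro mass_quad[OF K(1)]) auto
  also have "\<dots> = K x x - 2 * ((\<Sum>z\<in>X. K x z) / real k) + mass K X X"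
    using k0 by (simp add: mass_def power2_eq_square)
  finally have "(\<Sum>z\<in>X. K x z) / real k \<le> 1 / 2" using K(2)[of x x] X(3) by linarith
  then show ?thesis using k0 by (simp add: divide_le_eq)
qed

text \<open>Gluing with all four parameters \<open>1 / 2\<close>; the glued weights are bounded by
  \<open>1 / 4 + 1 / 2 = 3 / 4\<close>.\<close>

lemma split_half:
  assumes S: "separation U A B" and U: "U \<subseteq> V" and K: "kernel K" "\<And>x y. K x y \<le> 1 / 2"
    and m: "mass K A A = r + t + 2 * v" "mass K B B = p + t + 2 * u"
      "mass K U U = p + r + t + 2 * q + 2 * u + 2 * v"
      "mass K (A - B) (A - B) = r" "mass K (B - A) (B - A) = p"
    and A: "\<And>L. kernel L \<Longrightarrow> (\<And>x y. L x y \<le> 3 / 4) \<Longrightarrow> W A + holes L A A \<le> ca + ga * mass L A A"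
    and B: "\<And>L. kernel L \<Longrightarrow> (\<And>x y. L x y \<le> 3 / 4) \<Longrightarrow> W B + holes L B B \<le> cb + gb * mass L B B"
  shows "W U + holes K U U \<le> (ca + ga * (r + t / 2 + v + 1 / 2)) + (cb + gb * (p + t / 2 + u + 1 / 2))
    + (2 * q + u + v) - 1"
proof -
  note S' = separation_swap[OF S]
  define L where "L = glue (1 / 2) (1 / 2) K A B"
  define M where "M = glue (1 / 2) (1 / 2) K B A"
  have massL: "mass L A A = r + t / 2 + v + 1 / 2"
    unfolding L_def glue_mass[OF S U] m by ((simp only: monomials)?; linarith)
  have massM: "mass M B B = p + t / 2 + u + 1 / 2"
    unfolding M_def glue_mass[OF S' U] m by ((simp only: monomials)?; linarith)
  have L: "kernel L" unfolding L_def by (simp add: kernel_glue[OF K(1)])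
  have L_le: "L x y \<le> 3 / 4" for x y unfolding L_def by (rule glue_le[OF K(2,1)]) auto
  have M: "kernel M" unfolding M_def by (simp add: kernel_glue[OF K(1)])
  have M_le: "M x y \<le> 3 / 4" for x y unfolding M_def by (rule glue_le[OF K(2,1)]) auto
  have "W U + holes K U U \<le> (W A + holes L A A) + (W B + holes M B B) + mass K U U - mass L A A - mass M B B"
    by (intro split_bound[OF S U K(1) _ _ _ _ L_def M_def]) auto
  then show ?thesis using A[OF L L_le] B[OF M M_le] unfolding massL massM m by linarith
qed

text \<open>With \<alpha> = 0 the glued weight lives on two separate blocks. A row in the overlap
  consists of \<open>k\<close> entries \<open>1 / 2\<close>, and a row in \<open>A - B\<close> is a
  row of \<open>K\<close>, bounded by \<open>row_le\<close>.\<close>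

lemma glue_rows:
  assumes S: "separation U A B" and U: "U \<subseteq> V" and K: "kernel K" "\<And>x y. K x y \<le> 1 / 2"
    and m: "mass K (A - B) (A - B) \<le> 1 / 2" and x: "x \<in> A"
  shows "(\<Sum>z\<in>A. glue 0 (1 / 2) K A B x z) \<le> real k / 2"
proof (cases "x \<in> B")
  case True
  have "(\<Sum>z\<in>A. glue 0 (1 / 2) K A B x z) = (\<Sum>z\<in>A. if z \<in> B then 1 / 2 else 0)"
    using True x by (intro sum.cong) (auto simp: glue_def on_set_def)
  also have "\<dots> = real k / 2"
    using S separation_parts(5)[OF S U] by (simp add: sum.inter_restrict[symmetric] separation_def)
  finally show ?thesis by simp
next
  case False
  have "(\<Sum>z\<in>A. glue 0 (1 / 2) K A B x z) = (\<Sum>z\<in>A. if z \<in> A - B then K x z else 0)"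
    using False x by (intro sum.cong) (auto simp: glue_def on_set_def)
  also have "\<dots> = (\<Sum>z\<in>A \<inter> (A - B). K x z)"
    using separation_parts(5)[OF S U] by (simp add: sum.inter_restrict)
  also have "A \<inter> (A - B) = A - B" by auto
  also have "(\<Sum>z\<in>A - B. K x z) \<le> real k / 2"
    using False x m separation_parts(5)[OF S U] by (intro row_le[OF K]) auto
  finally show ?thesis .
qed

lemma split_rows:
  assumes S: "separation U A B" and U: "U \<subseteq> V" and K: "kernel K" "\<And>x y. K x y \<le> 1 / 2"
    and m: "mass K A A = r + t + 2 * v" "mass K B B = p + t + 2 * u"
      "mass K U U = p + r + t + 2 * q + 2 * u + 2 * v"
      "mass K (A - B) (A - B) = r" "mass K (B - A) (B - A) = p" and pr: "p \<le> 1 / 2" "r \<le> 1 / 2"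
    and A: "\<And>L. kernel L \<Longrightarrow> (\<And>x y. L x y \<le> 1 / 2) \<Longrightarrow> (\<And>x. x \<in> A \<Longrightarrow> (\<Sum>z\<in>A. L x z) \<le> real k / 2) \<Longrightarrow> W A + holes L A A \<le> ca"
    and B: "\<And>L. kernel L \<Longrightarrow> (\<And>x y. L x y \<le> 1 / 2) \<Longrightarrow> (\<And>x. x \<in> B \<Longrightarrow> (\<Sum>z\<in>B. L x z) \<le> real k / 2) \<Longrightarrow> W B + holes L B B \<le> cb"
  shows "W U + holes K U U \<le> ca + cb + t + 2 * q + 2 * u + 2 * v - 1"
proof -
  note S' = separation_swap[OF S]
  define L where "L = glue 0 (1 / 2) K A B"
  define M where "M = glue 0 (1 / 2) K B A"
  have massL: "mass L A A = r + 1 / 2" unfolding L_def glue_mass[OF S U] m by simp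
  have massM: "mass M B B = p + 1 / 2" unfolding M_def glue_mass[OF S' U] m by simp
  have L: "kernel L" unfolding L_def by (simp add: kernel_glue[OF K(1)])
  have L_le: "L x y \<le> 1 / 2" for x y unfolding L_def by (rule glue_le[OF K(2,1)]) auto
  have M: "kernel M" unfolding M_def by (simp add: kernel_glue[OF K(1)])
  have M_le: "M x y \<le> 1 / 2" for x y unfolding M_def by (rule glue_le[OF K(2,1)]) auto
  have "W U + holes K U U \<le> (W A + holes L A A) + (W B + holes M B B) + mass K U U - mass L A A - mass M B B"
    by (intro split_bound[OF S U K(1) _ _ _ _ L_def M_def]) auto
  moreover have "W A + holes L A A \<le> ca"
    using pr m L L_le glue_rows[OF S U K] by (intro A) (auto simp: L_def)
  moreover have "W B + holes M B B \<le> cb"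
    using pr m M M_le glue_rows[OF S' U K] by (intro B) (auto simp: M_def)
  ultimately show ?thesis unfolding massL massM m by linarith
qed

text \<open>\<open>deficit_slope_scaled\<close> with \<open>D = 1 / 2\<close>: half of the quadratic
  bound on the holes plus the slope term.\<close>

lemma half_bound:
  assumes U: "U \<subseteq> V" "2 * \<sigma> \<le> excess U" "excess U \<le> 15 / 4 * \<sigma>" and K: "kernel K" "\<And>x y. K x y \<le> 1 / 2"
  shows "W U + holes K U U \<le> 1 - \<gamma> * excess U + 3 / 8 * (excess U)\<^sup>2 - \<sigma> * excess U / 4 + \<sigma>\<^sup>2
    + slope \<sigma> (excess U) * mass K U U"
proof -
  have y: "0 < excess U" using U sigma_pos by linarith
  have "slope \<sigma> (excess U) * excess U = 3 / 4 * excess U - \<sigma> / 2"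
    using slope_mult[OF y, of \<sigma>] U sigma_pos by auto
  then have "slope \<sigma> (excess U) * (1 / 2 * (excess U)\<^sup>2) = (3 / 4 * excess U - \<sigma> / 2) * excess U / 2"
    by (simp add: power2_eq_square)
  then show ?thesis
    unfolding W_plus_holes
    using deficit_slope_scaled[OF U(1) y U(3) K] holes_ge_quadratic[OF U(1)] y
    by ((simp only: monomials)?; linarith)
qed

lemma three_quarter_bound:
  assumes U: "U \<subseteq> V" "\<sigma> < excess U" "excess U \<le> 15 / 4 * \<sigma>" and K: "kernel K" "\<And>x y. K x y \<le> 3 / 4"
  shows "W U + holes K U U \<le> (1 - \<gamma> * excess U + (if excess U \<le> 2 * \<sigma>
      then (excess U)\<^sup>2 / 4 + \<sigma> * excess U / 4 + \<sigma>\<^sup>2 / 2 else 5 / 16 * (excess U)\<^sup>2 + \<sigma> * excess U / 8 + \<sigma>\<^sup>2 / 2))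
    + slope \<sigma> (excess U) * mass K U U"
proof -
  have y: "0 < excess U" using U sigma_pos by linarith
  have sl: "slope \<sigma> (excess U) * (3 / 4 * (excess U)\<^sup>2) = (slope \<sigma> (excess U) * excess U) * excess U * (3 / 4)"
    by (simp add: power2_eq_square)
  note d = deficit_slope_scaled[OF U(1) y U(3) K]
  show ?thesis
  proof (cases "excess U \<le> 2 * \<sigma>")
    case True
    have "slope \<sigma> (excess U) * excess U = excess U - \<sigma>" using slope_mult[OF y, of \<sigma>] U True by auto
    note sl[unfolded this]
    then show ?thesis unfolding W_plus_holes using d holes_ge_linear[OF U(1) True] True
      by ((simp only: monomials if_True)?; linarith)
  next
    case False
    have "slope \<sigma> (excess U) * excess U = 3 / 4 * excess U - \<sigma> / 2" using slope_mult[OF y, of \<sigma>] U False by auto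
    note sl[unfolded this]
    then show ?thesis unfolding W_plus_holes using d holes_ge_quadratic[OF U(1)] y False
      by ((simp only: monomials if_False)?; linarith)
  qed
qed

lemma half_deficit:
  assumes U: "U \<subseteq> V" "\<sigma> < excess U" "excess U \<le> 15 / 4 * \<sigma>" and K: "kernel K" "\<And>x y. K x y \<le> 1 / 2"
  shows "(excess U)\<^sup>2 - deficit K U / 2 \<le> 11 / 16 * (excess U)\<^sup>2 - \<sigma> * excess U / 8 + \<sigma>\<^sup>2 / 2
    + slope \<sigma> (excess U) * mass K U U / 2"
proof -
  have y: "0 < excess U" using U sigma_pos by linarith
  have sl: "slope \<sigma> (excess U) * (1 / 2 * (excess U)\<^sup>2) = (slope \<sigma> (excess U) * excess U) * excess U / 2"
    by (simp add: power2_eq_square)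
  note d = deficit_slope_scaled[OF U(1) y U(3) K]
  show ?thesis
  proof (cases "excess U \<le> 2 * \<sigma>")
    case True
    have "slope \<sigma> (excess U) * excess U = excess U - \<sigma>" using slope_mult[OF y, of \<sigma>] U True by auto
    note sl[unfolded this]
    moreover have "0 \<le> excess U * (2 * \<sigma> - excess U)" using True y by simp
    ultimately show ?thesis using d holes_ge_linear[OF U(1) True] True
      by ((simp only: monomials)?; linarith)
  next
    case False
    have "slope \<sigma> (excess U) * excess U = 3 / 4 * excess U - \<sigma> / 2" using slope_mult[OF y, of \<sigma>] U False by auto
    note sl[unfolded this]
    then show ?thesis using d holes_ge_quadratic[OF U(1)] y False
      by ((simp only: monomials)?; linarith)
  qed
qed

lemma rows_bound:
  assumes \<sigma>: "sigma2 \<sigma>" and U: "U \<subseteq> V" "1 \<le> excess U" "excess U \<le> 124 / 100"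
    and K: "kernel K" "\<And>x y. K x y \<le> 1 / 2" "\<And>x. x \<in> U \<Longrightarrow> (\<Sum>z\<in>U. K x z) \<le> real k / 2"
  shows "W U + holes K U U \<le> 1 - \<gamma> * excess U + (3 / 4 - 249 / 1000) * (excess U)\<^sup>2 - \<sigma> * excess U / 2 + \<sigma>\<^sup>2
    + 249 / 1000 * excess U"
  unfolding W_plus_holes
  using deficit_row_gain[OF \<sigma> U K] row_gain_ge[of \<sigma> "excess U"] U sigma_pos
  by ((simp only: monomials)?; linarith)

end

context
  fixes p q r t u v ga gb m :: real
  assumes nn: "0 \<le> p" "0 \<le> r" "0 \<le> t" "0 \<le> u" "0 \<le> v" "2 * q \<le> p + r"
    and g: "0 \<le> gb" "gb \<le> ga" "ga \<le> 1" and m: "m = p + r + t + 2 * q + 2 * u + 2 * v"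
begin

lemma split_half_mass:
  "ga * (r + t / 2 + v) + gb * (p + t / 2 + u) + (2 * q + u + v) \<le> (1 / 2 + ga / 2) * m"
proof -
  have "0 \<le> (ga - gb) * p" "0 \<le> (ga - gb) * t" "0 \<le> (ga - gb) * u" "0 \<le> (1 - ga) * (p + r - 2 * q)"
    "0 \<le> (1 - gb) * t" using nn g by auto
  then show ?thesis unfolding m by ((simp only: monomials)?; linarith)
qed

lemma mixed_mass:
  assumes "ga / 4 \<le> \<kappa>" "3 / 8 * (ga + gb) - 1 / 4 \<le> \<kappa>" "\<kappa> \<le> 1 / 2"
  shows "(ga * (r + t / 2 + v) + gb * (p + t / 2 + u) + (2 * q + u + v)) / 2
    + ((ga + gb) * t / 2 + 2 * q) / 4 + (t + 2 * q + 2 * u + 2 * v) / 4 \<le> (1 / 2 + \<kappa>) * m"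
proof -
  have "0 \<le> (\<kappa> - ga / 4) * r" "0 \<le> (\<kappa> - ga / 4) * p" "0 \<le> (\<kappa> - ga / 4) * u" "0 \<le> (\<kappa> - ga / 4) * v"
    "0 \<le> (ga - gb) * p" "0 \<le> (ga - gb) * u" "0 \<le> (1 - 2 * \<kappa>) * (p + r - 2 * q)"
    "0 \<le> (\<kappa> - (3 / 8 * (ga + gb) - 1 / 4)) * t" using nn g assms by auto
  then show ?thesis unfolding m by ((simp only: monomials)?; linarith)
qed


end

section \<open>Numerical case analysis for the second alternative\<close>

context sep_graph begin

text \<open>From \<open>135 / 100\<close> to \<open>195 / 100\<close> the estimate
  \<open>half_bound\<close> suffices. In larger sets either the bigger side is good by induction, or
  both excesses lie between \<open>60 / 100\<close> and \<open>135 / 100\<close>. Then peeling,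
  \<open>PS\<close> (parameters \<open>1 / 2\<close>), \<open>J\<close> (joining) and
  \<open>JR\<close> (bounded row sums) divide the range among them.\<close>

lemma good_case2:
  assumes \<sigma>: "sigma2 \<sigma>" and \<gamma>: "\<gamma> = 11 / 5 * \<sigma>" and U: "U \<subseteq> V" "135 / 100 \<le> excess U"
  shows "good U"
  using U
proof (induction "card U" arbitrary: U rule: less_induct)
  case less
  interpret sigma2 \<sigma> by fact
  note sl = s_lo s_hi
  have prod: "5270462 / 10000000 * x \<le> \<sigma> * x" "\<sigma> * x \<le> 5270463 / 10000000 * x" if "0 \<le> x" for x
    by (rule mult_right_mono[OF sl(1) that], rule mult_right_mono[OF sl(2) that])
  have \<gamma>x: "\<gamma> * x = 11 / 5 * (\<sigma> * x)" for x by (simp add: \<gamma>)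
  have \<gamma>1: "1 \<le> \<gamma>" using sl by (simp add: \<gamma>)
  have tang2: "slope \<sigma> x \<le> 3 / 4 - i * \<sigma> + i\<^sup>2 / 2 * (\<sigma> * x)" if "2 * \<sigma> \<le> x" "0 < x" for x i
    using slope_le(2)[OF sigma_pos that(2,1), of i] by ((simp only: monomials)?; linarith)
  have tang1: "slope \<sigma> x \<le> 1 - 2 * i * \<sigma> + i\<^sup>2 * (\<sigma> * x)" if "\<sigma> < x" "x \<le> 2 * \<sigma>" for x i
    using slope_le(1)[OF sigma_pos _ that, of i] that sigma_pos by ((simp only: monomials)?; linarith)
  show ?case
  proof (cases "excess U \<le> 195 / 100")
    case True
    define y where "y = excess U"
    have y: "135 / 100 \<le> y" "y \<le> 195 / 100" "2 * \<sigma> \<le> y" "y \<le> 15 / 4 * \<sigma>"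
      using True less.prems sl by (auto simp: y_def)
    have "0 \<le> (y - 135 / 100) * (195 / 100 - y)" using y by simp
    then have 1: "1 - 49 / 20 * (\<sigma> * y) + 3 / 8 * y\<^sup>2 + 5 / 18 + slope \<sigma> y / 2 \<le> 1 / 2"
      using tang2[OF y(3), of "64 / 100"] prod[of y] y sl by ((simp only: monomials)?; linarith)
    show ?thesis unfolding good_def
    proof (intro allI impI)
      fix K :: "'a \<Rightarrow> 'a \<Rightarrow> real"
      assume K: "kernel K" "\<forall>x y. K x y \<le> 1 / 2" "mass K U U \<le> 1 / 2"
      \<comment> \<open>The slope is at least \<open>1 / 2\<close>, the slope of the bound in the
        definition of \<open>good\<close>, so the worst mass is \<open>1 / 2\<close>.\<close>
      have "0 \<le> (slope \<sigma> y - 1 / 2) * (1 / 2 - mass K U U)"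
        using K(3) slope_ge_half[OF sigma_pos y(3)] by simp
      then show "W U + holes K U U \<le> 1 / 4 + mass K U U / 2"
        using half_bound[OF less.prems(1) y(3,4)[unfolded y_def] K(1) K(2)[rule_format]] 1 \<gamma>x[of y] s2
        unfolding y_def[symmetric] by ((simp only: monomials)?; linarith)
    qed
  next
    case y195: False
    have "\<sigma> < excess U" using y195 sl by simp
    then obtain A B where S: "separation U A B" and le: "excess B \<le> excess A"
      using separation_ordered less.prems by blast
    note pt = separation_parts[OF S less.prems(1)]
    define a where "a = excess A" define b where "b = excess B"
    have ab: "0 < a" "0 < b" "excess U = a + b" "b \<le> a" using pt le by (auto simp: a_def b_def)
    note pa = prod[OF less_imp_le[OF ab(1)]] and pb = prod[OF less_imp_le[OF ab(2)]]
    have gA: "good A" if "135 / 100 \<le> a" using less.hyps[of A] pt that by (simp add: a_def)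
    have gB: "good B" if "135 / 100 \<le> b" using less.hyps[of B] pt that by (simp add: b_def)
    show ?thesis
    proof (cases "135 / 100 \<le> a")
      case True
      consider "b \<le> 1 / 2" | "1 / 2 \<le> b" "b \<le> 1" | "1 \<le> b" "b \<le> 135 / 100" | "135 / 100 \<le> b" by linarith
      then show ?thesis
      proof cases
        case 1
        then show ?thesis using good_peel[OF S less.prems(1) gA[OF True]] \<gamma>1 by (simp add: b_def)
      next
        case 2
        then have "0 \<le> (b - 1 / 2) * (1 - b)" by auto
        then have "1 / 12 \<le> b * (\<gamma> - b)" using 2 \<gamma>x[of b] pb by ((simp only: monomials)?; linarith)
        then show ?thesis using good_peel[OF S less.prems(1) gA[OF True]] by (simp add: b_def)
      next
        case 3
        have b: "0 < excess B" "excess B \<le> 15 / 4 * \<sigma>" using 3 sl pt by (auto simp: b_def)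
        \<comment> \<open>This is the condition \<open>c + 3 / 4 * s \<le> 3 / 4\<close> of
          \<open>good_attach\<close> for the bound that \<open>deficit_slope\<close> gives on
          \<open>B\<close>.\<close>
        have "1 - \<gamma> * b + b\<^sup>2 - slope \<sigma> b * b * b + 3 / 4 * slope \<sigma> b \<le> 3 / 4"
        proof (cases "b \<le> 2 * \<sigma>")
          case True
          have sb: "\<sigma> < b" using 3 sl by simp
          have "slope \<sigma> b * b * b = (b - \<sigma>) * b" using slope_mult[of b \<sigma>] True 3 sl by auto
          then show ?thesis
            using tang1[OF sb True, of 1] True 3 sl \<gamma>x[of b] pb by ((simp only: monomials)?; linarith)
        next
          case False
          have "slope \<sigma> b * b * b = (3 / 4 * b - \<sigma> / 2) * b" using slope_mult[of b \<sigma>] False 3 sl by auto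
          moreover have "0 \<le> (b - 1054 / 1000) * (135 / 100 - b)" using False 3 sl by auto
          ultimately show ?thesis
            using tang2[OF less_imp_le ab(2), of "5 / 6"] False 3 sl \<gamma>x[of b] pb by ((simp only: monomials)?; linarith)
        qed
        moreover have "W B + holes L B B \<le> (1 - \<gamma> * b + b\<^sup>2 - slope \<sigma> b * b * b) + slope \<sigma> b * mass L B B"
          if "kernel L" "\<And>x y. L x y \<le> 1" for L
          using deficit_slope[OF pt(4) b that] unfolding W_plus_holes b_def[symmetric]
          by ((simp only: monomials)?; linarith)
        ultimately show ?thesis
          using slope_bounds[OF sigma_pos, of b]
          by (intro good_attach[OF S less.prems(1) gA[OF True], of _ "slope \<sigma> b"]) auto
      next
        case 4
        then show ?thesis using good_glue[OF S less.prems(1) gA[OF True] gB] by simp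
      qed
    next
      case a135: False
      have y195: "195 / 100 \<le> a + b" using y195 ab by simp
      have rng: "excess A \<le> 15 / 4 * \<sigma>" "excess B \<le> 15 / 4 * \<sigma>" "\<sigma> < excess A" "\<sigma> < excess B"
        using a135 ab y195 sl by (auto simp: a_def b_def)
      have ga: "slope \<sigma> b \<le> slope \<sigma> a" "0 \<le> slope \<sigma> b" "slope \<sigma> a \<le> 1"
        using slope_mono[OF sigma_pos ab(2,4)] slope_bounds[OF sigma_pos] by auto
      show ?thesis unfolding good_def
      proof (intro allI impI)
        fix K :: "'a \<Rightarrow> 'a \<Rightarrow> real"
        assume K: "kernel K" and K1: "\<forall>x y. K x y \<le> 1 / 2" and K2: "mass K U U \<le> 1 / 2"
        have Kle: "K x y \<le> 1 / 2" "K x y \<le> 1" for x y using K1 by (auto intro: order_trans[where y="1/2"])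
        obtain p r t q u v where
          p: "mass K (B - A) (B - A) = p" "mass K (A - B) (A - B) = r" "mass K (A \<inter> B) (A \<inter> B) = t"
          and q: "mass K (B - A) (A - B) = q"
          and mA: "mass K A A = r + t + 2 * v" and mB: "mass K B B = p + t + 2 * u"
          and mU: "mass K U U = p + r + t + 2 * q + 2 * u + 2 * v"
          and bm: "block_masses (1 / 2) a b p r t q u v"
          unfolding a_def b_def by (rule kernel_blocks[OF S less.prems(1) K Kle(1)])
        note nn = block_massesD[OF bm]
        define m where "m = p + r + t + 2 * q + 2 * u + 2 * v"
        have m: "m \<le> 1 / 2" "mass K U U = m" "0 \<le> m" using mU K2 nn by (simp_all add: m_def)
        have qpr: "2 * q \<le> p + r" using block_masses_quad[OF bm, of 1 "-1"] by simp
        have peeling: "W U + holes K U U \<le> 1 / 4 + m / 2"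
          if \<kappa>: "1 / 2 \<le> \<kappa>" "\<kappa> \<le> 1" "1 \<le> \<kappa> * (2 - g)" and g: "slope \<sigma> a \<le> g" "g \<le> \<kappa>"
            and a2: "2 * \<sigma> \<le> a"
            and c: "1 - 49 / 20 * (\<sigma> * a) + 3 / 8 * a\<^sup>2 + 5 / 18 + \<kappa> / 2 - 1 / 2 \<le> b * (\<gamma> - b)" for \<kappa> g
        proof -
          \<comment> \<open>The condition \<open>1 \<le> \<kappa> * (2 - g)\<close> says
            \<open>(1 - \<kappa>)\<^sup>2 \<le> \<kappa> * (\<kappa> - g)\<close>. Dividing by
            \<kappa> then shows that the factor \<open>g\<close> on the mass of \<open>A\<close>
            together with the peeling loss \<open>2 * q\<close> is at most
            \<open>\<kappa> * m\<close>.\<close>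
          have "0 \<le> \<kappa>\<^sup>2 * p + 2 * \<kappa> * (- (1 - \<kappa>)) * q + (- (1 - \<kappa>))\<^sup>2 * r" by (rule block_masses_quad[OF bm])
          moreover have "0 \<le> (\<kappa> * (2 - g) - 1) * r" using \<kappa> nn by simp
          ultimately have "0 \<le> \<kappa> * (\<kappa> * p - 2 * (1 - \<kappa>) * q + (\<kappa> - g) * r)"
            by ((simp only: monomials)?; linarith)
          then have "0 \<le> \<kappa> * p - 2 * (1 - \<kappa>) * q + (\<kappa> - g) * r" using \<kappa>(1) by (simp add: zero_le_mult_iff)
          moreover have "0 \<le> (\<kappa> - g) * (t + 2 * v)" "0 \<le> \<kappa> * u" "0 \<le> (g - slope \<sigma> a) * (r + t + 2 * v)" using \<kappa> g nn by auto
          ultimately have 1: "slope \<sigma> a * (r + t + 2 * v) + 2 * q \<le> \<kappa> * m" unfolding m_def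
            by ((simp only: monomials)?; linarith)
          have "W A + holes K A A \<le> 1 - 49 / 20 * (\<sigma> * a) + 3 / 8 * a\<^sup>2 + 5 / 18 + slope \<sigma> a * (r + t + 2 * v)"
            using half_bound[OF pt(3) a2[unfolded a_def] rng(1) K Kle(1)] \<gamma>x[of a] s2 unfolding mA a_def[symmetric]
            by ((simp only: monomials)?; linarith)
          moreover have "0 \<le> (\<kappa> - 1 / 2) * (1 / 2 - m)" using \<kappa> m by simp
          ultimately show ?thesis using peel[OF S less.prems(1) K Kle(2)] 1 c unfolding q b_def[symmetric]
            by ((simp only: monomials)?; linarith)
        qed
        have hb: "c \<le> b * (\<gamma> - b)"
          if "l \<le> b" "b \<le> h" "0 \<le> - c + \<gamma> * l - 1 * l\<^sup>2" "0 \<le> - c + \<gamma> * h - 1 * h\<^sup>2" for c l h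
          using quadratic_concave[OF _ that] by (simp add: algebra_simps power2_eq_square)
        define qb where "qb = (if b \<le> 2 * \<sigma> then b\<^sup>2 / 4 + \<sigma> * b / 4 + \<sigma>\<^sup>2 / 2 else 5 / 16 * b\<^sup>2 + \<sigma> * b / 8 + \<sigma>\<^sup>2 / 2)"
        have PS: "W U + holes K U U \<le> 1 - 11 / 5 * (\<sigma> * a) - 11 / 5 * (\<sigma> * b)
            + 5 / 16 * a\<^sup>2 + \<sigma> * a / 8 + 5 / 36 + qb + (slope \<sigma> a + slope \<sigma> b) / 2
            + (slope \<sigma> a * (r + t / 2 + v) + slope \<sigma> b * (p + t / 2 + u) + (2 * q + u + v))"
          if a2: "2 * \<sigma> < a"
        proof -
          define ca where "ca = 1 - \<gamma> * a + (5 / 16 * a\<^sup>2 + \<sigma> * a / 8 + \<sigma>\<^sup>2 / 2)"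
          define cb where "cb = 1 - \<gamma> * b + qb"
          have "W U + holes K U U \<le> (ca + slope \<sigma> a * (r + t / 2 + v + 1 / 2))
              + (cb + slope \<sigma> b * (p + t / 2 + u + 1 / 2)) + (2 * q + u + v) - 1"
          proof (rule split_half[OF S less.prems(1) K Kle(1) mA mB mU p(2,1)])
            show "W A + holes L A A \<le> ca + slope \<sigma> a * mass L A A"
              if "kernel L" "\<And>x y. L x y \<le> 3 / 4" for L
              using three_quarter_bound[OF pt(3) rng(3,1) that] a2 by (simp add: ca_def a_def)
            show "W B + holes L B B \<le> cb + slope \<sigma> b * mass L B B"
              if "kernel L" "\<And>x y. L x y \<le> 3 / 4" for L
              using three_quarter_bound[OF pt(4) rng(4,2) that] unfolding cb_def qb_def b_def .
          qed
          then show ?thesis unfolding ca_def cb_def \<gamma>x s2 by ((simp only: monomials)?; linarith)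
        qed
        have J: "W U + holes K U U \<le> 1 - 11 / 5 * (\<sigma> * a) - 11 / 5 * (\<sigma> * b)
            + 11 / 16 * (a\<^sup>2 + b\<^sup>2) - \<sigma> * a / 8 - \<sigma> * b / 8 + 5 / 18 + (slope \<sigma> a + slope \<sigma> b) * t / 2 + 2 * q"
        proof -
          define J where "J = on_set (A \<inter> B) K"
          have J: "kernel J" "\<And>x y. J x y \<le> 1 / 2"
            unfolding J_def using kernel_on_set[OF K] Kle by (auto simp: on_set_def)
          have f: "finite A" "finite B" using pt by auto
          have i: "A \<inter> (A \<inter> B) = A \<inter> B" "B \<inter> (A \<inter> B) = A \<inter> B" by auto
          have mJ: "mass J A A = t" "mass J B B = t"
            unfolding J_def mass_on_set[OF f(1) f(1)] mass_on_set[OF f(2) f(2)] i p by auto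
          show ?thesis
            using join_bound[OF S less.prems(1) K Kle(1) J_def] half_deficit[OF pt(3) rng(3,1) J]
              half_deficit[OF pt(4) rng(4,2) J] \<gamma>x[of "a + b"]
            unfolding mJ q ab(3) a_def[symmetric] b_def[symmetric] s2 by ((simp only: monomials)?; linarith)
        qed
        have JR: "W U + holes K U U \<le> 1 - 11 / 5 * (\<sigma> * a) - 11 / 5 * (\<sigma> * b)
            + 501 / 1000 * (a\<^sup>2 + b\<^sup>2) - \<sigma> * a / 2 - \<sigma> * b / 2 + 5 / 9 + 249 / 1000 * (a + b) + (t + 2 * q + 2 * u + 2 * v)"
          if "1 \<le> b" "a \<le> 124 / 100"
        proof -
          define ca where "ca x = 1 - \<gamma> * x + (3 / 4 - 249 / 1000) * x\<^sup>2 - \<sigma> * x / 2 + \<sigma>\<^sup>2 + 249 / 1000 * x" for x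
          have "W U + holes K U U \<le> ca a + ca b + t + 2 * q + 2 * u + 2 * v - 1"
          proof (rule split_rows[OF S less.prems(1) K Kle(1) mA mB mU p(2,1)])
            show "p \<le> 1 / 2" "r \<le> 1 / 2" using m(1) nn unfolding m_def by linarith+
            have a1: "1 \<le> excess A" "excess A \<le> 124 / 100" "1 \<le> excess B" "excess B \<le> 124 / 100"
              using that ab by (auto simp: a_def b_def)
            show "W A + holes L A A \<le> ca a"
              if "kernel L" "\<And>x y. L x y \<le> 1 / 2" "\<And>x. x \<in> A \<Longrightarrow> (\<Sum>z\<in>A. L x z) \<le> real k / 2" for L
              using rows_bound[OF \<sigma> pt(3) a1(1,2) that] by (simp add: ca_def a_def)
            show "W B + holes L B B \<le> ca b"
              if "kernel L" "\<And>x y. L x y \<le> 1 / 2" "\<And>x. x \<in> B \<Longrightarrow> (\<Sum>z\<in>B. L x z) \<le> real k / 2" for L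
              using rows_bound[OF \<sigma> pt(4) a1(3,4) that] by (simp add: ca_def b_def)
          qed
          then show ?thesis unfolding ca_def \<gamma>x s2 by ((simp only: monomials)?; linarith)
        qed
        \<comment> \<open>Half of PS plus a quarter each of J and JR.\<close>
        have mixed: "W U + holes K U U \<le> 1 / 4 + m / 2"
          if bb: "102 / 100 \<le> b" "a \<le> 124 / 100" "217 / 100 \<le> a + b"
        proof -
          define \<kappa> where "\<kappa> = max (slope \<sigma> a / 4) (3 / 8 * (slope \<sigma> a + slope \<sigma> b) - 1 / 4)"
          have a2: "2 * \<sigma> < a" and b1: "1 \<le> b" using bb ab sl by auto
          have \<kappa>1: "slope \<sigma> a / 4 \<le> \<kappa>" "3 / 8 * (slope \<sigma> a + slope \<sigma> b) - 1 / 4 \<le> \<kappa>"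
            unfolding \<kappa>_def by (rule max.cobounded1, rule max.cobounded2)
          have \<kappa>2: "0 \<le> \<kappa>" using \<kappa>1(1) ga by linarith
          have \<kappa>3: "\<kappa> \<le> 1 / 2"
            unfolding \<kappa>_def max.bounded_iff using ga by (intro conjI; (simp only: monomials)?; linarith)
          define c where "c = 1 - 11 / 5 * (\<sigma> * a) - 11 / 5 * (\<sigma> * b)
            + (5 / 16 * a\<^sup>2 + \<sigma> * a / 8 + 5 / 36 + qb + (slope \<sigma> a + slope \<sigma> b) / 2) / 2
            + (11 / 16 * (a\<^sup>2 + b\<^sup>2) - \<sigma> * a / 8 - \<sigma> * b / 8 + 5 / 18) / 4
            + (501 / 1000 * (a\<^sup>2 + b\<^sup>2) - \<sigma> * a / 2 - \<sigma> * b / 2 + 5 / 9 + 249 / 1000 * (a + b)) / 4"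
          have "W U + holes K U U \<le> c + (1 / 2 + \<kappa>) * m"
            using mixed_mass[OF nn(1,2,3,5,6) qpr ga(2,1,3) m_def \<kappa>1 \<kappa>3] PS[OF a2] J JR[OF b1 bb(2)]
            unfolding c_def by ((simp only: monomials)?; linarith)
          moreover have "0 \<le> \<kappa> * (1 / 2 - m)" using \<kappa>2 m by simp
          moreover have "c + \<kappa> / 2 \<le> 1 / 4"
          proof -
            note ta = tang2[OF less_imp_le[OF a2] ab(1), of "88 / 100"]
            have "c + slope \<sigma> a / 8 \<le> 1 / 4 \<and> c + (3 / 8 * (slope \<sigma> a + slope \<sigma> b) - 1 / 4) / 2 \<le> 1 / 4"
            proof (cases "b \<le> 2 * \<sigma>")
              case True
              \<comment> \<open>\<open>10541 / 10000\<close> is \<open>2 * \<sigma>\<close> rounded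
                up, so \<open>a + b \<ge> 217 / 100\<close> forces
                \<open>a \<ge> 1115 / 1000\<close>. The products replace the convex squares in
                \<open>a\<close> and \<open>b\<close> by chords.\<close>
              have "0 \<le> (a - 1115 / 1000) * (124 / 100 - a)" "0 \<le> (b - 102 / 100) * (10541 / 10000 - b)"
                using True bb sl by auto
              moreover have sb: "\<sigma> < b" using bb sl by simp
              moreover have "qb = b\<^sup>2 / 4 + \<sigma> * b / 4 + 5 / 36" using True s2 by (simp add: qb_def)
              ultimately show ?thesis
                using ta tang1[OF sb True, of "965 / 1000"] pa pb sl bb ab unfolding c_def
                by (intro conjI; (simp only: monomials)?; linarith)
            next
              case False
              have "0 \<le> (a - 1085 / 1000) * (124 / 100 - a)" "0 \<le> (b - 1054 / 1000) * (124 / 100 - b)"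
                using False bb ab sl by auto
              moreover have "qb = 5 / 16 * b\<^sup>2 + \<sigma> * b / 8 + 5 / 36" using False s2 by (simp add: qb_def)
              ultimately show ?thesis
                using ta tang2[OF less_imp_le ab(2), of "88 / 100"] False pa pb sl bb ab unfolding c_def
                by (intro conjI; (simp only: monomials)?; linarith)
            qed
            then have "\<kappa> \<le> 1 / 2 - 2 * c"
              unfolding \<kappa>_def max.bounded_iff by (elim conjE, intro conjI; (simp only: monomials)?; linarith)
            then show ?thesis by linarith
          qed
          ultimately show ?thesis by ((simp only: monomials)?; linarith)
        qed
        have "W U + holes K U U \<le> 1 / 4 + m / 2"
        proof (cases "a \<le> 115 / 100")
          case True
          show ?thesis
          proof (cases "a + b \<le> 217 / 100")
            case False
            then show ?thesis using True by (intro mixed) auto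
          next
            case y217: True
            \<comment> \<open>The line is, up to rounding, the tangent at
              \<open>2 * \<sigma>\<close> to the outer piece of \<open>slope\<close>;
              \<open>9487 / 10000\<close> is close to \<open>1 / (2 * \<sigma>)\<close>.\<close>
            have g1: "slope \<sigma> x \<le> 2502 / 10000 + 2372 / 10000 * x" if "\<sigma> < x" for x
            proof (cases "x \<le> 2 * \<sigma>")
              case True
              show ?thesis
                using tang1[OF that True, of "9487 / 10000"] True that sl prod[of x]
                by ((simp only: monomials)?; linarith)
            next
              case False
              show ?thesis
                using tang2[of x "9487 / 10000"] False that sl prod[of x] by ((simp only: monomials)?; linarith)
            qed
            have "0 \<le> (115 / 100 - a) * (115 / 100 - b)" "0 \<le> (a + b - 195 / 100) * (217 / 100 - (a + b))"
              using True y217 y195 ab by auto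
            then have 1: "1 - 11 / 5 * (\<sigma> * a) - 11 / 5 * (\<sigma> * b)
                + 11 / 16 * (a\<^sup>2 + b\<^sup>2) - \<sigma> * a / 8 - \<sigma> * b / 8 + 5 / 18 \<le> 1 / 4 - 1 / 200"
              using pa pb y217 y195 ab by ((simp only: monomials)?; linarith)
            have "slope \<sigma> a + slope \<sigma> b \<le> 1 + 2 / 100"
              using g1[of a] g1[of b] rng y217 by (simp add: a_def b_def)
            then have "(slope \<sigma> a + slope \<sigma> b) * t \<le> (1 + 2 / 100) * t" using nn by (intro mult_right_mono) auto
            then show ?thesis using J 1 m(1) qpr nn unfolding m_def by ((simp only: monomials)?; linarith)
          qed
        next
          case a115: False
          have a2: "2 * \<sigma> \<le> a" using a115 sl by simp
          show ?thesis
          proof (cases "a \<le> 124 / 100")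
            case a124: True
            show ?thesis
            proof (cases "b \<le> 102 / 100")
              case True
              have "1422 / 10000 \<le> b * (\<gamma> - b)"
                using True y195 a124 sl by (intro hb[of "71 / 100" "102 / 100"]) (auto simp: \<gamma> power2_eq_square)
              moreover have "0 \<le> (a - 115 / 100) * (124 / 100 - a)" using a115 a124 by simp
              ultimately have "1 - 49 / 20 * (\<sigma> * a) + 3 / 8 * a\<^sup>2 + 5 / 18 + (689 / 1000) / 2 - 1 / 2 \<le> b * (\<gamma> - b)"
                using pa a115 a124 ab by ((simp only: monomials)?; linarith)
              moreover have "slope \<sigma> a \<le> 548 / 1000"
                using tang2[OF a2 ab(1), of "8 / 10"] pa a124 sl ab by ((simp only: monomials)?; linarith)
              \<comment> \<open>The first number is \<open>1 / (2 - g)\<close> rounded up, for the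
                bound \<open>g = 548 / 1000\<close> on the slope.\<close>
              ultimately show ?thesis using a2 by (intro peeling[of "689 / 1000" "548 / 1000"]) auto
            next
              case False
              then show ?thesis using a115 a124 by (intro mixed) auto
            qed
          next
            case a124: False
            show ?thesis
            proof (cases "b \<le> 1065 / 1000")
              case True
              have h: "1006 / 10000 \<le> b * (\<gamma> - b)"
                using True y195 a135 sl by (intro hb[of "60 / 100" "1065 / 1000"]) (auto simp: \<gamma> power2_eq_square)
              show ?thesis
              proof (cases "a \<le> 13 / 10")
                case a13: True
                have "0 \<le> (a - 124 / 100) * (13 / 10 - a)" using a13 a124 by simp
                then have "1 - 49 / 20 * (\<sigma> * a) + 3 / 8 * a\<^sup>2 + 5 / 18 + (689 / 1000) / 2 - 1 / 2 \<le> b * (\<gamma> - b)"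
                  using h pa a13 a124 ab by ((simp only: monomials)?; linarith)
                moreover have "slope \<sigma> a \<le> 548 / 1000"
                  using tang2[OF a2 ab(1), of "77 / 100"] pa a13 sl ab by ((simp only: monomials)?; linarith)
                ultimately show ?thesis using a2 by (intro peeling[of "689 / 1000" "548 / 1000"]) auto
              next
                case a13: False
                have "0 \<le> (a - 13 / 10) * (135 / 100 - a)" using a13 a135 by simp
                then have "1 - 49 / 20 * (\<sigma> * a) + 3 / 8 * a\<^sup>2 + 5 / 18 + (7 / 10) / 2 - 1 / 2 \<le> b * (\<gamma> - b)"
                  using h pa a13 a135 ab by ((simp only: monomials)?; linarith)
                moreover have "slope \<sigma> a \<le> 57 / 100"
                  using tang2[OF a2 ab(1), of "74 / 100"] pa a135 sl ab by ((simp only: monomials)?; linarith)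
                ultimately show ?thesis using a2 by (intro peeling[of "7 / 10" "57 / 100"]) auto
              qed
            next
              case False
              have b2: "2 * \<sigma> < b" "2 * \<sigma> < a" using False ab sl by auto
              have "0 \<le> (a - 124 / 100) * (135 / 100 - a)" "0 \<le> (b - 1065 / 1000) * (135 / 100 - b)"
                using False a124 a135 ab by auto
              moreover have "qb = 5 / 16 * b\<^sup>2 + \<sigma> * b / 8 + 5 / 36" using b2 s2 by (simp add: qb_def)
              ultimately have "1 - 11 / 5 * (\<sigma> * a) - 11 / 5 * (\<sigma> * b) + 5 / 16 * a\<^sup>2 + \<sigma> * a / 8 + 5 / 36 + qb
                  + (slope \<sigma> a + slope \<sigma> b) / 2 + slope \<sigma> a / 4 \<le> 1 / 4"
                using tang2[OF a2 ab(1), of "8 / 10"] tang2[OF less_imp_le[OF b2(1)] ab(2), of "93 / 100"] b2 pa pb sl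
                  False a124 a135 ab
                by ((simp only: monomials)?; linarith)
              moreover have "0 \<le> slope \<sigma> a * (1 / 2 - m)" using m ga by simp
              ultimately show ?thesis
                using PS[OF b2(2)] split_half_mass[OF nn(1,2,3,5,6) qpr ga(2,1,3) m_def]
                by ((simp only: monomials)?; linarith)
            qed
          qed
        qed
        then show "W U + holes K U U \<le> 1 / 4 + mass K U U / 2" using m by simp
      qed
    qed
  qed
qed

end

section \<open>Small connectivity\<close>

context sep_graph begin

lemma W_le_zero_kernel: "W U + holes (\<lambda>_ _. 0) U U = W U"
  using holes_scale[of 0 "\<lambda>_ _. 0" U U] by simp

lemma W_card: "W U = (1 + excess U)\<^sup>2 - holes (\<lambda>_ _. 1) U U - (2 + \<gamma>) * excess U"
  unfolding W_def by ((simp only: monomials)?; linarith)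

lemma W_adj:
  assumes "finite U"
  shows "W U = real (card {(x, y) \<in> U \<times> U. adj x y}) / (real k)\<^sup>2 - (2 + \<gamma>) * excess U"
proof -
  have "(\<Sum>x\<in>U. \<Sum>y\<in>U. 1 - nadj x y) = (\<Sum>z\<in>U \<times> U. if adj (fst z) (snd z) then 1 else 0)"
    by (auto simp: sum.cartesian_product nadj_def intro!: sum.cong)
  also have "\<dots> = real (card {z \<in> U \<times> U. adj (fst z) (snd z)})"
    using assms by (simp add: sum.If_cases Int_def)
  also have "{z \<in> U \<times> U. adj (fst z) (snd z)} = {(x, y) \<in> U \<times> U. adj x y}" by auto
  finally have "real (card {(x, y) \<in> U \<times> U. adj x y}) = real (card U) * real (card U) - (\<Sum>x\<in>U. \<Sum>y\<in>U. nadj x y)"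
    by (simp add: sum_subtractf)
  then have "real (card {(x, y) \<in> U \<times> U. adj x y}) / (real k)\<^sup>2 = (1 + excess U)\<^sup>2 - holes (\<lambda>_ _. 1) U U"
    using k0 by (simp add: excess_def holes_def mass_def diff_divide_distrib power2_eq_square)
  then show ?thesis unfolding W_card by simp
qed

text \<open>The claim is \<open>W V < 2 + \<gamma>\<close> rewritten. If the excess is below \<tau>,
  then \<open>card V / k < 2 + \<gamma>\<close>, and even all pairs together are too few.\<close>

lemma few_adjacent_pairs:
  assumes V: "V \<noteq> {}" and \<tau>: "0 \<le> \<gamma>" "\<tau> \<le> 1 + \<gamma>" and W: "\<tau> \<le> excess V \<Longrightarrow> W V \<le> 1"
  shows "real (card {(x, y) \<in> V \<times> V. adj x y}) < (2 + \<gamma>) * real k * real (card V)"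
proof -
  define y where "y = 1 + excess V"
  have y: "0 < y" "y * real k = real (card V)" using V finV k0 by (simp_all add: y_def excess_def card_gt_0_iff)
  have "W V < 2 + \<gamma>"
  proof (cases "\<tau> \<le> excess V")
    case True then show ?thesis using W \<tau> by simp
  next
    case False
    have "y * y < (2 + \<gamma>) * y" using False \<tau> y by (intro mult_strict_right_mono) (auto simp: y_def)
    moreover have "0 \<le> holes (\<lambda>_ _. 1) V V" by (intro holes_nonneg) simp
    moreover have "excess V = y - 1" by (simp add: y_def)
    ultimately show ?thesis unfolding W_card by ((simp only: monomials)?; linarith)
  qed
  then have "real (card {(x, y) \<in> V \<times> V. adj x y}) / (real k)\<^sup>2 < (2 + \<gamma>) * y"
    unfolding W_adj[OF finV] y_def by ((simp only: monomials)?; linarith)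
  then have "real (card {(x, y) \<in> V \<times> V. adj x y}) < (2 + \<gamma>) * y * (real k)\<^sup>2"
    using k0 by (simp add: pos_divide_less_eq)
  also have "\<dots> = (2 + \<gamma>) * real k * (y * real k)" by (simp add: power2_eq_square)
  finally show ?thesis using y by simp
qed

lemma reflexive_overlap:
  assumes S: "separation U A B" and U: "U \<subseteq> V"
  shows "holes (\<lambda>_ _. 1) (A \<inter> B) (A \<inter> B) \<le> 1 - 1 / real k"
proof -
  define T where "T = A \<inter> B"
  have T: "finite T" "card T = k" using separation_parts[OF S U] S by (auto simp: T_def separation_def)
  have "(\<Sum>y\<in>T. nadj x y) \<le> real k - 1" if "x \<in> T" for x
  proof -
    have "(\<Sum>y\<in>T. nadj x y) = nadj x x + (\<Sum>y\<in>T - {x}. nadj x y)" using T that by (simp add: sum.remove)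
    also have "\<dots> \<le> 0 + (\<Sum>y\<in>T - {x}. 1)"
      using adj_refl nadj_bounds by (intro add_mono sum_mono) (auto simp: nadj_def)
    also have "\<dots> = real k - 1" using T that k_pos by (simp add: of_nat_diff)
    finally show ?thesis .
  qed
  then have "(\<Sum>x\<in>T. \<Sum>y\<in>T. nadj x y) \<le> (\<Sum>x\<in>T. real k - 1)" by (intro sum_mono) auto
  also have "\<dots> = real k * (real k - 1)" using T by simp
  finally have "holes (\<lambda>_ _. 1) T T \<le> real k * (real k - 1) / (real k)\<^sup>2"
    by (simp add: holes_def mass_def divide_right_mono)
  also have "\<dots> = 1 - 1 / real k" using k0 by (simp add: field_simps power2_eq_square)
  finally show ?thesis by (simp add: T_def)
qed

definition loss :: "nat \<Rightarrow> real" where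
  "loss l = real l / real k * (\<gamma> - real l / real k)"

text \<open>
  Below \<open>J\<close> the bounds come from peeling only; from \<open>J\<close> on, two sides of at least this size can be glued at
  a cost of \<open>1 / k\<close>, since the overlap contains \<open>k\<close> adjacent pairs of equal vertices.
\<close>

lemma bound_by_table:
  assumes \<sigma>: "\<sigma> = 1 / real k"
    and F1: "1 - loss 1 \<le> F 1"
    and F: "\<And>i l. 1 \<le> l \<Longrightarrow> l \<le> i \<Longrightarrow> i < J \<Longrightarrow> F i - loss l \<le> F (i + l)"
    and large: "\<And>i. J \<le> i \<Longrightarrow> F i = c" and J: "\<And>l. l < J \<Longrightarrow> 0 \<le> loss l" and c: "c \<le> 1 / real k"
    and U: "U \<subseteq> V" "card U = k + j" "1 \<le> j"
  shows "W U \<le> F j"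
  using U
proof (induction "card U" arbitrary: U j rule: less_induct)
  case less
  have y: "excess U = real j / real k" using less.prems k0 by (simp add: excess_def add_divide_distrib)
  have nn: "0 \<le> holes (\<lambda>_ _. 1) U U" by (intro holes_nonneg) simp
  show ?case
  proof (cases "j = 1")
    case True
    have "W U \<le> 1 - \<gamma> * excess U + (excess U)\<^sup>2" unfolding W_def using nn by simp
    also have "\<dots> = 1 - loss 1" unfolding loss_def y True by (simp add: algebra_simps power2_eq_square)
    finally show ?thesis using F1 True by simp
  next
    case False
    have "1 < j" using False less.prems by simp
    then have "\<sigma> < excess U" unfolding y \<sigma> using k0 by (simp add: divide_strict_right_mono)
    then obtain A B where S: "separation U A B" and le: "excess B \<le> excess A"
      using separation_ordered less.prems by blast
    note pt = separation_parts[OF S less.prems(1)]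
    define i where "i = card A - k" define l where "l = card B - k"
    have k': "k < card A" "k < card B" using pt(13,14) k0 by (auto simp: excess_def field_simps)
    have eA: "excess A = real i / real k" "excess B = real l / real k"
      using k' k0 by (simp_all add: excess_def i_def l_def of_nat_diff diff_divide_distrib)
    have "real i + real l = real j" using pt(15) k0 unfolding eA y by (simp add: field_simps)
    then have j: "j = i + l" by (metis of_nat_add of_nat_eq_iff)
    have li: "1 \<le> l" "l \<le> i" using le k' k0 unfolding eA by (auto simp: l_def divide_le_cancel)
    have A: "W A \<le> F i" using pt k' li by (intro less.hyps) (auto simp: i_def)
    have B: "W B \<le> F l" using pt k' li by (intro less.hyps) (auto simp: l_def)
    have "mass (\<lambda>_ _. 0 :: real) (B - A) (A - B) = 0" using mass_const[of 0] by simp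
    then have peeled: "W U \<le> W A - loss l"
      using peel[OF S less.prems(1) kernel_const[of 0]] unfolding W_le_zero_kernel eA loss_def by simp
    consider "i < J" | "J \<le> i" "l < J" | "J \<le> l" "J \<le> i" using li by linarith
    then show ?thesis
    proof cases
      case 1 then show ?thesis using F[OF li 1] peeled A j by simp
    next
      case 2 then show ?thesis using J[OF 2(2)] peeled A j large[of i] large[of "i + l"] by simp
    next
      case 3
      then show ?thesis
        using A B W_separation[OF S less.prems(1)] reflexive_overlap[OF S less.prems(1)] c large j
        by simp
    qed
  qed
qed

lemma W_le_one_table:
  assumes k: "\<sigma> = 1 / real k" and \<gamma>: "k = 1 \<and> 1 \<le> \<gamma> \<or> k \<in> {2, 3, 4} \<and> \<gamma> = 1109 / 1000"
    and pos: "0 < excess V"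
  shows "W V \<le> 1"
proof -
  have "k < card V" using pos k0 by (simp add: excess_def field_simps)
  define j where "j = card V - k"
  have j: "card V = k + j" "1 \<le> j" using \<open>k < card V\<close> by (auto simp: j_def)
  consider "k = 1" "1 \<le> \<gamma>" | "k = 2" "\<gamma> = 1109 / 1000" | "k = 3" "\<gamma> = 1109 / 1000" | "k = 4" "\<gamma> = 1109 / 1000"
    using \<gamma> by auto
  then show ?thesis
  proof cases
    case 1
    have loss: "loss l = real l * (\<gamma> - real l)" for l using 1 unfolding loss_def by simp
    have "W V \<le> (\<lambda>_. 1) j"
    proof (rule bound_by_table[OF k, where J = 1 and c = 1])
      show "1 - loss 1 \<le> 1" using 1(2) by (simp add: loss)
      show "0 \<le> loss l" if "l < 1" for l using that by (simp add: loss)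
    qed (use 1 j in auto)
    then show ?thesis by simp
  next
    case 2
    have loss: "loss l = real l / 2 * (1109 / 1000 - real l / 2)" for l
      using 2 unfolding loss_def by simp
    define F :: "nat \<Rightarrow> real" where "F i = (if i = 1 then 7 / 10 else 1 / 2)" for i
    have "W V \<le> F j"
    proof (rule bound_by_table[OF k, where J = 2 and c = "1 / 2"])
      show "F i - loss l \<le> F (i + l)" if "1 \<le> l" "l \<le> i" "i < 2" for i l
      proof -
        have "i = 1" "l = 1" using that by auto
        then show ?thesis by (simp add: F_def loss)
      qed
      show "0 \<le> loss l" if "l < 2" for l
        using that by (auto simp: loss less_2_cases_iff)
      show "1 - loss 1 \<le> F 1" by (simp add: F_def loss)
    qed (use 2 j in \<open>auto simp: F_def\<close>)
    then show ?thesis by (auto simp: F_def split: if_splits)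
  next
    case 3
    have loss: "loss l = real l / 3 * (1109 / 1000 - real l / 3)" for l
      using 3 unfolding loss_def by simp
    define F :: "nat \<Rightarrow> real" where "F i = (if i = 1 then 7415 / 10000 else if i = 2 then 483 / 1000 else 1 / 3)" for i
    have "W V \<le> F j"
    proof (rule bound_by_table[OF k, where J = 3 and c = "1 / 3"])
      show "F i - loss l \<le> F (i + l)" if "1 \<le> l" "l \<le> i" "i < 3" for i l
      proof -
        have "i = 1 \<and> l = 1 \<or> i = 2 \<and> (l = 1 \<or> l = 2)" using that by auto
        then show ?thesis by (auto simp: F_def loss)
      qed
      show "0 \<le> loss l" if "l < 3" for l
      proof -
        have "l = 0 \<or> l = 1 \<or> l = 2" using that by auto
        then show ?thesis by (auto simp: loss)
      qed
      show "1 - loss 1 \<le> F 1" by (simp add: F_def loss)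
    qed (use 3 j in \<open>auto simp: F_def\<close>)
    then show ?thesis by (auto simp: F_def split: if_splits)
  next
    case 4
    have loss: "loss l = real l / 4 * (1109 / 1000 - real l / 4)" for l
      using 4 unfolding loss_def by simp
    \<comment> \<open>The first four entries are the results of the peeling recursion rounded up:
      each is the largest \<open>F i - loss l\<close> over the splits of its index, starting from
      \<open>1 - loss 1\<close>. From index 5 on the recursion is below
      \<open>1 / 4\<close>.\<close>
    define F :: "nat \<Rightarrow> real" where "F i = (if i = 1 then 7853 / 10000 else if i = 2 then 5706 / 10000
      else if i = 3 then 3559 / 10000 else if i = 4 then 2662 / 10000 else 1 / 4)" for i
    have "W V \<le> F j"
    proof (rule bound_by_table[OF k, where J = 5 and c = "1 / 4"])
      show "F i - loss l \<le> F (i + l)" if "1 \<le> l" "l \<le> i" "i < 5" for i l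
      proof -
        have "i = 1 \<and> l = 1 \<or> i = 2 \<and> (l = 1 \<or> l = 2) \<or> i = 3 \<and> (l = 1 \<or> l = 2 \<or> l = 3)
            \<or> i = 4 \<and> (l = 1 \<or> l = 2 \<or> l = 3 \<or> l = 4)" using that by auto
        then show ?thesis by (auto simp: F_def loss)
      qed
      show "0 \<le> loss l" if "l < 5" for l
      proof -
        have "l = 0 \<or> l = 1 \<or> l = 2 \<or> l = 3 \<or> l = 4" using that by auto
        then show ?thesis by (auto simp: loss)
      qed
      show "1 - loss 1 \<le> F 1" by (simp add: F_def loss)
    qed (use 4 j in \<open>auto simp: F_def\<close>)
    then show ?thesis by (auto simp: F_def split: if_splits)
  qed
qed

lemma good_imp_le:
  assumes "good U" shows "W U \<le> 1"
proof -
  have m: "mass (\<lambda>_ _. 0) U U = 0" using mass_const[of 0] by simp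
  show ?thesis using goodD[OF assms kernel_const[of 0]] unfolding W_le_zero_kernel m by simp
qed

end

section \<open>From graphs to separations\<close>

lemma card_edges_le:
  assumes "graph G"
  shows "2 * card (edges G) \<le> card (arcs_ends G)"
proof -
  interpret graph G by fact
  have fin: "finite (arcs_ends G)" by (simp add: arcs_ends_conv)
  define fiber where "fiber e = {(u, v) \<in> arcs_ends G. {u, v} = e}" for e
  have E: "edges G = (\<lambda>(u, v). {u, v}) ` arcs_ends G"
    unfolding edges_def arcs_ends_conv by auto
  have "(\<Sum>e\<in>edges G. 2) \<le> (\<Sum>e\<in>edges G. card (fiber e))"
  proof (intro sum_mono)
    fix e assume "e \<in> edges G"
    then obtain u v where e: "(u, v) \<in> arcs_ends G" "e = {u, v}" unfolding E by auto
    have "u \<noteq> v" using e adj_not_same by blast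
    moreover have "{(u, v), (v, u)} \<subseteq> fiber e" using e graph_symmetric by (auto simp: fiber_def)
    moreover have "finite (fiber e)" unfolding fiber_def by (rule finite_subset[OF _ fin]) auto
    ultimately show "2 \<le> card (fiber e)" using card_mono[of "fiber e" "{(u, v), (v, u)}"] by simp
  qed
  also have "\<dots> = card (\<Union>e\<in>edges G. fiber e)"
    by (rule card_UN_disjoint[symmetric]) (auto simp: E fin fiber_def intro: finite_subset[OF _ fin])
  also have "\<dots> \<le> card (arcs_ends G)" by (rule card_mono[OF fin]) (auto simp: fiber_def)
  finally show ?thesis by simp
qed

lemma not_connected_split:
  assumes "\<not> Digraph_Component.connected H" "verts H \<noteq> {}"
  obtains C D where "C \<union> D = verts H" "C \<inter> D = {}" "C \<noteq> {}" "D \<noteq> {}"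
    "\<And>x y. x \<in> C \<Longrightarrow> y \<in> D \<Longrightarrow> (x, y) \<notin> arcs_ends H"
proof -
  let ?R = "rtrancl_on (verts H) ((arcs_ends H)\<^sup>s)"
  obtain u v where uv: "u \<in> verts H" "v \<in> verts H" "(u, v) \<notin> ?R"
    using assms by (auto simp: connected_conv)
  define C where "C = {w \<in> verts H. (u, w) \<in> ?R}"
  have "(x, y) \<notin> arcs_ends H" if "x \<in> C" "y \<in> verts H - C" for x y
  proof
    assume "(x, y) \<in> arcs_ends H"
    then have "(x, y) \<in> (arcs_ends H)\<^sup>s" by (simp add: symcl_def)
    moreover have ux: "(u, x) \<in> ?R" and y: "y \<in> verts H" using that unfolding C_def by blast+
    ultimately have "(u, y) \<in> ?R" using rtrancl_on_into_rtrancl_on[OF ux _ y] by simp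
    then show False using that unfolding C_def by blast
  qed
  moreover have "u \<in> C" "v \<in> verts H - C" using uv by (auto simp: C_def)
  ultimately show ?thesis by (intro that[of C "verts H - C"]) (auto simp: C_def)
qed

lemma graph_induce_subgraph:
  assumes "graph G" "U \<subseteq> verts G"
  shows "graph (G \<restriction> U)"
proof -
  interpret graph G by fact
  have "digraph (G \<restriction> U)" by (rule digraph_subgraph[OF subgraph_induce_subgraphI[OF assms(2)]])
  moreover have "symmetric (G \<restriction> U)"
    by (rule induced_graph_imp_symmetric[OF sym_arcs induced_induce[OF assms(2)]])
  ultimately show ?thesis by (rule digraph.graphI)
qed

text \<open>A disconnecting set may have fewer than \<open>k\<close> vertices. It is filled up to
  exactly \<open>k\<close>, sparing one vertex \<open>c\<close> and one vertex \<open>d\<close> on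
  the two sides so that both parts remain proper; \<open>k + 2 \<le> card U\<close> leaves enough
  vertices.\<close>

lemma separation_of_exact_order:
  assumes G: "graph G" and U: "U \<subseteq> verts G" "k + 2 \<le> card U" and nc: "\<not> vertex_connected (k + 1) (G \<restriction> U)"
  obtains A B where "A \<union> B = U" "card (A \<inter> B) = k" "A \<noteq> U" "B \<noteq> U"
    "\<And>x y. x \<in> A - B \<Longrightarrow> y \<in> B - A \<Longrightarrow> (x, y) \<notin> arcs_ends G"
proof -
  interpret graph G by fact
  have fU: "finite U" using finite_subset[OF U(1)] by simp
  obtain S where S: "S \<subseteq> U" "card S \<le> k" "\<not> Digraph_Component.connected ((G \<restriction> U) \<restriction> (U - S))"
    using nc U by (auto simp: vertex_connected_def)
  have fS: "finite S" using S fU finite_subset by auto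
  have cUS: "card (U - S) = card U - card S" using S fS by (simp add: card_Diff_subset)
  then have "U - S \<noteq> {}" using S U by auto
  then obtain C D where CD: "C \<union> D = U - S" "C \<inter> D = {}" "C \<noteq> {}" "D \<noteq> {}"
    and no: "\<And>x y. x \<in> C \<Longrightarrow> y \<in> D \<Longrightarrow> (x, y) \<notin> arcs_ends ((G \<restriction> U) \<restriction> (U - S))"
    using not_connected_split[OF S(3)] by auto
  obtain c d where cd: "c \<in> C" "d \<in> D" using CD by auto
  have "card {c, d} \<le> 2" by (simp add: card_insert_if)
  then have "k - card S \<le> card (U - S - {c, d})"
    using cUS U S(2) diff_card_le_card_Diff[of "{c, d}" "U - S"] by simp
  then obtain X where X: "X \<subseteq> U - S - {c, d}" "card X = k - card S"
    by (meson obtain_subset_with_card_n)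
  have fX: "finite X" using X fU finite_subset by blast
  define A where "A = C \<union> S \<union> X" define B where "B = D \<union> S \<union> X"
  have AB: "A \<inter> B = S \<union> X" using CD by (auto simp: A_def B_def)
  show ?thesis
  proof (rule that)
    show "A \<union> B = U" using CD X S by (auto simp: A_def B_def)
    show "card (A \<inter> B) = k" unfolding AB using X S fX fS by (subst card_Un_disjoint) auto
    show "A \<noteq> U" "B \<noteq> U" using cd CD X by (auto simp: A_def B_def)
    show "(x, y) \<notin> arcs_ends G" if "x \<in> A - B" "y \<in> B - A" for x y
    proof
      assume "(x, y) \<in> arcs_ends G"
      moreover have xy: "x \<in> C" "y \<in> D" using that by (auto simp: A_def B_def)
      moreover have "x \<in> U - S" "y \<in> U - S" using xy CD by auto
      ultimately have "(x, y) \<in> arcs_ends ((G \<restriction> U) \<restriction> (U - S))" by (auto simp: arcs_ends_conv)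
      then show False using no xy by simp
    qed
  qed
qed

text \<open>The \<open>- 1\<close> in the degree condition is made up for by the reflexive pairs,
  one for each vertex.\<close>

lemma adjacent_pairs_ge:
  assumes G: "graph G" and k: "0 < k" and d: "\<delta> * real k - 1 \<le> average_degree G" "1 < \<delta> * real k"
  defines "adj \<equiv> \<lambda>u v. u = v \<or> (u, v) \<in> arcs_ends G"
  shows "verts G \<noteq> {}" "\<delta> * real k * real (card (verts G)) \<le> real (card {(x, y) \<in> verts G \<times> verts G. adj x y})"
proof -
  interpret graph G by fact
  define n where "n = card (verts G)"
  have n: "0 < n" using d by (cases "n = 0") (auto simp: average_degree_def n_def)
  then show "verts G \<noteq> {}" by (auto simp: n_def)
  have e: "{(x, y) \<in> verts G \<times> verts G. adj x y} = Id_on (verts G) \<union> arcs_ends G"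
    by (auto simp: adj_def arcs_ends_conv)
  have "card (Id_on (verts G)) = n"
    using card_image[of "\<lambda>x. (x, x)" "verts G"] by (simp add: n_def inj_on_def Id_on_def UNION_singleton_eq_range)
  moreover have "card (Id_on (verts G) \<union> arcs_ends G) = card (Id_on (verts G)) + card (arcs_ends G)"
    by (rule card_Un_disjoint) (auto simp: arcs_ends_conv Id_on_def dest: no_loops)
  ultimately have "n + 2 * card (edges G) \<le> card {(x, y) \<in> verts G \<times> verts G. adj x y}"
    using card_edges_le[OF G] unfolding e by simp
  then have "real (n + 2 * card (edges G)) \<le> real (card {(x, y) \<in> verts G \<times> verts G. adj x y})"
    by (simp only: of_nat_le_iff)
  then have 1: "real n + 2 * real (card (edges G)) \<le> real (card {(x, y) \<in> verts G \<times> verts G. adj x y})"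
    by (simp only: of_nat_add of_nat_mult of_nat_numeral)
  have "(\<delta> * real k - 1) * real n \<le> 2 * real (card (edges G))"
    using d(1) n unfolding average_degree_def n_def[symmetric] by (simp add: pos_le_divide_eq)
  then show "\<delta> * real k * real (card (verts G)) \<le> real (card {(x, y) \<in> verts G \<times> verts G. adj x y})"
    using 1 unfolding n_def[symmetric] by (simp add: algebra_simps)
qed

lemma sep_graph_of_digraph:
  assumes G: "graph G" and k: "0 < k" and s: "0 < s" "1 \<le> s * real k"
    and nc: "\<And>U. U \<subseteq> verts G \<Longrightarrow> (1 + s) * real k < real (card U) \<Longrightarrow> \<not> vertex_connected (k + 1) (G \<restriction> U)"
  shows "sep_graph (verts G) (\<lambda>u v. u = v \<or> (u, v) \<in> arcs_ends G) k s"
proof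
  interpret graph G by fact
  show "finite (verts G)" by simp
  show "\<exists>A B. A \<union> B = U \<and> card (A \<inter> B) = k \<and> A \<noteq> U \<and> B \<noteq> U \<and>
      (\<forall>x\<in>A - B. \<forall>y\<in>B - A. \<not> (x = y \<or> (x, y) \<in> arcs_ends G))"
    if U: "U \<subseteq> verts G" "(1 + s) * real k < real (card U)" for U
  proof -
    \<comment> \<open>The assumption \<open>1 \<le> s * k\<close> enters here: it provides the
      \<open>k + 2\<close> vertices needed to fill up a separator.\<close>
    have "real (k + 1) < real (card U)" using U(2) s(2) by (simp add: distrib_right)
    then have "k + 2 \<le> card U" by (simp only: of_nat_less_iff)
    from separation_of_exact_order[OF G U(1) this nc[OF U]] show ?thesis by (metis DiffD1 DiffD2)
  qed
  show "v = u \<or> (v, u) \<in> arcs_ends G" if "u = v \<or> (u, v) \<in> arcs_ends G" for u v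
    using that graph_symmetric by auto
qed (use k s in auto)

text \<open>With \<open>c = sqrt (2 / 3)\<close> and \<open>f = 1 / sqrt 3\<close> the threshold of
  the first alternative is \<open>c + f\<close>, and beyond it
  \<open>(s - c)\<^sup>2 \<ge> f\<^sup>2 = 1 / 3\<close>, which rearranges to
  \<open>2 * c \<le> s + 1 / (3 * s)\<close>.\<close>

lemma sqrt_constants:
  fixes s d :: real
  shows "(sqrt 2 + 1) / sqrt 3 \<le> s \<Longrightarrow> sqrt (2 / 3) \<le> s \<and> 1 \<le> s \<and> 2 * sqrt (2 / 3) \<le> s + 1 / (3 * s)"
    and "s = 1 / 3 * sqrt (5 / 2) \<Longrightarrow> sigma2 s"
    and "s = 1 / 3 * sqrt (5 / 2) \<Longrightarrow> d = 2 + 11 / 3 * sqrt (1 / 10) \<Longrightarrow> d = 2 + 11 / 5 * s"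
proof -
  show "sqrt (2 / 3) \<le> s \<and> 1 \<le> s \<and> 2 * sqrt (2 / 3) \<le> s + 1 / (3 * s)" if "(sqrt 2 + 1) / sqrt 3 \<le> s"
  proof -
    define c where "c = sqrt (2 / 3)"
    define f where "f = 1 / sqrt 3"
    have cf: "0 < c" "0 < f" "c\<^sup>2 = 2 / 3" "f\<^sup>2 = 1 / 3" by (auto simp: c_def f_def power_divide)
    have "(sqrt 2 + 1) / sqrt 3 = c + f" by (simp add: c_def f_def real_sqrt_divide add_divide_distrib)
    then have s: "c + f \<le> s" using that by simp
    have "0 \<le> c * f" using cf by simp
    then have "1\<^sup>2 \<le> (c + f)\<^sup>2" using cf(1,2) unfolding power2_sum cf(3,4) by simp
    then have "1 \<le> c + f" using cf by (intro power2_le_imp_le[of 1]) auto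
    then have s1: "1 \<le> s" using s by simp
    have "0 \<le> (s - c - f) * (s - c + f)" using s cf by auto
    also have "\<dots> = (s - c)\<^sup>2 - f\<^sup>2" by algebra
    finally have "2 * c * s \<le> s\<^sup>2 + 1 / 3" using cf by (simp add: power2_diff algebra_simps)
    then have "2 * c \<le> s + 1 / (3 * s)" using s1 by (simp add: field_simps power2_eq_square)
    then show ?thesis using s s1 cf by (simp add: c_def)
  qed
  have sq: "(1 / 3 * sqrt (5 / 2))\<^sup>2 = 5 / (18 :: real)" by (simp add: power_mult_distrib power_divide)
  show "sigma2 s" if s: "s = 1 / 3 * sqrt (5 / 2)"
  proof
    show s2: "s\<^sup>2 = 5 / 18" unfolding s by (rule sq)
    have s0: "0 \<le> s" unfolding s by simp
    show "5270462 / 10000000 \<le> s" by (rule power2_le_imp_le[OF _ s0]) (simp add: s2 power_divide)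
    show "s \<le> 5270463 / 10000000" by (rule power2_le_imp_le) (simp_all add: s2 power_divide)
  qed
  show "d = 2 + 11 / 5 * s" if s: "s = 1 / 3 * sqrt (5 / 2)" and d: "d = 2 + 11 / 3 * sqrt (1 / 10)"
  proof -
    have "sqrt (5 / 2) = 5 * sqrt (1 / 10)"
    proof (rule real_sqrt_unique)
      show "(5 * sqrt (1 / 10))\<^sup>2 = 5 / (2 :: real)" by (simp add: power_mult_distrib power_divide)
    qed simp
    then show ?thesis using s d by simp
  qed
qed

theorem theorem1:
  fixes k :: nat and \<sigma> \<delta> :: real and G :: "('a, 'b) pre_digraph"
  assumes "k > 0"
    and "(\<sigma> \<ge> (sqrt 2 + 1) / sqrt 3 \<and> \<delta> = 2 + \<sigma> + 1 / (3 * \<sigma>)) \<or>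
         (\<sigma> = 1 / 3 * sqrt (5 / 2) \<and> \<delta> = 2 + 11 / 3 * sqrt (1 / 10)) \<or>
         (\<sigma> = 0.2 \<and> \<delta> = 3.109)"
    and "graph G"
    and "average_degree G \<ge> \<delta> * real k - 1"
  shows "\<exists>H. subgraph H G \<and> graph H \<and> vertex_connected (k + 1) H \<and>
             real (card (verts H)) > (1 + \<sigma>) * real k"
proof (rule ccontr)
  assume none: "\<not> ?thesis"
  interpret G: graph G by fact
  have nc: "\<not> vertex_connected (k + 1) (G \<restriction> U)" if "U \<subseteq> verts G" "(1 + \<sigma>) * real k < real (card U)" for U
    using none that graph_induce_subgraph[OF assms(3) that(1)] G.subgraph_induce_subgraphI[OF that(1)] by auto
  \<comment> \<open>If \<open>\<sigma> k < 1\<close>, all sets of at least \<open>k + 2\<close> vertices are separable, as for \<open>\<sigma> = 1 / k\<close>.\<close>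
  define s where "s = (if 1 \<le> \<sigma> * real k then \<sigma> else 1 / real k)"
  define g where "g = \<delta> - 2"
  have k1: "1 \<le> real k" using assms(1) by simp
  have \<sigma>0: "0 < \<sigma>"
    using assms(2)
  proof (elim disjE conjE)
    assume "(sqrt 2 + 1) / sqrt 3 \<le> \<sigma>" then show ?thesis using sqrt_constants(1)[of \<sigma>] by simp
  next
    assume "\<sigma> = 1 / 3 * sqrt (5 / 2)"
    then interpret s2: sigma2 \<sigma> by (rule sqrt_constants(2))
    show ?thesis using s2.s_lo by simp
  qed simp_all
  have s: "0 < s" "1 \<le> s * real k" "\<sigma> \<le> s"
    using assms(1) \<sigma>0 by (auto simp: s_def field_simps)
  have ncs: "\<not> vertex_connected (k + 1) (G \<restriction> U)" if "U \<subseteq> verts G" "(1 + s) * real k < real (card U)" for U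
  proof (rule nc[OF that(1)])
    have "(1 + \<sigma>) * real k \<le> (1 + s) * real k" using s by (intro mult_right_mono) auto
    then show "(1 + \<sigma>) * real k < real (card U)" using that by simp
  qed
  interpret sep_graph "verts G" "\<lambda>u v. u = v \<or> (u, v) \<in> arcs_ends G" k s g
    by (rule sep_graph_of_digraph[OF assms(3,1) s(1,2) ncs])
  have "\<exists>\<tau>. 0 \<le> g \<and> \<tau> \<le> 1 + g \<and> (\<tau> \<le> excess (verts G) \<longrightarrow> W (verts G) \<le> 1)"
  proof (cases "1 \<le> \<sigma> * real k")
    case True
    then have s\<sigma>: "s = \<sigma>" by (simp add: s_def)
    from assms(2) show ?thesis
    proof (elim disjE conjE)
      assume a: "(sqrt 2 + 1) / sqrt 3 \<le> \<sigma>" "\<delta> = 2 + \<sigma> + 1 / (3 * \<sigma>)"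
      note c = sqrt_constants(1)[OF a(1)]
      have m: "mass (\<lambda>_ _. 0) (verts G) (verts G) = 0" using mass_const[of 0] by simp
      have g: "g = s + 1 / (3 * s)" using a(2) by (simp add: g_def s\<sigma>)
      have "W (verts G) \<le> 1" if y: "1 / (3 * s) \<le> excess (verts G)"
      proof -
        have "W (verts G) + holes (\<lambda>_ _. 0) (verts G) (verts G) \<le> 2 / 3"
        proof (rule bound_case1[OF _ _ _ _ _ g subset_refl y kernel_const])
          show "sqrt (2 / 3) \<le> s" "2 * sqrt (2 / 3) \<le> g" using c by (simp_all only: s\<sigma> g)
          show "1 / (3 * s) * s = 1 / 3" using s by simp
        qed (auto simp: m)
        then show ?thesis unfolding W_le_zero_kernel by simp
      qed
      moreover have "0 \<le> g" "1 / (3 * s) \<le> 1 + g" using s unfolding g by simp_all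
      ultimately show ?thesis by (intro exI conjI impI)
    next
      assume a: "\<sigma> = 1 / 3 * sqrt (5 / 2)" "\<delta> = 2 + 11 / 3 * sqrt (1 / 10)"
      have g: "g = 11 / 5 * s" using sqrt_constants(3)[OF a] by (simp add: g_def s\<sigma>)
      have s2: "sigma2 s" using sqrt_constants(2)[OF a(1)] s\<sigma> by simp
      then interpret s2: sigma2 s .
      have "0 \<le> g" "135 / 100 \<le> 1 + g" using s2.s_lo unfolding g by simp_all
      then show ?thesis using good_imp_le[OF good_case2[OF s2 g subset_refl]] by (intro exI conjI impI)
    next
      assume a: "\<sigma> = 0.2" "\<delta> = 3.109"
      have sg: "s = 1 / 5" "g = 1109 / 1000" using a s\<sigma> by (simp_all add: g_def)
      have "0 \<le> g" "12308 / 10000 \<le> 1 + g" unfolding sg(2) by simp_all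
      then show ?thesis using good_imp_le[OF good_case3[OF sg subset_refl]] by (intro exI conjI impI)
    qed
  next
    case False
    then have sk: "s = 1 / real k" by (simp add: s_def)
    \<comment> \<open>Only few cases have \<open>\<sigma> * k < 1\<close>: none in the first
      alternative, where \<open>\<sigma> \<ge> 1\<close>; \<open>k = 1\<close> in the second, where
      \<open>\<sigma> > 1 / 2\<close>; and \<open>k \<le> 4\<close> in the third.\<close>
    have kg: "k = 1 \<and> 1 \<le> g \<or> k \<in> {2, 3, 4} \<and> g = 1109 / 1000"
      using assms(2)
    proof (elim disjE conjE)
      assume a: "(sqrt 2 + 1) / sqrt 3 \<le> \<sigma>"
      then have "1 * 1 \<le> \<sigma> * real k" using sqrt_constants(1)[OF a] k1 by (intro mult_mono) auto
      then show ?thesis using False by simp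
    next
      assume a: "\<sigma> = 1 / 3 * sqrt (5 / 2)" "\<delta> = 2 + 11 / 3 * sqrt (1 / 10)"
      interpret s2: sigma2 \<sigma> using sqrt_constants(2)[OF a(1)] .
      have "k = 1"
      proof (rule ccontr)
        assume "k \<noteq> 1"
        then have "2 \<le> real k" using assms(1) by simp
        then have "(1 / 2) * 2 \<le> \<sigma> * real k" using s2.s_lo by (intro mult_mono) auto
        then show False using False by simp
      qed
      then show ?thesis using sqrt_constants(3)[OF a] s2.s_lo by (simp add: g_def)
    next
      assume a: "\<sigma> = 0.2" "\<delta> = 3.109"
      then have "real k < 5" using False by (simp add: a(1))
      then have "k \<in> {1, 2, 3, 4}" using assms(1) by auto
      then show ?thesis using a by (auto simp: g_def)
    qed
    then show ?thesis using W_le_one_table[OF sk kg] kg by (intro exI[of _ 1]) auto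
  qed
  then obtain \<tau> where "0 \<le> g" "\<tau> \<le> 1 + g" "\<tau> \<le> excess (verts G) \<Longrightarrow> W (verts G) \<le> 1" by blast
  note few = few_adjacent_pairs[OF _ this]
  have "1 < \<delta> * real k"
  proof -
    have "1 * 1 < (2 + g) * real k" using \<open>0 \<le> g\<close> k1 by (intro mult_less_le_imp_less) auto
    then show ?thesis by (simp add: g_def)
  qed
  from adjacent_pairs_ge[OF assms(3,1) assms(4) this] few show False by (simp add: g_def)
qed

end
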